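(* Let $S\in\mathcal{CPMM}$ be of operator type, with Markov partition $\mathcal P$ and transition matrix $M=M(S)$ with respect to $\mathcal P$. If $M$ represents an operator $\mathcal M$ on $\ell^1(\mathcal P)$ whose spectral radius equals $\lambda_S:=\lambda_M$ (the Perron value of $M$), then any centralized recurrent perturbation $T$ of $S$ (on some $\mathcal P'\subset\mathcal P$) such that $h_{top}(T)>h_{top}(S)$ is linearizable. The entropy assumption $h_{top}(T)>h_{top}(S)$ is always satisfied when $S$ is recurrent.
   Context: A continuous map on a closed interval is piecewise monotone if the interval splits into finitely many subintervals on each of which the map is monotone. A Markov partition for a continuous map $T:[0,1]\to[0,1]$ is a finite or countably infinite collection $\mathcal P$ of closed nondegenerate subintervals of $[0,1]$ such that: (1) distinct elements of $\mathcal P$ have disjoint interiors and $[0,1]\setminus\bigcup\mathcal P$ is at most countable; (2) $T|_i$ is monotone for each $i\in\mathcal P$ (classical), or piecewise monotone for each $i\in\mathcal P$ (slack); (3) for all $i,j\in\mathcal P$ and every maximal interval $i'\subset i$ of monotonicity of $T$, if $T(i')\cap j^\circ\ne\emptyset$ then $T(i')\supset j$. $\mathcal{CPMM}$ is the set of continuous maps $T:[0,1]\to[0,1]$ that are topologically mixing (for all nonempty open $U,V$ there is $n$ with $T^m(U)\cap V\neq\emptyset$ for all $m\ge n$), admit a countably infinite Markov partition, and have finite topological entropy $h_{top}(T)<\infty$. $T\in\mathcal{CPMM}$ is of operator type if there is $K>0$ with $\#T^{-1}(y)\le K$ for all $y\in[0,1]$. Transition matrix of $T$ with respect to $\mathcal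 P$: $M=(m_{ij})_{i,j\in\mathcal P}$, where $m_{ij}=0$ if $T(i)\not\supset j$, and otherwise $m_{ij}$ is the maximal number of intervals $i_1,\dots,i_\kappa\subset i$ with pairwise disjoint interiors such that each $T|_{i_\ell}$ is monotone and $T(i_\ell)\supset j$ (this number is finite). It is irreducible and aperiodic. If $\sup_j\sum_i m_{ij}<\infty$ (which holds exactly when the map is of operator type), $M$ represents the bounded operator $\mathcal M(v)=\big(\sum_j m_{ij}v_j\big)_{i}$ on $\ell^1(\mathcal P)$, with norm $\sup_j\sum_i m_{ij}$ and spectral radius $\lim_n\|\mathcal M^n\|^{1/n}$. For an irreducible aperiodic nonnegative matrix $M$ with powers $M^n=(m_{ij}(n))$, let $R$ be the common radius of convergence of the series $\sum_{n\ge0}m_{ij}(n)z^n$; the Perron value is $\lambda_M=1/R=\lim_n[m_{ij}(n)]^{1/n}$, assumed finite. Let $f_{ij}(1)=m_{ij}$, $f_{ij}(n+1)=\sum_{\alpha\ne j}m_{i\alpha}f_{\alpha j}(n)$ and $F_{ij}(z)=\sum_{n\ge1}f_{ij}(n)z^n$. $M$ is recurrent if $F_{ii}(R)=1$ and transient if $F_{ii}(R)<1$ (independently of $i$). A map in $\mathcal{CPMM}$ is called recurrent if its transition matrix is recurrent; this does not depend on the choice of the Markov partition. Perturbation on $\mathcal P'$: let $S\in\mathcal{CPMM}$ with Markov partition $\mathcal P$ and let $\mathcal P'\subset\mathcal P$ (possibly infinite) be such that $S|_j$ is monotone for each $j\in\mathcal P'$. $T\in\mathcal{CPMM}$ is a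 (window) perturbation of $S$ on $\mathcal P'$ if $T=S$ on $[0,1]\setminus\bigcup_{j\in\mathcal P'}j^\circ$ and for each $j\in\mathcal P'$ there are $k_j\in\mathbb N$ (the order, depending on $j$) and a nontrivial partition $(j_i)_{i=1}^{2k_j+1}$ of $j$ into subintervals such that $T(j_i)=S(j)$ and $T|_{j_i}$ is monotone for each $i$. It is centralized if there is an interval $[a,b]$ with $a,b\in(0,1)\setminus\bigcup_{i\in\mathcal P}i^\circ$ and $\bigcup\mathcal P'\subset[a,b]$. For technical reasons the empty perturbation $T=S$ is also considered as centralized. A continuous interval map has constant slope $s$ if its derivative has absolute value $s$ at all but countably many points. A map $T:[0,1]\to[0,1]$ is linearizable if it is topologically conjugate to an interval map of constant slope $e^{h_{top}(T)}$.
   Formalization: The closing claim that the entropy assumption always holds when S is recurrent is stated only for perturbations on a nonempty P'; the empty perturbation T=S also counts as centralized, and for it h_top(T)>h_top(S) is false. *)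

theory Defs
  imports "HOL-Analysis.Analysis"
begin

section \<open>Topological dynamics\<close>

definition topologically_mixing :: "'a::topological_space set \<Rightarrow> ('a \<Rightarrow> 'a) \<Rightarrow> bool" where
  "topologically_mixing X T \<longleftrightarrow>
    (\<forall>U V. openin (top_of_set X) U \<and> U \<noteq> {} \<and> openin (top_of_set X) V \<and> V \<noteq> {} \<longrightarrow>
      (\<exists>n. \<forall>m\<ge>n. (T ^^ m) ` U \<inter> V \<noteq> {}))"

definition dyn_separated :: "'a::metric_space set \<Rightarrow> ('a \<Rightarrow> 'a) \<Rightarrow> nat \<Rightarrow> real \<Rightarrow> 'a set \<Rightarrow> bool" where
  "dyn_separated X T n \<epsilon> E \<longleftrightarrow> E \<subseteq> X \<and>
    (\<forall>x\<in>E. \<forall>y\<in>E. x \<noteq> y \<longrightarrow> (\<exists>k<n. dist ((T ^^ k) x) ((T ^^ k) y) > \<epsilon>))"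

text \<open>Bowen's definition of the entropy of a continuous self-map of a compact space. The logarithm
  of the largest cardinality of an \<open>(n, \<epsilon>)\<close>-separated set is a supremum over the finite ones;
  the empty set contributes \<open>ln 0 = 0\<close>, just as singletons do. The limit for \<open>\<epsilon>\<close> tending to \<open>0\<close> is
  a supremum because the expression is monotone in \<open>\<epsilon>\<close>.\<close>

definition topological_entropy :: "'a::metric_space set \<Rightarrow> ('a \<Rightarrow> 'a) \<Rightarrow> ereal" where
  "topological_entropy X T =
    (SUP \<epsilon>\<in>{0<..}. limsup (\<lambda>n.
      (SUP E\<in>{E. finite E \<and> dyn_separated X T n \<epsilon> E}. ereal (ln (real (card E)))) / ereal (real n)))"

definition topologically_conjugate ::
  "'a::topological_space set \<Rightarrow> ('a \<Rightarrow> 'a) \<Rightarrow> 'b::topological_space set \<Rightarrow> ('b \<Rightarrow> 'b) \<Rightarrow> bool" where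
  "topologically_conjugate X T Y g \<longleftrightarrow>
    (\<exists>\<psi> \<phi>. homeomorphism X Y \<psi> \<phi> \<and> (\<forall>x\<in>X. \<psi> (T x) = g (\<psi> x)))"


section \<open>Interval maps and Markov partitions\<close>

text \<open>A map of the unit interval is represented by a function on the reals of which only the values
  on \<open>{0..1}\<close> matter.\<close>

definition interval_map :: "(real \<Rightarrow> real) \<Rightarrow> bool" where
  "interval_map T \<longleftrightarrow> continuous_on {0..1} T \<and> T ` {0..1} \<subseteq> {0..1}"

abbreviation h_top :: "(real \<Rightarrow> real) \<Rightarrow> ereal" where
  "h_top T \<equiv> topological_entropy {0..1} T"

definition monotone_map_on :: "real set \<Rightarrow> (real \<Rightarrow> real) \<Rightarrow> bool" where
  "monotone_map_on A T \<longleftrightarrow> mono_on A T \<or> antimono_on A T"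

definition piecewise_monotone_on :: "real set \<Rightarrow> (real \<Rightarrow> real) \<Rightarrow> bool" where
  "piecewise_monotone_on A T \<longleftrightarrow> (\<exists>J. J division_of A \<and> (\<forall>K\<in>J. monotone_map_on K T))"

definition maximal_monotone_interval :: "(real \<Rightarrow> real) \<Rightarrow> real set \<Rightarrow> real set \<Rightarrow> bool" where
  "maximal_monotone_interval T i i' \<longleftrightarrow>
    is_interval i' \<and> i' \<noteq> {} \<and> i' \<subseteq> i \<and> monotone_map_on i' T \<and>
    (\<forall>K. is_interval K \<and> i' \<subseteq> K \<and> K \<subseteq> i \<and> monotone_map_on K T \<longrightarrow> K = i')"

text \<open>Markov partitions in the slack sense; since monotone maps are piecewise monotone, the classical
  ones are included.\<close>

definition markov_partition :: "(real \<Rightarrow> real) \<Rightarrow> real set set \<Rightarrow> bool" where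
  "markov_partition T P \<longleftrightarrow>
    countable P \<and>
    (\<forall>i\<in>P. \<exists>a b. 0 \<le> a \<and> a < b \<and> b \<le> 1 \<and> i = {a..b}) \<and>
    (\<forall>i\<in>P. \<forall>j\<in>P. i \<noteq> j \<longrightarrow> interior i \<inter> interior j = {}) \<and>
    countable ({0..1} - \<Union>P) \<and>
    (\<forall>i\<in>P. piecewise_monotone_on i T) \<and>
    (\<forall>i\<in>P. \<forall>j\<in>P. \<forall>i'. maximal_monotone_interval T i i' \<longrightarrow>
      T ` i' \<inter> interior j \<noteq> {} \<longrightarrow> j \<subseteq> T ` i')"

definition CPMM :: "(real \<Rightarrow> real) set" where
  "CPMM = {T. interval_map T \<and> topologically_mixing {0..1} T \<and>
    (\<exists>P. markov_partition T P \<and> infinite P) \<and> h_top T < \<infinity>}"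

definition operator_type :: "(real \<Rightarrow> real) \<Rightarrow> bool" where
  "operator_type T \<longleftrightarrow>
    (\<exists>K::nat. K > 0 \<and> (\<forall>y\<in>{0..1}. finite {x\<in>{0..1}. T x = y} \<and> card {x\<in>{0..1}. T x = y} \<le> K))"

definition transition_matrix :: "(real \<Rightarrow> real) \<Rightarrow> real set \<Rightarrow> real set \<Rightarrow> real" where
  "transition_matrix T i j =
    (if j \<subseteq> T ` i
     then real (Max {card I | I. finite I \<and>
       (\<forall>K\<in>I. is_interval K \<and> K \<subseteq> i \<and> monotone_map_on K T \<and> j \<subseteq> T ` K) \<and>
       (\<forall>K\<in>I. \<forall>L\<in>I. K \<noteq> L \<longrightarrow> interior K \<inter> interior L = {})})
     else 0)"


section \<open>Countable nonnegative matrices\<close>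

text \<open>Powers and generating functions are computed in \<open>[0, \<infinity>]\<close>, where all sums exist. The matrix
  \<open>M\<close> is indexed by \<open>P\<close>; its values outside \<open>P\<close> are ignored.\<close>

primrec mat_power :: "'a set \<Rightarrow> ('a \<Rightarrow> 'a \<Rightarrow> real) \<Rightarrow> nat \<Rightarrow> 'a \<Rightarrow> 'a \<Rightarrow> ennreal" where
  "mat_power P M 0 i j = (if i = j then 1 else 0)"
| "mat_power P M (Suc n) i j = (\<Sum>\<^sub>\<infinity>\<alpha>\<in>P. ennreal (M i \<alpha>) * mat_power P M n \<alpha> j)"

fun first_passage :: "'a set \<Rightarrow> ('a \<Rightarrow> 'a \<Rightarrow> real) \<Rightarrow> nat \<Rightarrow> 'a \<Rightarrow> 'a \<Rightarrow> ennreal" where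
  "first_passage P M 0 i j = 0"
| "first_passage P M (Suc 0) i j = ennreal (M i j)"
| "first_passage P M (Suc (Suc n)) i j =
    (\<Sum>\<^sub>\<infinity>\<alpha>\<in>P - {j}. ennreal (M i \<alpha>) * first_passage P M (Suc n) \<alpha> j)"

definition first_passage_series :: "'a set \<Rightarrow> ('a \<Rightarrow> 'a \<Rightarrow> real) \<Rightarrow> 'a \<Rightarrow> 'a \<Rightarrow> ennreal \<Rightarrow> ennreal" where
  "first_passage_series P M i j z = (\<Sum>n. first_passage P M (Suc n) i j * z ^ Suc n)"

definition ennreal_conv_radius :: "(nat \<Rightarrow> ennreal) \<Rightarrow> ennreal" where
  "ennreal_conv_radius a = Sup {r. (\<Sum>n. a n * r ^ n) < \<infinity>}"

lemma enn2ereal_ennreal_conv_radius: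
  fixes b :: "nat \<Rightarrow> real"
  assumes nonneg: "\<And>n. b n \<ge> 0"
  shows "enn2ereal (ennreal_conv_radius (\<lambda>n. ennreal (b n))) = conv_radius b"
proof -
  have key: "(\<Sum>n. ennreal (b n) * ennreal r ^ n) < \<infinity> \<longleftrightarrow> summable (\<lambda>n. b n * r ^ n)"
    if "r \<ge> 0" for r :: real
  proof -
    have eq: "(\<lambda>n. ennreal (b n) * ennreal r ^ n) = (\<lambda>n. ennreal (b n * r ^ n))"
      using that nonneg by (simp add: ennreal_power ennreal_mult)
    show ?thesis
      unfolding eq infinity_ennreal_def less_top[symmetric]
      using that nonneg
      by (auto simp: suminf_ennreal2 intro: summable_suminf_not_top)
  qed
  define R where "R = ennreal_conv_radius (\<lambda>n. ennreal (b n))"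
  have "R = e2ennreal (conv_radius b)"
  proof (rule antisym)
    show "R \<le> e2ennreal (conv_radius b)"
    proof (rule dense_ge)
      fix x assume x: "e2ennreal (conv_radius b) < x"
      show "R \<le> x" unfolding R_def ennreal_conv_radius_def
      proof (rule Sup_least, rule ccontr)
        fix r assume r: "r \<in> {r. (\<Sum>n. ennreal (b n) * r ^ n) < \<infinity>}" and "\<not> r \<le> x"
        then have "x < r" by simp
        then obtain t where t: "x = ennreal t" "t \<ge> 0"
          by (cases x) auto
        have "(\<Sum>n. ennreal (b n) * x ^ n) \<le> (\<Sum>n. ennreal (b n) * r ^ n)"
          using \<open>x < r\<close> by (intro suminf_le mult_left_mono power_mono) auto
        then have "(\<Sum>n. ennreal (b n) * ennreal t ^ n) < \<infinity>" using r t by (auto intro: le_less_trans)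
        then have s: "summable (\<lambda>n. b n * t ^ n)" using key t by blast
        have "\<not> ereal t \<le> conv_radius b"
          using x t e2ennreal_mono[of "ereal t" "conv_radius b"] by (auto simp: e2ennreal_ereal)
        then have "conv_radius b < ereal t" by simp
        then show False
          using not_summable_outside_conv_radius[of b t] s t by auto
      qed
    qed
    show "e2ennreal (conv_radius b) \<le> R"
    proof (rule dense_le)
      fix x assume x: "x < e2ennreal (conv_radius b)"
      then obtain t where t: "x = ennreal t" "t \<ge> 0"
        by (cases x) auto
      have "\<not> conv_radius b \<le> ereal t"
        using x t e2ennreal_mono[of "conv_radius b" "ereal t"] by (auto simp: e2ennreal_ereal)
      then have "ereal t < conv_radius b" by simp
      then have "summable (\<lambda>n. b n * t ^ n)"
        using summable_in_conv_radius[of t b] t by auto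
      then show "x \<le> R" unfolding R_def ennreal_conv_radius_def using key t
        by (intro Sup_upper) auto
    qed
  qed
  then show ?thesis using conv_radius_nonneg[of b] by (simp add: R_def enn2ereal_e2ennreal)
qed

text \<open>For an irreducible matrix the radius of convergence does not depend on the entry.\<close>

definition common_conv_radius :: "'a set \<Rightarrow> ('a \<Rightarrow> 'a \<Rightarrow> real) \<Rightarrow> ennreal" where
  "common_conv_radius P M =
    (THE R. \<forall>i\<in>P. \<forall>j\<in>P. ennreal_conv_radius (\<lambda>n. mat_power P M n i j) = R)"

definition perron_value :: "'a set \<Rightarrow> ('a \<Rightarrow> 'a \<Rightarrow> real) \<Rightarrow> ennreal" where
  "perron_value P M = 1 / common_conv_radius P M"

text \<open>The Perron value of a recurrent matrix is automatically finite, as the series vanishes at \<open>0\<close>.\<close>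

definition recurrent_matrix :: "'a set \<Rightarrow> ('a \<Rightarrow> 'a \<Rightarrow> real) \<Rightarrow> bool" where
  "recurrent_matrix P M \<longleftrightarrow>
    (\<forall>i\<in>P. first_passage_series P M i i (common_conv_radius P M) = 1)"

definition recurrent_map :: "(real \<Rightarrow> real) \<Rightarrow> bool" where
  "recurrent_map T \<longleftrightarrow> (\<exists>P. markov_partition T P \<and> recurrent_matrix P (transition_matrix T))"


section \<open>Operators on \<open>\<ell>\<^sup>1(P)\<close>\<close>

definition l1_space :: "'a set \<Rightarrow> ('a \<Rightarrow> real) set" where
  "l1_space P = {v. (\<lambda>i. \<bar>v i\<bar>) summable_on P \<and> (\<forall>i. i \<notin> P \<longrightarrow> v i = 0)}"

definition l1_norm :: "'a set \<Rightarrow> ('a \<Rightarrow> real) \<Rightarrow> real" where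
  "l1_norm P v = (\<Sum>\<^sub>\<infinity>i\<in>P. \<bar>v i\<bar>)"

definition matrix_operator :: "'a set \<Rightarrow> ('a \<Rightarrow> 'a \<Rightarrow> real) \<Rightarrow> ('a \<Rightarrow> real) \<Rightarrow> 'a \<Rightarrow> real" where
  "matrix_operator P M v = (\<lambda>i. if i \<in> P then \<Sum>\<^sub>\<infinity>j\<in>P. M i j * v j else 0)"

definition represents_l1_operator :: "'a set \<Rightarrow> ('a \<Rightarrow> 'a \<Rightarrow> real) \<Rightarrow> bool" where
  "represents_l1_operator P M \<longleftrightarrow> (SUP j\<in>P. \<Sum>\<^sub>\<infinity>i\<in>P. ennreal (M i j)) < \<infinity>"

definition l1_operator_norm :: "'a set \<Rightarrow> (('a \<Rightarrow> real) \<Rightarrow> 'a \<Rightarrow> real) \<Rightarrow> real" where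
  "l1_operator_norm P A = (SUP v\<in>{v \<in> l1_space P. l1_norm P v \<le> 1}. l1_norm P (A v))"

definition l1_spectral_radius :: "'a set \<Rightarrow> (('a \<Rightarrow> real) \<Rightarrow> 'a \<Rightarrow> real) \<Rightarrow> real" where
  "l1_spectral_radius P A = lim (\<lambda>n. root n (l1_operator_norm P (A ^^ n)))"


section \<open>Perturbations and linearizability\<close>

text \<open>The orders \<open>k\<close> are positive and may depend on \<open>j\<close>, without any uniform bound. For
  \<open>P' = {}\<close> the condition says that \<open>T = S\<close> on \<open>{0..1}\<close>.\<close>

definition window_perturbation ::
  "(real \<Rightarrow> real) \<Rightarrow> real set set \<Rightarrow> real set set \<Rightarrow> (real \<Rightarrow> real) \<Rightarrow> bool" where
  "window_perturbation S P P' T \<longleftrightarrow>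
    S \<in> CPMM \<and> markov_partition S P \<and> P' \<subseteq> P \<and> (\<forall>j\<in>P'. monotone_map_on j S) \<and>
    T \<in> CPMM \<and>
    (\<forall>x\<in>{0..1} - (\<Union>j\<in>P'. interior j). T x = S x) \<and>
    (\<forall>j\<in>P'. \<exists>k\<ge>1. \<exists>J. J division_of j \<and> card J = 2 * k + 1 \<and>
      (\<forall>K\<in>J. interior K \<noteq> {} \<and> T ` K = S ` j \<and> monotone_map_on K T))"

definition centralized_perturbation ::
  "(real \<Rightarrow> real) \<Rightarrow> real set set \<Rightarrow> real set set \<Rightarrow> (real \<Rightarrow> real) \<Rightarrow> bool" where
  "centralized_perturbation S P P' T \<longleftrightarrow>
    window_perturbation S P P' T \<and>
    (P' = {} \<or>
     (\<exists>a b. a \<le> b \<and> {a, b} \<subseteq> {0<..<1} - (\<Union>i\<in>P. interior i) \<and> \<Union>P' \<subseteq> {a..b}))"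

definition constant_slope :: "(real \<Rightarrow> real) \<Rightarrow> real \<Rightarrow> bool" where
  "constant_slope g s \<longleftrightarrow> interval_map g \<and>
    (\<exists>E. countable E \<and>
      (\<forall>x\<in>{0..1} - E. \<exists>d. (g has_real_derivative d) (at x within {0..1}) \<and> \<bar>d\<bar> = s))"

definition linearizable :: "(real \<Rightarrow> real) \<Rightarrow> bool" where
  "linearizable T \<longleftrightarrow>
    (\<exists>g. constant_slope g (exp (real_of_ereal (h_top T))) \<and>
      topologically_conjugate {0..1} T {0..1} g)"

end

theory Submission
  imports Defs
begin

text \<open>
  For a generic point \<open>y\<close> of a partition interval \<open>j\<close>, the entry \<open>(i, j)\<close> of the \<open>n\<close>-th power of
  the transition matrix is the number of solutions of \<open>T\<^sup>n x = y\<close> in \<open>i\<close>. This makes the entries comparable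
  between different partitions, and it ties the entropy to the matrix. Between two neighbours
  of an \<open>(n, \<epsilon>)\<close>-separated set there is a preimage, of order below \<open>n\<close>, of one of finitely many
  \<open>\<epsilon>\<close>-dense test points, so that a summable superharmonic vector for \<open>\<lambda>\<close> bounds the entropy by \<open>ln \<lambda>\<close>;
  conversely the branches of \<open>T\<^sup>n\<close> from \<open>i\<close> onto \<open>i\<close> form horseshoes.

  Since \<open>T\<close> is mixing, some iterate of any partition interval covers the window \<open>[a, b]\<close>; hence a finite
  superharmonic vector for the perturbed matrix is summable over the window. Above the spectral radius of
  the unperturbed matrix \<open>M\<close> the potential of the charge that \<open>M\<close> leaves there is summable, and it is still
  superharmonic for the perturbed matrix. Applied to columns of the Green function this
  gives \<open>h\<^sub>t\<^sub>o\<^sub>p(T) \<le> ln \<lambda>\<^sub>T\<close>; applied to the first passage vector, which in the recurrent case is the minimal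
  superharmonic vector, it gives a summable eigenvector for \<open>\<lambda>\<^sub>T = exp h\<^sub>t\<^sub>o\<^sub>p(T)\<close>. Pulling back an atomic measure with
  the masses of this eigenvector and normalising by \<open>\<lambda>\<^sub>T\<^sup>n\<close> produces, in the limit, the conjugacy to a map of
  constant slope. If \<open>S\<close> is recurrent as well, the first return series of an interval of the
  window at least triples under the perturbation, which forces \<open>\<lambda>\<^sub>T > \<lambda>\<^sub>S\<close>.
\<close>

text \<open>The orders of the perturbation are not bounded, so the perturbed matrix is not known to
  act on \<open>l1_space P\<close>, and perturbation theory of operators gives no hold on it. What
  remains is that it is the old matrix with each row multiplied by a factor that is 1 off
  \<open>P'\<close> and at least 3 on \<open>P'\<close>. Hence operator estimates concern the
  unperturbed matrix only, and the rows in the window are controlled by dynamics. Mixing lets an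
  iterate of any interval cover a compact subset of the open unit interval, but not necessarily the
  end points; this is why the perturbation has to be centralized. The strict entropy inequality puts
  the eigenvalue strictly above the spectral radius, and this gap gives a convergent geometric
  series. The factor 3 gives the superharmonic vector a strict excess on the window. Sums are taken
  in [0, \<infinity>], so that they can be exchanged freely and finiteness becomes a separate
  question.\<close>

section \<open>Countable sums as integrals against counting measure\<close>

abbreviation csum :: "'a set \<Rightarrow> ('a \<Rightarrow> ennreal) \<Rightarrow> ennreal" where
  "csum A f \<equiv> (\<integral>\<^sup>+x. f x \<partial>count_space A)"

text \<open>Both sides are suprema of finite partial sums. The integral form brings Tonelli and
  monotone convergence to the sums in the definitions.\<close>

lemma infsum_eq_csum:
  fixes f :: "'a \<Rightarrow> ennreal"
  assumes "countable A"
  shows "infsum f A = csum A f"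
proof -
  have eq: "infsum f A = (SUP F\<in>{F. finite F \<and> F \<subseteq> A}. sum f F)"
    by (rule nonneg_infsum_complete) auto
  have le: "sum f F \<le> csum A f" if "finite F" "F \<subseteq> A" for F
  proof -
    have "sum f F = csum F f"
      using that by (simp add: nn_integral_count_space_finite)
    also have "\<dots> = csum A (\<lambda>x. f x * indicator F x)"
      using that by (subst nn_integral_count_space_indicator[of F], simp) (subst nn_integral_count_space_indicator[of A], simp, intro nn_integral_cong, auto split: split_indicator)
    also have "\<dots> \<le> csum A f"
      by (intro nn_integral_mono) (auto split: split_indicator)
    finally show ?thesis .
  qed
  show ?thesis
  proof (cases "finite A")
    case True
    then show ?thesis by (simp add: nn_integral_count_space_finite)
  next
    case False
    have bij: "bij_betw (from_nat_into A) UNIV A"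
      using False assms by (rule bij_betw_from_nat_into[rotated])
    have "csum A f = csum UNIV (\<lambda>n. f (from_nat_into A n))"
      by (rule nn_integral_bij_count_space[OF bij, symmetric])
    also have "\<dots> = (\<Sum>n. f (from_nat_into A n))"
      by (rule nn_integral_count_space_nat)
    also have "\<dots> = (SUP n. \<Sum>k<n. f (from_nat_into A k))"
      by (rule suminf_eq_SUP)
    also have "\<dots> \<le> infsum f A"
    proof (rule SUP_least)
      fix n
      have "(\<Sum>k<n. f (from_nat_into A k)) = sum f (from_nat_into A ` {..<n})"
        by (subst sum.reindex) (use bij in \<open>auto simp: bij_betw_def intro: inj_on_subset\<close>)
      also have "\<dots> \<le> infsum f A"
        unfolding eq by (rule SUP_upper) (use bij in \<open>auto simp: bij_betw_def\<close>)
      finally show "(\<Sum>k<n. f (from_nat_into A k)) \<le> infsum f A" .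
    qed
    finally show ?thesis
      using le unfolding eq by (intro antisym SUP_least) auto
  qed
qed

lemma csum_UNIV_indicator: "csum A f = csum UNIV (\<lambda>x. f x * indicator A x)"
  by (cases "A = UNIV") (simp_all add: nn_integral_count_space_indicator)

lemma csum_swap: "csum A (\<lambda>x. csum B (\<lambda>y. f x y)) = csum B (\<lambda>y. csum A (\<lambda>x. f x y))"
proof -
  let ?g = "\<lambda>(x, y). f x y * indicator A x * indicator B y"
  have "csum A (\<lambda>x. csum B (\<lambda>y. f x y)) = csum UNIV (\<lambda>x. csum UNIV (\<lambda>y. ?g (x, y)))"
    unfolding csum_UNIV_indicator[of A] csum_UNIV_indicator[of B]
    by (subst nn_integral_multc[symmetric]) (auto intro!: nn_integral_cong simp: ac_simps)
  also have "\<dots> = csum UNIV (\<lambda>y. csum UNIV (\<lambda>x. ?g (x, y)))"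
    by (simp only: nn_integral_fst_count_space nn_integral_snd_count_space)
  also have "\<dots> = csum B (\<lambda>y. csum A (\<lambda>x. f x y))"
    unfolding csum_UNIV_indicator[of A] csum_UNIV_indicator[of B]
    by (subst nn_integral_multc[symmetric]) (auto intro!: nn_integral_cong simp: ac_simps)
  finally show ?thesis .
qed

lemma csum_single: "j \<in> A \<Longrightarrow> csum A (\<lambda>x. f x * (if x = j then 1 else 0)) = f j"
  for f :: "'a \<Rightarrow> ennreal"
proof -
  assume j: "j \<in> A"
  have "csum A (\<lambda>x. f x * (if x = j then 1 else 0)) = csum A (\<lambda>x. f j * indicator {j} x)"
    by (intro nn_integral_cong) auto
  also have "\<dots> = f j"
    using j by (simp add: nn_integral_cmult_indicator)
  finally show ?thesis .
qed

lemma csum_upper: "i \<in> A \<Longrightarrow> f i \<le> csum A f"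
proof -
  assume i: "i \<in> A"
  have "f i = csum A (\<lambda>x. f x * (if x = i then 1 else 0))"
    using csum_single[OF i] by simp
  also have "\<dots> \<le> csum A f" by (intro nn_integral_mono) auto
  finally show ?thesis .
qed

lemma csum_remove:
  assumes "j \<in> A"
  shows "csum A f = f j + csum (A - {j}) f"
proof -
  have "csum A f = csum A (\<lambda>x. f x * indicator {j} x + f x * indicator (A - {j}) x)"
    by (intro nn_integral_cong) (auto split: split_indicator)
  also have "\<dots> = csum A (\<lambda>x. f x * indicator {j} x) + csum A (\<lambda>x. f x * indicator (A - {j}) x)"
    by (rule nn_integral_add) auto
  also have "csum A (\<lambda>x. f x * indicator {j} x) = f j"
    using csum_single[OF assms, of f] by (simp add: indicator_def of_bool_def)
  also have "csum A (\<lambda>x. f x * indicator (A - {j}) x) = csum (A - {j}) f"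
    by (subst nn_integral_count_space_indicator[of A], simp, subst nn_integral_count_space_indicator[of "A - {j}"], simp, intro nn_integral_cong)
      (auto split: split_indicator)
  finally show ?thesis .
qed

lemma csum_cmult: "csum A (\<lambda>x. c * f x) = c * csum A f"
  by (rule nn_integral_cmult) simp

lemma csum_multc: "csum A (\<lambda>x. f x * c) = csum A f * c"
  by (rule nn_integral_multc) simp

lemma csum_cong: "(\<And>x. x \<in> A \<Longrightarrow> f x = g x) \<Longrightarrow> csum A f = csum A g"
  by (rule nn_integral_cong) simp

lemma csum_mono: "(\<And>x. x \<in> A \<Longrightarrow> f x \<le> g x) \<Longrightarrow> csum A f \<le> csum A g"
  by (rule nn_integral_mono) simp

lemma csum_mono_set:
  assumes "A \<subseteq> B" shows "csum A f \<le> csum B f"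
  by (subst nn_integral_count_space_indicator[of A], simp, subst nn_integral_count_space_indicator[of B], simp)
    (intro nn_integral_mono, use assms in \<open>auto split: split_indicator\<close>)

lemma csum_suminf: "csum A (\<lambda>x. \<Sum>n. f n x) = (\<Sum>n. csum A (f n))"
  by (rule nn_integral_suminf) simp

section \<open>Power series with nonnegative coefficients\<close>

text \<open>Tonelli for the triangular array k \<le> n; with values in [0, \<infinity>] no
  convergence condition arises.\<close>

lemma suminf_Cauchy_ennreal:
  fixes a b :: "nat \<Rightarrow> ennreal"
  shows "(\<Sum>n. \<Sum>k\<le>n. a k * b (n - k)) = (\<Sum>n. a n) * (\<Sum>n. b n)"
proof -
  have "(\<Sum>n. \<Sum>k\<le>n. a k * b (n - k)) = (\<Sum>n. \<Sum>k. if k \<le> n then a k * b (n - k) else 0)"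
  proof (rule suminf_cong)
    fix n
    have "(\<Sum>k. if k \<le> n then a k * b (n - k) else 0) = (\<Sum>k\<in>{..n}. if k \<le> n then a k * b (n - k) else 0)"
      by (rule suminf_finite) auto
    then show "(\<Sum>k\<le>n. a k * b (n - k)) = (\<Sum>k. if k \<le> n then a k * b (n - k) else 0)"
      by simp
  qed
  also have "\<dots> = csum UNIV (\<lambda>n. csum UNIV (\<lambda>k. if k \<le> n then a k * b (n - k) else 0))"
    by (simp add: nn_integral_count_space_nat)
  also have "\<dots> = csum UNIV (\<lambda>k. csum UNIV (\<lambda>n. if k \<le> n then a k * b (n - k) else 0))"
    by (rule csum_swap)
  also have "\<dots> = (\<Sum>k. \<Sum>n. if k \<le> n then a k * b (n - k) else 0)"
    by (simp add: nn_integral_count_space_nat)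
  also have "\<dots> = (\<Sum>k. \<Sum>n. a k * b n)"
  proof (rule suminf_cong)
    fix k
    have "(\<Sum>n. if k \<le> n then a k * b (n - k) else 0)
        = (\<Sum>n. (if k \<le> n + k then a k * b (n + k - k) else 0)) + (\<Sum>n<k. if k \<le> n then a k * b (n - k) else 0)"
      by (rule suminf_offset) (rule summableI)
    then show "(\<Sum>n. if k \<le> n then a k * b (n - k) else 0) = (\<Sum>n. a k * b n)"
      by simp
  qed
  finally show ?thesis by simp
qed

text \<open>A one-sided Abel theorem. Coefficients may be infinite, so partial sums are not treated
  as polynomials in z. With z = t R the scalar t ^ N is factored out of the N-th partial sum, and
  only this scalar tends to 1.\<close>

lemma power_series_left_limit_le:
  fixes a :: "nat \<Rightarrow> ennreal" and R :: real
  assumes R: "0 < R" and le: "\<And>z. 0 < z \<Longrightarrow> z < R \<Longrightarrow> (\<Sum>n. a n * ennreal z ^ n) \<le> C"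
  shows "(\<Sum>n. a n * ennreal R ^ n) \<le> C"
proof -
  have part: "(\<Sum>n<N. a n * ennreal R ^ n) \<le> C" for N
  proof -
    define s where "s = (\<Sum>n<N. a n * ennreal R ^ n)"
    have t: "ennreal (t ^ N) * s \<le> C" if t: "0 < t" "t < 1" for t
    proof -
      have "ennreal (t ^ N) * s = (\<Sum>n<N. ennreal (t ^ N) * (a n * ennreal R ^ n))"
        by (simp add: s_def sum_distrib_left)
      also have "\<dots> \<le> (\<Sum>n<N. a n * ennreal (t * R) ^ n)"
      proof (rule sum_mono)
        fix n assume "n \<in> {..<N}"
        then have "t ^ N \<le> t ^ n" using t by (intro power_decreasing) auto
        then have "ennreal (t ^ N) * (a n * ennreal R ^ n) \<le> ennreal (t ^ n) * (a n * ennreal R ^ n)"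
          by (intro mult_right_mono ennreal_leI) auto
        also have "\<dots> = a n * ennreal (t * R) ^ n"
          using t R by (simp add: ennreal_mult power_mult_distrib ennreal_power[symmetric] ac_simps)
        finally show "ennreal (t ^ N) * (a n * ennreal R ^ n) \<le> a n * ennreal (t * R) ^ n" .
      qed
      also have "\<dots> \<le> (\<Sum>n. a n * ennreal (t * R) ^ n)" by (rule sum_le_suminf) auto
      also have "\<dots> \<le> C" using t R by (intro le) auto
      finally show ?thesis .
    qed
    have "((\<lambda>t. ennreal (t ^ N) * s) \<longlongrightarrow> ennreal (1 ^ N) * s) (at_left (1::real))"
      by (intro tendsto_mult_ennreal tendsto_ennrealI tendsto_intros) auto
    moreover have "eventually (\<lambda>t::real. ennreal (t ^ N) * s \<le> C) (at_left 1)"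
      by (rule eventually_at_left_1) (rule t)
    ultimately have "ennreal (1 ^ N) * s \<le> C"
      by (intro tendsto_upperbound[of _ _ "at_left (1::real)"]) auto
    then show ?thesis by (simp add: s_def)
  qed
  show ?thesis unfolding suminf_eq_SUP by (intro SUP_least part)
qed

section \<open>Renewal theory\<close>

text \<open>The Green function, that is, the generating function of the powers of M. Radius of
  convergence and recurrence are handled through its finiteness or divergence.\<close>

definition green :: "'a set \<Rightarrow> ('a \<Rightarrow> 'a \<Rightarrow> real) \<Rightarrow> 'a \<Rightarrow> 'a \<Rightarrow> ennreal \<Rightarrow> ennreal" where
  "green P M i j z = (\<Sum>n. mat_power P M n i j * z ^ n)"

lemma mat_power_Suc_csum:
  assumes "countable P"
  shows "mat_power P M (Suc n) i j = csum P (\<lambda>\<alpha>. ennreal (M i \<alpha>) * mat_power P M n \<alpha> j)"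
  using assms by (simp add: infsum_eq_csum)

lemma first_passage_Suc_csum:
  assumes "countable P"
  shows "first_passage P M (Suc (Suc n)) i j = csum (P - {j}) (\<lambda>\<alpha>. ennreal (M i \<alpha>) * first_passage P M (Suc n) \<alpha> j)"
  using assms by (simp add: infsum_eq_csum)

declare mat_power.simps(2)[simp del] first_passage.simps(3)[simp del]

lemma mat_power_one:
  assumes "countable P" "j \<in> P" shows "mat_power P M (Suc 0) i j = ennreal (M i j)"
  using assms by (simp add: mat_power_Suc_csum csum_single)

lemma mat_power_add:
  assumes P: "countable P" and i: "i \<in> P"
  shows "mat_power P M (m + n) i j = csum P (\<lambda>\<alpha>. mat_power P M m i \<alpha> * mat_power P M n \<alpha> j)"
  using i
proof (induction m arbitrary: i)
  case 0
  have "csum P (\<lambda>\<alpha>. mat_power P M 0 i \<alpha> * mat_power P M n \<alpha> j)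
      = csum P (\<lambda>\<alpha>. mat_power P M n \<alpha> j * (if \<alpha> = i then 1 else 0))"
    by (intro csum_cong) auto
  then show ?case using 0 by (simp add: csum_single)
next
  case (Suc m)
  have "mat_power P M (Suc m + n) i j
      = csum P (\<lambda>\<beta>. ennreal (M i \<beta>) * csum P (\<lambda>\<alpha>. mat_power P M m \<beta> \<alpha> * mat_power P M n \<alpha> j))"
    using Suc.IH by (simp add: mat_power_Suc_csum[OF P] cong: csum_cong)
  also have "\<dots> = csum P (\<lambda>\<beta>. csum P (\<lambda>\<alpha>. ennreal (M i \<beta>) * mat_power P M m \<beta> \<alpha> * mat_power P M n \<alpha> j))"
    by (simp add: csum_cmult mult.assoc)
  also have "\<dots> = csum P (\<lambda>\<alpha>. csum P (\<lambda>\<beta>. ennreal (M i \<beta>) * mat_power P M m \<beta> \<alpha> * mat_power P M n \<alpha> j))"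
    by (rule csum_swap)
  finally show ?case
    by (simp add: csum_multc mat_power_Suc_csum[OF P])
qed

lemma mat_power_add_ge:
  assumes P: "countable P" and "i \<in> P" "k \<in> P"
  shows "mat_power P M m i k * mat_power P M n k j \<le> mat_power P M (m + n) i j"
  unfolding mat_power_add[OF P \<open>i \<in> P\<close>]
  using csum_upper[of k P "\<lambda>\<alpha>. mat_power P M m i \<alpha> * mat_power P M n \<alpha> j"] assms by simp

text \<open>Decomposition of paths by their first visit to j after time 0. The induction peels off
  the first step: it lands on j (the term k = 0) or prolongs a first passage by one.\<close>

lemma renewal:
  assumes P: "countable P" and j: "j \<in> P"
  shows "mat_power P M (Suc n) i j = (\<Sum>k\<le>n. first_passage P M (Suc k) i j * mat_power P M (n - k) j j)"
proof (induction n arbitrary: i)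
  case 0
  show ?case using mat_power_one[OF P j] by simp
next
  case (Suc n)
  have "mat_power P M (Suc (Suc n)) i j = ennreal (M i j) * mat_power P M (Suc n) j j
      + csum (P - {j}) (\<lambda>\<alpha>. ennreal (M i \<alpha>) * mat_power P M (Suc n) \<alpha> j)"
    by (subst mat_power_Suc_csum[OF P], subst csum_remove[OF j]) simp
  also have "csum (P - {j}) (\<lambda>\<alpha>. ennreal (M i \<alpha>) * mat_power P M (Suc n) \<alpha> j)
      = csum (P - {j}) (\<lambda>\<alpha>. \<Sum>k\<le>n. ennreal (M i \<alpha>) * first_passage P M (Suc k) \<alpha> j * mat_power P M (n - k) j j)"
    using Suc by (simp add: sum_distrib_left mult.assoc)
  also have "\<dots> = (\<Sum>k\<le>n. csum (P - {j}) (\<lambda>\<alpha>. ennreal (M i \<alpha>) * first_passage P M (Suc k) \<alpha> j) * mat_power P M (n - k) j j)"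
    by (subst nn_integral_sum) (auto simp: csum_multc)
  also have "\<dots> = (\<Sum>k\<le>n. first_passage P M (Suc (Suc k)) i j * mat_power P M (n - k) j j)"
    by (simp add: first_passage_Suc_csum[OF P])
  also have "ennreal (M i j) * mat_power P M (Suc n) j j + \<dots>
      = (\<Sum>k\<le>Suc n. first_passage P M (Suc k) i j * mat_power P M (Suc n - k) j j)"
    by (subst sum.atMost_Suc_shift) simp
  finally show ?case .
qed

lemma green_renewal:
  assumes P: "countable P" and j: "j \<in> P"
  shows "green P M i j z = (if i = j then 1 else 0) + first_passage_series P M i j z * green P M j j z"
proof -
  have "green P M i j z = (\<Sum>n. mat_power P M (Suc n) i j * z ^ Suc n) + mat_power P M 0 i j"
    unfolding green_def by (subst suminf_offset[where i=1]) auto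
  also have "(\<Sum>n. mat_power P M (Suc n) i j * z ^ Suc n)
     = (\<Sum>n. \<Sum>k\<le>n. (first_passage P M (Suc k) i j * z ^ Suc k) * (mat_power P M (n - k) j j * z ^ (n - k)))"
  proof (rule suminf_cong)
    fix n
    have "z ^ Suc n = z ^ Suc k * z ^ (n - k)" if "k \<le> n" for k
      using that by (subst power_add[symmetric]) simp
    then show "mat_power P M (Suc n) i j * z ^ Suc n
      = (\<Sum>k\<le>n. (first_passage P M (Suc k) i j * z ^ Suc k) * (mat_power P M (n - k) j j * z ^ (n - k)))"
      unfolding renewal[OF P j] sum_distrib_right by (intro sum.cong) (auto simp: ac_simps)
  qed
  also have "\<dots> = first_passage_series P M i j z * green P M j j z"
    unfolding first_passage_series_def green_def by (rule suminf_Cauchy_ennreal)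
  finally show ?thesis by (simp add: add.commute)
qed

text \<open>First-step analysis. If F_jj(z) = 1, the isolated term M i j is the missing summand of
  index j, and the first passage vector becomes an eigenvector for 1 / z.\<close>

lemma first_passage_series_eq:
  assumes P: "countable P" and j: "j \<in> P"
  shows "first_passage_series P M i j z
     = z * ennreal (M i j) + z * csum (P - {j}) (\<lambda>\<alpha>. ennreal (M i \<alpha>) * first_passage_series P M \<alpha> j z)"
proof -
  have "first_passage_series P M i j z
      = (\<Sum>n. first_passage P M (Suc (Suc n)) i j * z ^ Suc (Suc n)) + z * ennreal (M i j)"
    unfolding first_passage_series_def by (subst suminf_offset[where i=1]) (auto simp: ac_simps)
  also have "(\<Sum>n. first_passage P M (Suc (Suc n)) i j * z ^ Suc (Suc n))
      = (\<Sum>n. csum (P - {j}) (\<lambda>\<alpha>. z * (ennreal (M i \<alpha>) * (first_passage P M (Suc n) \<alpha> j * z ^ Suc n))))"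
    unfolding first_passage_Suc_csum[OF P] csum_multc[symmetric]
    by (intro arg_cong[where f=suminf] ext csum_cong) (simp add: ac_simps)
  also have "\<dots> = z * csum (P - {j}) (\<lambda>\<alpha>. ennreal (M i \<alpha>) * first_passage_series P M \<alpha> j z)"
    unfolding csum_suminf[symmetric] first_passage_series_def csum_cmult[symmetric] ennreal_suminf_cmult[symmetric] ..
  finally show ?thesis by (simp add: add.commute)
qed

text \<open>Minimality of the first passage vector. The sum truncated at N weighs paths that stop at
  j within N steps, and superharmonicity of x is applied once per step.\<close>

lemma first_passage_series_le_super:
  assumes P: "countable P" and j: "j \<in> P"
    and super: "\<And>i. i \<in> P \<Longrightarrow> z * csum P (\<lambda>\<alpha>. ennreal (M i \<alpha>) * x \<alpha>) \<le> x i"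
    and i: "i \<in> P"
  shows "first_passage_series P M i j z * x j \<le> x i"
proof -
  have "(\<Sum>n<N. first_passage P M (Suc n) i j * z ^ Suc n) * x j \<le> x i" for N
    using i
  proof (induction N arbitrary: i)
    case (Suc N)
    have "(\<Sum>n<Suc N. first_passage P M (Suc n) i j * z ^ Suc n) * x j
       = z * ennreal (M i j) * x j + (\<Sum>n<N. first_passage P M (Suc (Suc n)) i j * z ^ Suc (Suc n)) * x j"
      by (subst sum.lessThan_Suc_shift) (simp add: mult.commute[of z "ennreal (M i j)"] distrib_right)
    also have "(\<Sum>n<N. first_passage P M (Suc (Suc n)) i j * z ^ Suc (Suc n)) * x j
       = z * csum (P - {j}) (\<lambda>\<alpha>. ennreal (M i \<alpha>) * ((\<Sum>n<N. first_passage P M (Suc n) \<alpha> j * z ^ Suc n) * x j))"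
      unfolding first_passage_Suc_csum[OF P] csum_multc[symmetric] csum_cmult[symmetric] sum_distrib_left sum_distrib_right
      by (subst nn_integral_sum[symmetric]) (auto intro!: csum_cong sum.cong simp: ac_simps)
    also have "\<dots> \<le> z * csum (P - {j}) (\<lambda>\<alpha>. ennreal (M i \<alpha>) * x \<alpha>)"
      using Suc.IH by (intro mult_left_mono csum_mono) auto
    also have "z * ennreal (M i j) * x j + \<dots> = z * csum P (\<lambda>\<alpha>. ennreal (M i \<alpha>) * x \<alpha>)"
      by (subst csum_remove[OF j]) (simp add: distrib_left ac_simps)
    finally show ?case using super[OF Suc.prems] by (simp add: order_trans)
  qed simp
  then have "(SUP N. (\<Sum>n<N. first_passage P M (Suc n) i j * z ^ Suc n) * x j) \<le> x i"
    by (intro SUP_least)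
  then show ?thesis
    unfolding first_passage_series_def suminf_eq_SUP by (simp add: SUP_mult_right_ennreal)
qed

text \<open>The renewal equation gives G \<ge> 1 + G, which only infinity satisfies.\<close>

lemma green_infinite_of_passage_ge:
  assumes P: "countable P" and j: "j \<in> P" and F: "1 \<le> first_passage_series P M j j z"
  shows "green P M j j z = \<infinity>"
proof (rule ccontr)
  assume "green P M j j z \<noteq> \<infinity>"
  moreover have "1 + green P M j j z \<le> green P M j j z"
    using green_renewal[OF P j, of M j z] mult_right_mono[OF F, of "green P M j j z"]
    by (metis add_left_mono mult_1 zero_le)
  ultimately show False
    by (cases "green P M j j z") (auto simp flip: ennreal_1 ennreal_plus)
qed

lemma passage_less_1_of_green_finite:
  assumes P: "countable P" and j: "j \<in> P" and "green P M j j z < \<infinity>"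
  shows "first_passage_series P M j j z < 1"
  using green_infinite_of_passage_ge[OF P j, of M z] assms by (metis less_irrefl not_le)

text \<open>Below R the finite Green function forces F < 1, hence F(R) \<le> 1 in the limit. A value
  q < 1 would bound the Green function below R by 1 / (1 - q), and then also at R.\<close>

lemma passage_eq_1_at_radius:
  fixes R :: real
  assumes P: "countable P" and j: "j \<in> P" and R: "0 < R"
    and fin: "\<And>z. 0 < z \<Longrightarrow> z < R \<Longrightarrow> green P M j j (ennreal z) < \<infinity>"
    and inf: "green P M j j (ennreal R) = \<infinity>"
  shows "first_passage_series P M j j (ennreal R) = 1"
proof (rule antisym)
  have shift: "first_passage_series P M j j z = (\<Sum>n. first_passage P M n j j * z ^ n)" for z
    unfolding first_passage_series_def by (subst (2) suminf_offset[where i=1]) auto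
  show le: "first_passage_series P M j j (ennreal R) \<le> 1"
    unfolding shift by (rule power_series_left_limit_le[OF R])
      (use fin passage_less_1_of_green_finite[OF P j, of M] in \<open>force simp flip: shift intro: less_imp_le\<close>)
  show "1 \<le> first_passage_series P M j j (ennreal R)"
  proof (rule ccontr)
    assume "\<not> ?thesis"
    then obtain q where q: "first_passage_series P M j j (ennreal R) = ennreal q" "0 \<le> q" "q < 1"
      by (cases "first_passage_series P M j j (ennreal R)") (auto simp flip: ennreal_1)
    have "green P M j j (ennreal z) \<le> ennreal (1 / (1 - q))" if z: "0 < z" "z < R" for z
    proof -
      obtain g where g: "green P M j j (ennreal z) = ennreal g" "0 \<le> g"
        using fin[OF z] by (cases "green P M j j (ennreal z)") auto
      have "first_passage_series P M j j (ennreal z) \<le> ennreal q"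
        unfolding q(1)[symmetric] first_passage_series_def
        using z by (intro suminf_le mult_left_mono power_mono ennreal_leI) auto
      then have "ennreal g \<le> 1 + ennreal q * ennreal g"
        using green_renewal[OF P j, of M j "ennreal z"] mult_right_mono[of _ _ "ennreal g"] unfolding g(1)
        by (metis add_left_mono zero_le)
      also have "\<dots> = ennreal (1 + q * g)"
        using q g by (simp add: ennreal_plus ennreal_mult del: ennreal_1 flip: ennreal_1)
      finally have "g \<le> 1 + q * g" using q g by (simp only: ennreal_le_iff[of "1 + q * g"] add_nonneg_nonneg mult_nonneg_nonneg zero_le_one)
      then have "g * (1 - q) \<le> 1" by (simp add: algebra_simps)
      then show ?thesis unfolding g(1) using q by (intro ennreal_leI) (simp add: field_simps)
    qed
    then have "green P M j j (ennreal R) \<le> ennreal (1 / (1 - q))"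
      unfolding green_def by (rule power_series_left_limit_le[OF R])
    with inf show False by (simp add: top_unique)
  qed
qed

text \<open>If F stayed at most 1 below R, the left limit would keep it at most 1 at R.\<close>

lemma passage_gt_1_before:
  fixes R :: real
  assumes R: "0 < R" and gt: "first_passage_series P M j j (ennreal R) > 1"
  shows "\<exists>z. 0 < z \<and> z < R \<and> first_passage_series P M j j (ennreal z) > 1"
proof (rule ccontr)
  have shift: "first_passage_series P M j j z = (\<Sum>n. first_passage P M n j j * z ^ n)" for z
    unfolding first_passage_series_def by (subst (2) suminf_offset[where i=1]) auto
  assume "\<not> ?thesis"
  then have "first_passage_series P M j j (ennreal z) \<le> 1" if "0 < z" "z < R" for z
    using that by (meson not_less)
  then have "first_passage_series P M j j (ennreal R) \<le> 1"
    unfolding shift by (rule power_series_left_limit_le[OF R])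
  with gt show False by simp
qed

section \<open>Submultiplicative sequences\<close>

text \<open>Fekete's lemma in multiplicative form; the limit is the infimum of the roots.\<close>

lemma submultiplicative_root_convergent:
  fixes q :: "nat \<Rightarrow> real"
  assumes nonneg: "\<And>n. 0 \<le> q n" and sub: "\<And>m n. q (m + n) \<le> q m * q n"
  shows "convergent (\<lambda>n. root n (q n))"
proof -
  define L where "L = (INF n\<in>{1..}. root n (q n))"
  have bdd: "bdd_below ((\<lambda>n. root n (q n)) ` {1..})"
    using nonneg by (intro bdd_belowI[of _ 0]) auto
  have low: "L \<le> root n (q n)" if "n \<ge> 1" for n
    unfolding L_def using that by (intro cINF_lower bdd) auto
  have "(\<lambda>n. root n (q n)) \<longlonglongrightarrow> L"
  proof (rule LIMSEQ_I)
    fix e :: real assume e: "0 < e"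
    have "\<exists>m\<in>{1..}. root m (q m) < L + e/2"
      unfolding L_def using e bdd by (subst cINF_less_iff[symmetric]) auto
    then obtain m where m: "m \<ge> 1" "root m (q m) < L + e/2" by auto
    define s where "s = L + e/2"
    have s: "s > 0" using m nonneg[of m] real_root_ge_zero[of "q m" m] unfolding s_def by linarith
    have qm: "q m \<le> s ^ m"
      using m nonneg[of m] s unfolding s_def[symmetric]
      by (metis less_eq_real_def not_one_le_zero power_strict_mono real_root_ge_zero real_root_pow_pos2 zero_less_iff_neq_zero)
    \<comment> \<open>\<open>K\<close> absorbs the remainders n mod m. Adding 1 keeps it positive,
      so that its n-th root tends to 1.\<close>
    define K where "K = Max ((\<lambda>r. q r / s ^ r) ` {..<m}) + 1"
    have K: "q r / s ^ r \<le> K" if "r < m" for r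
      unfolding K_def using that by (intro order_trans[OF Max_ge[of "(\<lambda>r. q r / s ^ r) ` {..<m}" "q r / s ^ r"]]) auto
    have K0: "K > 0"
    proof -
      have "0 \<le> q 0 / s ^ 0" using nonneg by simp
      also have "\<dots> \<le> Max ((\<lambda>r. q r / s ^ r) ` {..<m})" using m by (intro Max_ge imageI) auto
      finally show ?thesis unfolding K_def by simp
    qed
    have mult: "q (k * m + r) \<le> q m ^ k * q r" for k r
    proof (induction k)
      case (Suc k)
      have "q (Suc k * m + r) \<le> q m * q (k * m + r)"
        using sub[of m "k * m + r"] by (simp add: ac_simps)
      also have "\<dots> \<le> q m * (q m ^ k * q r)" using Suc nonneg by (intro mult_left_mono)
      finally show ?case by (simp add: ac_simps)
    qed simp
    have bound: "q n \<le> K * s ^ n" for n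
    proof -
      have "q n \<le> q m ^ (n div m) * q (n mod m)" using mult[of "n div m" "n mod m"] by simp
      also have "\<dots> \<le> (s ^ m) ^ (n div m) * (K * s ^ (n mod m))"
        using qm nonneg K[of "n mod m"] m s by (intro mult_mono power_mono) (auto simp: field_simps)
      also have "\<dots> = K * s ^ (m * (n div m) + n mod m)" by (simp only: power_mult power_add mult.left_commute)
      finally show ?thesis by simp
    qed
    have "(\<lambda>n. root n K * s) \<longlonglongrightarrow> 1 * s"
      using K0 by (intro tendsto_intros LIMSEQ_root_const)
    then have "eventually (\<lambda>n. root n K * s < L + e) sequentially"
      using e by (intro order_tendstoD) (auto simp: s_def)
    then obtain N where N: "\<And>n. n \<ge> N \<Longrightarrow> root n K * s < L + e"
      by (auto simp: eventually_sequentially)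
    have "norm (root n (q n) - L) < e" if "n \<ge> max 1 N" for n
    proof -
      have "root n (q n) \<le> root n (K * s ^ n)" using bound that by (intro real_root_le_mono) auto
      also have "\<dots> = root n K * s" using that s by (simp add: real_root_mult real_root_power_cancel)
      also have "\<dots> < L + e" using N that by simp
      finally show ?thesis using low[of n] that e by simp
    qed
    then show "\<exists>no. \<forall>n\<ge>no. norm (root n (q n) - L) < e" by blast
  qed
  then show ?thesis by (rule convergentI)
qed

section \<open>Column sums and the spectral radius\<close>

lemma summable_on_iff_csum:
  fixes f :: "'a \<Rightarrow> real"
  assumes "countable A"
  shows "(\<lambda>x. \<bar>f x\<bar>) summable_on A \<longleftrightarrow> csum A (\<lambda>x. ennreal \<bar>f x\<bar>) < \<infinity>"
    and "(\<lambda>x. \<bar>f x\<bar>) summable_on A \<Longrightarrow> ennreal (\<Sum>\<^sub>\<infinity>x\<in>A. \<bar>f x\<bar>) = csum A (\<lambda>x. ennreal \<bar>f x\<bar>)"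
proof -
  have sup: "csum A (\<lambda>x. ennreal \<bar>f x\<bar>) = (SUP F\<in>{F. finite F \<and> F \<subseteq> A}. ennreal (\<Sum>x\<in>F. \<bar>f x\<bar>))"
    unfolding infsum_eq_csum[OF assms, symmetric] by (subst nonneg_infsum_complete) auto
  show eq: "ennreal (\<Sum>\<^sub>\<infinity>x\<in>A. \<bar>f x\<bar>) = csum A (\<lambda>x. ennreal \<bar>f x\<bar>)" if "(\<lambda>x. \<bar>f x\<bar>) summable_on A"
    unfolding sup by (rule infsum_nonneg_is_SUPREMUM_ennreal[OF that]) auto
  show "(\<lambda>x. \<bar>f x\<bar>) summable_on A \<longleftrightarrow> csum A (\<lambda>x. ennreal \<bar>f x\<bar>) < \<infinity>"
  proof
    assume "csum A (\<lambda>x. ennreal \<bar>f x\<bar>) < \<infinity>"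
    then obtain c where c: "csum A (\<lambda>x. ennreal \<bar>f x\<bar>) = ennreal c" "0 \<le> c"
      by (cases "csum A (\<lambda>x. ennreal \<bar>f x\<bar>)") auto
    show "(\<lambda>x. \<bar>f x\<bar>) summable_on A"
    proof (rule nonneg_bdd_above_summable_on)
      show "bdd_above (sum (\<lambda>x. \<bar>f x\<bar>) ` {F. F \<subseteq> A \<and> finite F})"
      proof (rule bdd_aboveI2)
        fix F assume F: "F \<in> {F. F \<subseteq> A \<and> finite F}"
        then have "ennreal (\<Sum>x\<in>F. \<bar>f x\<bar>) \<le> ennreal c"
          unfolding c(1)[symmetric] sup by (intro SUP_upper) auto
        then show "(\<Sum>x\<in>F. \<bar>f x\<bar>) \<le> c" using c by (simp add: ennreal_le_iff)
      qed
    qed simp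
  qed (use eq in \<open>auto simp flip: eq\<close>)
qed

lemma ennreal_abs_infsum_le:
  fixes f :: "'a \<Rightarrow> real"
  assumes "countable A"
  shows "ennreal \<bar>infsum f A\<bar> \<le> csum A (\<lambda>x. ennreal \<bar>f x\<bar>)"
proof (cases "csum A (\<lambda>x. ennreal \<bar>f x\<bar>) < \<infinity>")
  case True
  then have s: "(\<lambda>x. \<bar>f x\<bar>) summable_on A" using summable_on_iff_csum(1)[OF assms] by blast
  then have "\<bar>infsum f A\<bar> \<le> (\<Sum>\<^sub>\<infinity>x\<in>A. \<bar>f x\<bar>)"
    using norm_infsum_bound[of f A] by simp
  then show ?thesis using summable_on_iff_csum(2)[OF assms s] by (metis ennreal_leI)
next
  case False
  then show ?thesis by (simp add: top_unique not_less)
qed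

locale l1_matrix =
  fixes P :: "'a set" and M :: "'a \<Rightarrow> 'a \<Rightarrow> real" and K :: real
  assumes P: "countable P" and M_nonneg: "\<And>i j. 0 \<le> M i j" and K_nonneg: "0 \<le> K"
    and colsum: "\<And>j. j \<in> P \<Longrightarrow> csum P (\<lambda>i. ennreal (M i j)) \<le> ennreal K"
begin

abbreviation "Mop \<equiv> matrix_operator P M"

lemma l1_space_iff: "v \<in> l1_space P \<longleftrightarrow> csum P (\<lambda>i. ennreal \<bar>v i\<bar>) < \<infinity> \<and> (\<forall>i. i \<notin> P \<longrightarrow> v i = 0)"
  unfolding l1_space_def using summable_on_iff_csum(1)[OF P, of v] by auto

lemma l1_norm_csum: "v \<in> l1_space P \<Longrightarrow> ennreal (l1_norm P v) = csum P (\<lambda>i. ennreal \<bar>v i\<bar>)"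
  unfolding l1_norm_def l1_space_def by (rule summable_on_iff_csum(2)[OF P]) auto

lemma l1_norm_nonneg: "0 \<le> l1_norm P v"
  unfolding l1_norm_def by (rule infsum_nonneg) simp

text \<open>Exchanging the two sums brings out the column sums, which are what the hypothesis
  bounds.\<close>

lemma csum_abs_le:
  assumes v: "v \<in> l1_space P"
  shows "csum P (\<lambda>i. csum P (\<lambda>j. ennreal \<bar>M i j * v j\<bar>)) \<le> ennreal (K * l1_norm P v)"
proof -
  have "csum P (\<lambda>i. csum P (\<lambda>j. ennreal \<bar>M i j * v j\<bar>)) = csum P (\<lambda>j. csum P (\<lambda>i. ennreal (M i j) * ennreal \<bar>v j\<bar>))"
    by (subst csum_swap) (simp add: abs_mult M_nonneg ennreal_mult)
  also have "\<dots> \<le> csum P (\<lambda>j. ennreal K * ennreal \<bar>v j\<bar>)"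
    unfolding csum_multc using colsum by (intro csum_mono mult_right_mono) auto
  also have "\<dots> = ennreal (K * l1_norm P v)"
    using K_nonneg l1_norm_nonneg by (simp add: csum_cmult l1_norm_csum[OF v, symmetric] ennreal_mult)
  finally show ?thesis .
qed

lemma Mop_l1:
  assumes v: "v \<in> l1_space P"
  shows "Mop v \<in> l1_space P" "l1_norm P (Mop v) \<le> K * l1_norm P v"
proof -
  have le: "csum P (\<lambda>i. ennreal \<bar>Mop v i\<bar>) \<le> ennreal (K * l1_norm P v)"
    by (rule order_trans[OF _ csum_abs_le[OF v]], rule csum_mono)
      (simp add: matrix_operator_def ennreal_abs_infsum_le[OF P])
  then show in_l1: "Mop v \<in> l1_space P"
    unfolding l1_space_iff by (auto simp: matrix_operator_def intro: le_less_trans)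
  show "l1_norm P (Mop v) \<le> K * l1_norm P v"
    using le unfolding l1_norm_csum[OF in_l1, symmetric] using K_nonneg l1_norm_nonneg by (simp add: ennreal_le_iff)
qed

lemma Mop_pow_l1:
  assumes v: "v \<in> l1_space P"
  shows "(Mop ^^ n) v \<in> l1_space P" "l1_norm P ((Mop ^^ n) v) \<le> K ^ n * l1_norm P v"
proof (induction n)
  case (Suc n)
  case 1 show ?case using Suc Mop_l1 by simp
  case 2
  have "l1_norm P ((Mop ^^ Suc n) v) \<le> K * l1_norm P ((Mop ^^ n) v)" using Suc Mop_l1 by simp
  also have "\<dots> \<le> K * (K ^ n * l1_norm P v)" using Suc K_nonneg by (intro mult_left_mono)
  finally show ?case by (simp add: ac_simps)
qed (use v in auto)

lemma Mop_pow_scale: "(Mop ^^ n) (\<lambda>i. c * v i) = (\<lambda>i. c * (Mop ^^ n) v i)"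
proof (induction n)
  case (Suc n)
  have "Mop (\<lambda>i. c * w i) = (\<lambda>i. c * Mop w i)" for w
    unfolding matrix_operator_def by (auto simp: fun_eq_iff infsum_cmult_right'[symmetric] ac_simps)
  then show ?case using Suc by simp
qed simp

lemma zero_l1: "(\<lambda>_. 0) \<in> l1_space P" "l1_norm P (\<lambda>_. 0) = 0"
  by (auto simp: l1_space_def l1_norm_def)

abbreviation "opn n \<equiv> l1_operator_norm P (Mop ^^ n)"

lemma opn_bdd: "bdd_above ((\<lambda>v. l1_norm P ((Mop ^^ n) v)) ` {v \<in> l1_space P. l1_norm P v \<le> 1})"
proof (rule bdd_aboveI2)
  fix v assume v: "v \<in> {v \<in> l1_space P. l1_norm P v \<le> 1}"
  then have "l1_norm P ((Mop ^^ n) v) \<le> K ^ n * l1_norm P v" by (intro Mop_pow_l1) auto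
  also have "\<dots> \<le> K ^ n * 1" using v K_nonneg by (intro mult_left_mono) auto
  finally show "l1_norm P ((Mop ^^ n) v) \<le> K ^ n" by simp
qed

lemma opn_upper_unit: "v \<in> l1_space P \<Longrightarrow> l1_norm P v \<le> 1 \<Longrightarrow> l1_norm P ((Mop ^^ n) v) \<le> opn n"
  unfolding l1_operator_norm_def by (intro cSUP_upper opn_bdd) auto

lemma opn_nonneg: "0 \<le> opn n"
  using opn_upper_unit[OF zero_l1(1), of n] zero_l1(2) l1_norm_nonneg[of "(Mop ^^ n) (\<lambda>_. 0)"] by linarith

lemma opn_upper:
  assumes v: "v \<in> l1_space P" shows "l1_norm P ((Mop ^^ n) v) \<le> opn n * l1_norm P v"
proof (cases "l1_norm P v = 0")
  case True
  then show ?thesis using Mop_pow_l1(2)[OF v, of n] by simp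
next
  case False
  define c where "c = l1_norm P v"
  have c: "c > 0" using False l1_norm_nonneg[of v] by (simp add: c_def)
  have scale: "l1_norm P (\<lambda>i. a * w i) = a * l1_norm P w" if "0 \<le> a" for a w
    unfolding l1_norm_def using that by (simp add: abs_mult infsum_cmult_right')
  have "(\<lambda>i. (1/c) * v i) \<in> l1_space P"
    using v c unfolding l1_space_def by (auto simp: abs_mult divide_inverse intro: summable_on_cmult_right)
  then have "l1_norm P ((Mop ^^ n) (\<lambda>i. (1/c) * v i)) \<le> opn n"
    using c scale[of "1/c" v] by (intro opn_upper_unit) (auto simp flip: c_def)
  then have "(1/c) * l1_norm P ((Mop ^^ n) v) \<le> opn n"
    using c unfolding Mop_pow_scale by (subst (asm) scale) auto
  then show ?thesis using c by (simp add: c_def[symmetric] field_simps)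
qed

lemma opn_submult: "opn (m + n) \<le> opn m * opn n"
  unfolding l1_operator_norm_def[of P "Mop ^^ (m + n)"]
proof (rule cSUP_least)
  show "{v \<in> l1_space P. l1_norm P v \<le> 1} \<noteq> {}" using zero_l1 by force
  fix v assume v: "v \<in> {v \<in> l1_space P. l1_norm P v \<le> 1}"
  have "l1_norm P ((Mop ^^ (m + n)) v) = l1_norm P ((Mop ^^ m) ((Mop ^^ n) v))"
    by (simp add: funpow_add)
  also have "\<dots> \<le> opn m * l1_norm P ((Mop ^^ n) v)" using v by (intro opn_upper Mop_pow_l1) auto
  also have "\<dots> \<le> opn m * opn n" using v by (intro mult_left_mono opn_upper_unit opn_nonneg) auto
  finally show "l1_norm P ((Mop ^^ (m + n)) v) \<le> opn m * opn n" .
qed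

lemma opn_growth:
  assumes "l1_spectral_radius P Mop < l"
  shows "\<exists>C. \<forall>n. opn n \<le> C * l ^ n"
proof -
  define s where "s = l1_spectral_radius P Mop"
  have lim: "(\<lambda>n. root n (opn n)) \<longlonglongrightarrow> s"
    using submultiplicative_root_convergent[of opn, OF opn_nonneg opn_submult]
    unfolding s_def l1_spectral_radius_def by (simp add: convergent_LIMSEQ_iff)
  have s0: "0 \<le> s"
    by (rule LIMSEQ_le_const[OF lim]) (use opn_nonneg real_root_ge_zero in blast)
  then have l: "l > 0" using assms by (simp add: s_def)
  have "eventually (\<lambda>n. root n (opn n) < l) sequentially"
    using lim assms by (intro order_tendstoD(2)) (simp_all add: s_def)
  then obtain N where N: "\<And>n. n \<ge> N \<Longrightarrow> root n (opn n) < l" by (auto simp: eventually_sequentially)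
  \<comment> \<open>The maximum handles the indices up to N. Adding 1 makes \<open>C\<close> at
    least 1, as needed beyond N, where the bound is \<open>opn n \<le> l ^ n\<close>.\<close>
  define C where "C = Max ((\<lambda>n. opn n / l ^ n) ` {..N}) + 1"
  have CN: "opn n / l ^ n \<le> C" if "n \<le> N" for n
    unfolding C_def using that by (intro order_trans[OF Max_ge[of "(\<lambda>n. opn n / l ^ n) ` {..N}" "opn n / l ^ n"]]) auto
  have C1: "1 \<le> C"
  proof -
    have "0 \<le> opn 0 / l ^ 0" using opn_nonneg[of 0] by simp
    also have "\<dots> \<le> Max ((\<lambda>n. opn n / l ^ n) ` {..N})"
      by (intro Max_ge imageI finite_imageI) (rule finite_atMost, rule iffD2[OF atMost_iff], rule le0)
    finally show ?thesis by (simp add: C_def)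
  qed
  have "opn n \<le> C * l ^ n" for n
  proof (cases "n \<le> N")
    case True
    then show ?thesis using CN[OF True] l by (simp add: field_simps)
  next
    case False
    then have "0 < n" "root n (opn n) \<le> l" using N[of n] by auto
    then have "opn n \<le> l ^ n"
      using opn_nonneg[of n] by (metis power_mono real_root_ge_zero real_root_pow_pos2)
    also have "\<dots> \<le> C * l ^ n" using C1 l by simp
    finally show ?thesis .
  qed
  then show ?thesis by blast
qed

text \<open>Links the real operator with the powers computed in [0, \<infinity>]: on the unit vector
  at j it returns column j. Each row sum has to be shown summable before \<open>infsum\<close> and
  \<open>csum\<close> agree.\<close>

lemma Mop_pow_unit:
  assumes j: "j \<in> P" and i: "i \<in> P"
  shows "0 \<le> (Mop ^^ n) (\<lambda>i. if i = j then 1 else 0) i \<and>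
    ennreal ((Mop ^^ n) (\<lambda>i. if i = j then 1 else 0) i) = mat_power P M n i j"
  using i
proof (induction n arbitrary: i)
  case (Suc n)
  define e where "e = (\<lambda>i. if i = j then 1 else (0::real))"
  define v where "v = (Mop ^^ n) e"
  have IH: "0 \<le> v \<alpha>" "ennreal (v \<alpha>) = mat_power P M n \<alpha> j" if "\<alpha> \<in> P" for \<alpha>
    using Suc.IH[OF that] by (auto simp: v_def e_def)
  have "csum P (\<lambda>i. ennreal \<bar>e i\<bar>) = csum P (\<lambda>i. 1 * (if i = j then 1 else 0))"
    by (intro csum_cong) (auto simp: e_def)
  then have "csum P (\<lambda>i. ennreal \<bar>e i\<bar>) = 1" by (simp only: csum_single[OF j])
  then have e: "e \<in> l1_space P" unfolding l1_space_iff using j by (auto simp: e_def)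
  then have v: "v \<in> l1_space P" unfolding v_def by (rule Mop_pow_l1)
  have "csum P (\<lambda>\<alpha>. ennreal \<bar>M i \<alpha> * v \<alpha>\<bar>) \<le> csum P (\<lambda>i. csum P (\<lambda>j. ennreal \<bar>M i j * v j\<bar>))"
    by (rule csum_upper[OF Suc.prems])
  also have "\<dots> < \<infinity>" using csum_abs_le[OF v] by (auto intro: le_less_trans)
  finally have s: "(\<lambda>\<alpha>. \<bar>M i \<alpha> * v \<alpha>\<bar>) summable_on P" using summable_on_iff_csum(1)[OF P, of "\<lambda>\<alpha>. M i \<alpha> * v \<alpha>"] by blast
  have abs: "infsum (\<lambda>\<alpha>. M i \<alpha> * v \<alpha>) P = infsum (\<lambda>\<alpha>. \<bar>M i \<alpha> * v \<alpha>\<bar>) P"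
    using IH(1) M_nonneg by (intro infsum_cong) auto
  have "ennreal (infsum (\<lambda>\<alpha>. M i \<alpha> * v \<alpha>) P) = csum P (\<lambda>\<alpha>. ennreal \<bar>M i \<alpha> * v \<alpha>\<bar>)"
    unfolding abs by (rule summable_on_iff_csum(2)[OF P s])
  also have "\<dots> = mat_power P M (Suc n) i j"
    unfolding mat_power_Suc_csum[OF P]
    by (intro csum_cong) (auto simp: IH(2)[symmetric] ennreal_mult[symmetric] M_nonneg IH(1))
  finally have "ennreal (Mop v i) = mat_power P M (Suc n) i j"
    using Suc.prems by (simp add: matrix_operator_def)
  moreover have "0 \<le> Mop v i"
    unfolding matrix_operator_def abs by (auto simp: abs intro!: infsum_nonneg mult_nonneg_nonneg M_nonneg IH(1))
  ultimately show ?case by (simp add: v_def e_def)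
qed auto

text \<open>The column sum is the norm of the image of a unit vector, hence at most the operator
  norm of the power.\<close>

lemma colsum_growth:
  assumes "l1_spectral_radius P Mop < l"
  shows "\<exists>C. \<forall>n. \<forall>j\<in>P. csum P (\<lambda>i. mat_power P M n i j) \<le> ennreal (C * l ^ n)"
proof -
  obtain C where C: "\<And>n. opn n \<le> C * l ^ n" using opn_growth[OF assms] by blast
  have "csum P (\<lambda>i. mat_power P M n i j) \<le> ennreal (C * l ^ n)" if j: "j \<in> P" for n j
  proof -
    define e where "e = (\<lambda>i. if i = j then 1 else (0::real))"
    have "csum P (\<lambda>i. ennreal \<bar>e i\<bar>) = csum P (\<lambda>i. 1 * (if i = j then 1 else 0))"
      by (intro csum_cong) (auto simp: e_def)
    then have one: "csum P (\<lambda>i. ennreal \<bar>e i\<bar>) = 1" by (simp only: csum_single[OF j])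
    then have e: "e \<in> l1_space P" unfolding l1_space_iff using j by (auto simp: e_def)
    have "l1_norm P e \<le> 1"
      using l1_norm_csum[OF e] one l1_norm_nonneg by (simp flip: ennreal_1)
    have "csum P (\<lambda>i. mat_power P M n i j) = csum P (\<lambda>i. ennreal \<bar>(Mop ^^ n) e i\<bar>)"
      using Mop_pow_unit[OF j] by (intro csum_cong) (simp add: e_def)
    also have "\<dots> = ennreal (l1_norm P ((Mop ^^ n) e))"
      by (rule l1_norm_csum[symmetric]) (rule Mop_pow_l1[OF e])
    also have "\<dots> \<le> ennreal (C * l ^ n)"
      using opn_upper_unit[OF e \<open>l1_norm P e \<le> 1\<close>, of n] C[of n] by (intro ennreal_leI) linarith
    finally show ?thesis .
  qed
  then show ?thesis by blast
qed

end

lemma represents_l1_colsum_growth: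
  assumes P: "countable P" and M: "\<And>i j. 0 \<le> M i j" and rep: "represents_l1_operator P M"
    and l: "l1_spectral_radius P (matrix_operator P M) < l"
  shows "\<exists>C. \<forall>n. \<forall>j\<in>P. csum P (\<lambda>i. mat_power P M n i j) \<le> ennreal (C * l ^ n)"
proof -
  define c where "c = (SUP j\<in>P. \<Sum>\<^sub>\<infinity>i\<in>P. ennreal (M i j))"
  obtain K where K: "c = ennreal K" "0 \<le> K"
    using rep unfolding represents_l1_operator_def c_def[symmetric] by (cases c) auto
  have "csum P (\<lambda>i. ennreal (M i j)) \<le> ennreal K" if "j \<in> P" for j
    unfolding K(1)[symmetric] c_def infsum_eq_csum[OF P, symmetric] using that by (intro SUP_upper)
  then interpret l1_matrix P M K by unfold_locales (use P M K in auto)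
  show ?thesis by (rule colsum_growth[OF l])
qed

section \<open>Entropy estimates\<close>

lemma funpow_in: "T ` X \<subseteq> X \<Longrightarrow> x \<in> X \<Longrightarrow> (T ^^ n) x \<in> X"
  by (induction n) auto

lemma continuous_on_funpow:
  assumes "continuous_on X T" "T ` X \<subseteq> X" shows "continuous_on X (T ^^ n)"
proof (induction n)
  case (Suc n)
  have "(T ^^ n) ` X \<subseteq> X" using funpow_in[OF assms(2)] by blast
  then have "continuous_on X (T \<circ> T ^^ n)"
    using Suc continuous_on_subset[OF assms(1)] by (intro continuous_on_compose) auto
  then show ?case by simp
qed (simp add: id_def)

lemma funpow_cong_on:
  assumes "\<And>x. x \<in> X \<Longrightarrow> T x = S x" "S ` X \<subseteq> X" "x \<in> X"
  shows "(T ^^ n) x = (S ^^ n) x"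
  using assms funpow_in[OF assms(2,3)] by (induction n) auto

lemma topological_entropy_cong:
  assumes "\<And>x. x \<in> X \<Longrightarrow> T x = S x" "S ` X \<subseteq> X"
  shows "topological_entropy X T = topological_entropy X S"
proof -
  have "dyn_separated X T n e E = dyn_separated X S n e E" for n e E
  proof (cases "E \<subseteq> X")
    case True
    have "(T ^^ k) x = (S ^^ k) x" if "x \<in> E" for k x
      using that True by (intro funpow_cong_on[OF assms]) auto
    then show ?thesis unfolding dyn_separated_def by (auto cong: ball_cong)
  qed (auto simp: dyn_separated_def)
  then show ?thesis unfolding topological_entropy_def by simp
qed

lemma limsup_subseq_ge:
  fixes u :: "nat \<Rightarrow> ereal"
  assumes "\<And>m. m \<ge> 1 \<Longrightarrow> c \<le> u (n * m)" "n \<ge> 1"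
  shows "c \<le> limsup u"
proof -
  have sm: "strict_mono (\<lambda>m. n * m)" using assms(2) by (auto intro!: strict_monoI)
  have "c = limsup (\<lambda>m::nat. c)" by (simp add: Limsup_const)
  also have "\<dots> \<le> limsup (u \<circ> (\<lambda>m. n * m))"
    by (rule Limsup_mono) (auto simp: eventually_sequentially intro!: exI[of _ 1] assms(1))
  also have "\<dots> \<le> limsup u" by (rule limsup_subseq_mono[OF sm])
  finally show ?thesis .
qed

text \<open>The word is realised from its last symbol backwards: a point that follows the tail lies
  in \<Union>C and is pulled back into the first set.\<close>

lemma horseshoe_itinerary:
  assumes sub: "\<And>A. A \<in> C \<Longrightarrow> \<Union>C \<subseteq> (T ^^ n) ` A" and ne: "\<And>A. A \<in> C \<Longrightarrow> A \<noteq> {}"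
    and w: "set w \<subseteq> C" "w \<noteq> []"
  shows "\<exists>x. \<forall>k<length w. (T ^^ (n * k)) x \<in> w ! k"
  using w
proof (induction w)
  case (Cons A w)
  show ?case
  proof (cases "w = []")
    case True
    then show ?thesis using ne[of A] Cons.prems by auto
  next
    case False
    then obtain x where x: "\<And>k. k < length w \<Longrightarrow> (T ^^ (n * k)) x \<in> w ! k" using Cons by auto
    from x[of 0] False have "x \<in> w ! 0" by auto
    moreover have "w ! 0 \<in> C" using False Cons.prems by (metis length_greater_0_conv list.set_intros(2) nth_mem subsetD)
    ultimately have "x \<in> (T ^^ n) ` A" using sub[of A] Cons.prems by auto
    then obtain x' where x': "x' \<in> A" "x = (T ^^ n) x'" by auto
    have "(T ^^ (n * k)) x' \<in> (A # w) ! k" if "k < length (A # w)" for k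
    proof (cases k)
      case (Suc k')
      have "(T ^^ (n * k)) x' = (T ^^ (n * k')) ((T ^^ n) x')"
        unfolding Suc by (simp add: add.commute[of n] funpow_add)
      then show ?thesis using x[of k'] that x' Suc by simp
    qed (use x' in simp)
    then show ?thesis by blast
  qed
qed simp

lemma finite_disjoint_compact_separated:
  fixes C :: "'a::heine_borel set set"
  assumes "finite C" "\<And>A. A \<in> C \<Longrightarrow> compact A" "disjoint C"
  shows "\<exists>d>0. \<forall>A\<in>C. \<forall>B\<in>C. A \<noteq> B \<longrightarrow> (\<forall>x\<in>A. \<forall>y\<in>B. d < dist x y)"
proof -
  have "\<forall>p\<in>C \<times> C. \<exists>d>0. fst p \<noteq> snd p \<longrightarrow> (\<forall>x\<in>fst p. \<forall>y\<in>snd p. d < dist x y)"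
  proof clarsimp
    fix A B assume AB: "A \<in> C" "B \<in> C"
    show "\<exists>d>0. A \<noteq> B \<longrightarrow> (\<forall>x\<in>A. \<forall>y\<in>B. d < dist x y)"
    proof (cases "A = B")
      case False
      then have "A \<inter> B = {}" using AB assms(3) by (auto simp: disjoint_def)
      then obtain d where "d > 0" "\<forall>x\<in>A. \<forall>y\<in>B. d \<le> dist x y"
        using separate_compact_closed[of A B] assms(2)[OF AB(1)] compact_imp_closed[OF assms(2)[OF AB(2)]] by auto
      then show ?thesis by (intro exI[of _ "d/2"]) force
    qed (auto intro: exI[of _ 1])
  qed
  then obtain d where d: "\<And>p. p \<in> C \<times> C \<Longrightarrow> 0 < d p \<and> (fst p \<noteq> snd p \<longrightarrow> (\<forall>x\<in>fst p. \<forall>y\<in>snd p. d p < dist x y))"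
    by metis
  define e where "e = Min (insert 1 (d ` (C \<times> C)))"
  have "\<forall>z\<in>insert 1 (d ` (C \<times> C)). 0 < z" using d by force
  then have "e > 0" unfolding e_def using assms(1) by (subst Min_gr_iff) auto
  moreover have "e \<le> d p" if "p \<in> C \<times> C" for p
    unfolding e_def using assms(1) that by (intro Min_le) auto
  moreover have "d (A, B) < dist x y" if "A \<in> C" "B \<in> C" "A \<noteq> B" "x \<in> A" "y \<in> B" for A B x y
    using d[of "(A, B)"] that by auto
  ultimately show ?thesis
    by (intro exI[of _ e]) (meson SigmaI order_le_less_trans)
qed

text \<open>Distinct words of length m over \<open>C\<close> are followed by points that separate
  within n * m steps at a scale \<open>d\<close> below the distance between members of
  \<open>C\<close>. This yields (card C) ^ m separated points.\<close>

lemma entropy_ge_horseshoe: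
  fixes T :: "'a::heine_borel \<Rightarrow> 'a"
  assumes T: "T ` X \<subseteq> X" and n: "n \<ge> 1"
    and fin: "finite C" and C: "\<And>A. A \<in> C \<Longrightarrow> compact A \<and> A \<noteq> {} \<and> A \<subseteq> X" and disj: "disjoint C"
    and sub: "\<And>A. A \<in> C \<Longrightarrow> \<Union>C \<subseteq> (T ^^ n) ` A"
    and ne: "C \<noteq> {}"
  shows "ereal (ln (real (card C)) / n) \<le> topological_entropy X T"
proof -
  obtain d where d: "d > 0" "\<And>A B x y. A \<in> C \<Longrightarrow> B \<in> C \<Longrightarrow> A \<noteq> B \<Longrightarrow> x \<in> A \<Longrightarrow> y \<in> B \<Longrightarrow> d < dist x y"
    using finite_disjoint_compact_separated[OF fin _ disj] C by (metis (no_types, lifting))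
  define u where "u = (\<lambda>n. (SUP E\<in>{E. finite E \<and> dyn_separated X T n d E}. ereal (ln (real (card E)))) / ereal (real n))"
  have N: "0 < card C" using ne fin by (simp add: card_gt_0_iff)
  have *: "ereal (ln (real (card C)) / n) \<le> u (n * m)" if m: "m \<ge> 1" for m
  proof -
    define W where "W = {w. set w \<subseteq> C \<and> length w = m}"
    have W: "finite W" "card W = card C ^ m"
      unfolding W_def using fin by (auto simp: finite_lists_length_eq card_lists_length_eq)
    have "\<exists>x. \<forall>k<length w. (T ^^ (n * k)) x \<in> w ! k" if "w \<in> W" for w
    proof (rule horseshoe_itinerary)
      show "set w \<subseteq> C" "w \<noteq> []" using that m by (auto simp: W_def)
    qed (use C sub in auto)
    then obtain p where p: "\<And>w k. w \<in> W \<Longrightarrow> k < m \<Longrightarrow> (T ^^ (n * k)) (p w) \<in> w ! k"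
      unfolding W_def by (simp) metis
    have nthC: "w ! k \<in> C" if "w \<in> W" "k < m" for w k
      using that nth_mem[of k w] by (auto simp: W_def subset_iff)
    have sep: "\<exists>k<n * m. d < dist ((T ^^ k) (p w)) ((T ^^ k) (p w'))" if w: "w \<in> W" "w' \<in> W" "w \<noteq> w'" for w w'
    proof -
      obtain k where k: "k < m" "w ! k \<noteq> w' ! k"
        using w nth_equalityI[of w w'] unfolding W_def by auto
      have "w ! k \<in> C" "w' ! k \<in> C" using nthC w(1,2) k(1) by blast+
      then have "d < dist ((T ^^ (n * k)) (p w)) ((T ^^ (n * k)) (p w'))"
        using k p that by (intro d(2)[of "w ! k" "w' ! k"]) auto
      then show ?thesis using k n by (intro exI[of _ "n * k"]) auto
    qed
    have inj: "inj_on p W"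
    proof (rule inj_onI)
      fix w w' assume "w \<in> W" "w' \<in> W" "p w = p w'"
      then show "w = w'" using sep[of w w'] d(1) by fastforce
    qed
    have "p w \<in> X" if "w \<in> W" for w
      using p[OF that, of 0] m C nthC[OF that, of 0] by auto
    then have "dyn_separated X T (n * m) d (p ` W)"
      unfolding dyn_separated_def using sep by auto
    then have "ereal (ln (real (card (p ` W)))) \<le> (SUP E\<in>{E. finite E \<and> dyn_separated X T (n * m) d E}. ereal (ln (real (card E))))"
      using W by (intro SUP_upper) auto
    then have "ereal (ln (real (card (p ` W)))) / ereal (real (n * m)) \<le> u (n * m)"
      unfolding u_def using n m by (intro ereal_divide_right_mono) auto
    also have "ereal (ln (real (card (p ` W)))) / ereal (real (n * m)) = ereal (ln (real (card C)) / n)"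
      using W inj n m N by (simp add: card_image ln_realpow)
    finally show ?thesis .
  qed
  have "ereal (ln (real (card C)) / n) \<le> limsup u" by (rule limsup_subseq_ge[of "ereal (ln (real (card C)) / n)" u n]) (use * n in auto)
  also have "\<dots> \<le> topological_entropy X T"
    unfolding topological_entropy_def u_def using d(1) by (intro SUP_upper) auto
  finally show ?thesis .
qed

text \<open>The point has to be strictly inside: consecutive gaps of a separated set share an end
  point, and the points found in them must differ.\<close>

lemma open_interval_subset_image:
  fixes f :: "real \<Rightarrow> real"
  assumes "continuous_on {a..b} f" "a < b" "y \<in> open_segment (f a) (f b)"
  shows "\<exists>x\<in>{a<..<b}. f x = y"
proof -
  have "\<exists>x. a \<le> x \<and> x \<le> b \<and> f x = y"
  proof (cases "f a \<le> f b")
    case True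
    then show ?thesis using IVT'[of f a y b] assms by (auto simp: open_segment_eq_real_ivl split: if_splits)
  next
    case False
    then show ?thesis using IVT2'[of f b y a] assms by (auto simp: open_segment_eq_real_ivl split: if_splits)
  qed
  then obtain x where "a \<le> x" "x \<le> b" "f x = y" by blast
  moreover have "x \<noteq> a" "x \<noteq> b" using \<open>f x = y\<close> assms(3) by (auto simp: open_segment_def)
  ultimately show ?thesis by force
qed

lemma exists_finite_test_set:
  assumes G: "\<And>p q. 0 \<le> p \<Longrightarrow> p < q \<Longrightarrow> q \<le> 1 \<Longrightarrow> \<exists>y\<in>G. p < y \<and> y < (q::real)" and e: "0 < e"
  shows "\<exists>F\<subseteq>G. finite F \<and> (\<forall>p q. 0 \<le> p \<and> q \<le> 1 \<and> q - p > e \<longrightarrow> (\<exists>y\<in>F. p < y \<and> y < q))"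
proof -
  \<comment> \<open>Cells of width below e / 2: an interval longer than e has a grid point at
    distance less than one cell from its left end, and contains the whole cell that follows.\<close>
  obtain N :: nat where N: "1 / real (Suc N) < e / 2" using nat_approx_posE[of "e/2"] e by (metis half_gt_zero)
  define h where "h = 1 / real (Suc N)"
  have h: "h > 0" "real (Suc N) * h = 1" by (auto simp: h_def)
  have "\<forall>k<Suc N. \<exists>y\<in>G. real k * h < y \<and> y < real (Suc k) * h"
  proof (intro allI impI G)
    fix k assume k: "k < Suc N"
    show "real k * h < real (Suc k) * h" "0 \<le> real k * h" using h by auto
    have "real (Suc k) * h \<le> real (Suc N) * h" using k h by (intro mult_right_mono) auto
    then show "real (Suc k) * h \<le> 1" unfolding h(2) .
  qed
  then obtain y where y: "\<And>k. k < Suc N \<Longrightarrow> y k \<in> G \<and> real k * h < y k \<and> y k < real (Suc k) * h" by metis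
  have "\<exists>z\<in>y ` {..<Suc N}. p < z \<and> z < q" if pq: "0 \<le> p" "q \<le> 1" "q - p > e" for p q
  proof -
    define k where "k = nat \<lceil>p / h\<rceil>"
    have k1: "p \<le> real k * h" and k2: "real k * h < p + h"
    proof -
      have "p / h \<le> real k" unfolding k_def by linarith
      then show "p \<le> real k * h" using h by (simp add: field_simps)
      have "real k < p / h + 1" unfolding k_def using pq h by (auto simp: ceiling_correct) linarith
      then show "real k * h < p + h" using h by (simp add: field_simps)
    qed
    have kk: "real (Suc k) * h < p + 2 * h" using k2 by (simp add: algebra_simps)
    also have "\<dots> < q" using pq N h_def by linarith
    finally have q: "real (Suc k) * h < q" .
    then have "real (Suc k) * h < real (Suc N) * h" using pq h by linarith
    then have "k < Suc N" using h by simp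
    then show ?thesis using y[of k] k1 q by (intro bexI[of _ "y k"]) auto
  qed
  then show ?thesis using y by (intro exI[of _ "y ` {..<Suc N}"]) auto
qed

text \<open>The gaps between consecutive points of \<open>E\<close> are disjoint, so the triples
  (order, test point, preimage) attached to them are distinct. The summand 1 is for the largest
  point, which has no successor.\<close>

lemma card_separated_le:
  fixes T :: "real \<Rightarrow> real"
  assumes T: "interval_map T" and F: "finite F" and e: "0 < e"
    and test: "\<And>p q. 0 \<le> p \<Longrightarrow> q \<le> 1 \<Longrightarrow> q - p > e \<Longrightarrow> \<exists>y\<in>F. p < y \<and> y < q"
    and cnt: "\<And>y k. y \<in> F \<Longrightarrow> finite {x\<in>{0..1}. (T ^^ k) x = y}"
    and E: "finite E" "dyn_separated {0..1} T n e E"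
  shows "card E \<le> 1 + (\<Sum>k<n. \<Sum>y\<in>F. card {x\<in>{0..1}. (T ^^ k) x = y})"
proof (cases "E = {}")
  case False
  define Z where "Z = Sigma {..<n} (\<lambda>k. Sigma F (\<lambda>y. {x\<in>{0..1}. (T ^^ k) x = y}))"
  have Z: "finite Z" "card Z = (\<Sum>k<n. \<Sum>y\<in>F. card {x\<in>{0..1}. (T ^^ k) x = y})"
    unfolding Z_def using F cnt by (auto simp: card_SigmaI finite_SigmaI)
  have EX: "E \<subseteq> {0..1}" using E by (auto simp: dyn_separated_def)
  have T01: "T ` {0..1} \<subseteq> {0..1}" and Tc: "continuous_on {0..1} T" using T by (auto simp: interval_map_def)
  have cont: "continuous_on {0..1} (T ^^ k)" for k by (rule continuous_on_funpow[OF Tc T01])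
  define nxt where "nxt x = Min {z\<in>E. x < z}" for x
  have nxt: "nxt x \<in> E" "x < nxt x" "\<And>z. z \<in> E \<Longrightarrow> x < z \<Longrightarrow> nxt x \<le> z" if "x \<in> E - {Max E}" for x
  proof -
    have "x < Max E" using that E(1) by (metis DiffD1 DiffD2 Max_ge insertI1 order_le_less)
    then have ne: "{z\<in>E. x < z} \<noteq> {}" using Max_in[OF E(1) False] by auto
    then have "nxt x \<in> {z\<in>E. x < z}" unfolding nxt_def using E(1) by (intro Min_in) auto
    then show "nxt x \<in> E" "x < nxt x" by auto
    show "nxt x \<le> z" if "z \<in> E" "x < z" for z unfolding nxt_def using that E(1) by (intro Min_le) auto
  qed
  have "\<exists>k y z. k < n \<and> y \<in> F \<and> z \<in> {x<..<nxt x} \<and> (T ^^ k) z = y" if x: "x \<in> E - {Max E}" for x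
  proof -
    obtain k where k: "k < n" "dist ((T ^^ k) x) ((T ^^ k) (nxt x)) > e"
      using E(2) nxt[OF x] x unfolding dyn_separated_def by (metis Diff_iff order_less_irrefl)
    have X: "x \<in> {0..1}" "nxt x \<in> {0..1}" using x nxt[OF x] EX by auto
    have in01: "(T ^^ k) x \<in> {0..1}" "(T ^^ k) (nxt x) \<in> {0..1}" using X funpow_in[OF T01] by blast+
    have "\<exists>y\<in>F. y \<in> open_segment u v" if "dist u v > e" "u \<in> {0..1}" "v \<in> {0..1}" for u v
      using test[of u v] test[of v u] that e by (cases "u \<le> v") (auto simp: dist_real_def open_segment_eq_real_ivl)
    then obtain y where y: "y \<in> F" "y \<in> open_segment ((T ^^ k) x) ((T ^^ k) (nxt x))"
      using k(2) in01 by blast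
    have "continuous_on {x..nxt x} (T ^^ k)" using X by (intro continuous_on_subset[OF cont]) auto
    then obtain z where "z \<in> {x<..<nxt x}" "(T ^^ k) z = y"
      using open_interval_subset_image nxt(2)[OF x] y(2) by blast
    then show ?thesis using k y by blast
  qed
  then obtain kf yf zf where f: "\<And>x. x \<in> E - {Max E} \<Longrightarrow> kf x < n \<and> yf x \<in> F \<and> zf x \<in> {x<..<nxt x} \<and> (T ^^ kf x) (zf x) = yf x"
    by metis
  have inj: "inj_on (\<lambda>x. (kf x, yf x, zf x)) (E - {Max E})"
  proof (rule inj_onI)
    fix x x' assume x: "x \<in> E - {Max E}" and x': "x' \<in> E - {Max E}" and "(kf x, yf x, zf x) = (kf x', yf x', zf x')"
    then have "zf x = zf x'" by simp
    then have "zf x \<in> {x<..<nxt x}" "zf x \<in> {x'<..<nxt x'}" using f[OF x] f[OF x'] by auto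
    then have "x < nxt x'" "x' < nxt x" by auto
    then show "x = x'" using nxt(3)[OF x, of x'] nxt(3)[OF x', of x] x x' by fastforce
  qed
  have "(\<lambda>x. (kf x, yf x, zf x)) ` (E - {Max E}) \<subseteq> Z"
  proof
    fix t assume "t \<in> (\<lambda>x. (kf x, yf x, zf x)) ` (E - {Max E})"
    then obtain x where x: "x \<in> E - {Max E}" "t = (kf x, yf x, zf x)" by auto
    have "x \<in> {0..1}" "nxt x \<in> {0..1}" using x nxt[OF x(1)] EX by auto
    then show "t \<in> Z" using f[OF x(1)] x(2) by (auto simp: Z_def)
  qed
  then have "card (E - {Max E}) \<le> card Z" using inj Z(1) by (metis card_image card_mono)
  then show ?thesis using Z(2) E(1) by (metis Max_in False Suc_eq_plus1_left Suc_le_mono card_Suc_Diff1)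
qed simp

text \<open>The counts of all orders below n add up to at most D * n * l ^ n, where l \<ge> 1 allows
  l ^ k to be replaced by l ^ n. The linear factor disappears in the exponential growth
  rate.\<close>

lemma entropy_le_of_preimage_growth:
  fixes T :: "real \<Rightarrow> real"
  assumes T: "interval_map T" and l: "1 \<le> l"
    and G: "\<And>p q. 0 \<le> p \<Longrightarrow> p < q \<Longrightarrow> q \<le> 1 \<Longrightarrow> \<exists>y\<in>G. p < y \<and> y < q"
    and cnt: "\<And>y. y \<in> G \<Longrightarrow> \<exists>C. \<forall>k. finite {x\<in>{0..1}. (T ^^ k) x = y} \<and> real (card {x\<in>{0..1}. (T ^^ k) x = y}) \<le> C * l ^ k"
  shows "h_top T \<le> ereal (ln l)"
  unfolding topological_entropy_def
proof (rule SUP_least)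
  fix e :: real assume "e \<in> {0<..}"
  then have e: "e > 0" by simp
  obtain F where F: "F \<subseteq> G" "finite F" "\<And>p q. 0 \<le> p \<Longrightarrow> q \<le> 1 \<Longrightarrow> q - p > e \<Longrightarrow> \<exists>y\<in>F. p < y \<and> y < q"
  proof -
    have "\<exists>F\<subseteq>G. finite F \<and> (\<forall>p q. 0 \<le> p \<and> q \<le> 1 \<and> q - p > e \<longrightarrow> (\<exists>y\<in>F. p < y \<and> y < q))"
      using G e by (rule exists_finite_test_set)
    then obtain F where "F \<subseteq> G" "finite F" "\<forall>p q. 0 \<le> p \<and> q \<le> 1 \<and> q - p > e \<longrightarrow> (\<exists>y\<in>F. p < y \<and> y < q)" by blast
    then show ?thesis by (intro that[of F]) simp_all
  qed
  obtain C where C: "\<And>y k. y \<in> F \<Longrightarrow> finite {x\<in>{0..1}. (T ^^ k) x = y} \<and> real (card {x\<in>{0..1}. (T ^^ k) x = y}) \<le> C y * l ^ k"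
  proof -
    have "\<forall>y\<in>F. \<exists>C. \<forall>k. finite {x\<in>{0..1}. (T ^^ k) x = y} \<and> real (card {x\<in>{0..1}. (T ^^ k) x = y}) \<le> C * l ^ k"
      using cnt F(1) by blast
    then obtain C where "\<forall>y\<in>F. \<forall>k. finite {x\<in>{0..1}. (T ^^ k) x = y} \<and> real (card {x\<in>{0..1}. (T ^^ k) x = y}) \<le> C y * l ^ k"
      by (rule bchoice[THEN exE])
    then show ?thesis by (intro that[of C]) simp
  qed
  define D where "D = 1 + (\<Sum>y\<in>F. \<bar>C y\<bar>)"
  have D: "D \<ge> 1" by (simp add: D_def sum_nonneg)
  have card: "real (card E) \<le> (1 + D * real n) * l ^ n" if E: "finite E" "dyn_separated {0..1} T n e E" for E n
  proof -
    have "real (card E) \<le> real (1 + (\<Sum>k<n. \<Sum>y\<in>F. card {x\<in>{0..1}. (T ^^ k) x = y}))"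
      by (intro of_nat_mono card_separated_le[OF T F(2) e F(3) _ E]) (use C in auto)
    also have "\<dots> = 1 + (\<Sum>k<n. \<Sum>y\<in>F. real (card {x\<in>{0..1}. (T ^^ k) x = y}))" by simp
    also have "(\<Sum>k<n. \<Sum>y\<in>F. real (card {x\<in>{0..1}. (T ^^ k) x = y})) \<le> (\<Sum>k<n. D * l ^ n)"
    proof (rule sum_mono)
      fix k assume k: "k \<in> {..<n}"
      have "(\<Sum>y\<in>F. real (card {x\<in>{0..1}. (T ^^ k) x = y})) \<le> (\<Sum>y\<in>F. \<bar>C y\<bar> * l ^ n)"
      proof (rule sum_mono)
        fix y assume "y \<in> F"
        then have "real (card {x\<in>{0..1}. (T ^^ k) x = y}) \<le> C y * l ^ k" using C by blast
        also have "\<dots> \<le> \<bar>C y\<bar> * l ^ n" using l k by (intro mult_mono power_increasing) auto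
        finally show "real (card {x\<in>{0..1}. (T ^^ k) x = y}) \<le> \<bar>C y\<bar> * l ^ n" .
      qed
      also have "\<dots> \<le> D * l ^ n" using l unfolding D_def by (auto simp: sum_distrib_right distrib_right)
      finally show "(\<Sum>y\<in>F. real (card {x\<in>{0..1}. (T ^^ k) x = y})) \<le> D * l ^ n" .
    qed
    also have "1 + (\<Sum>k<n. D * l ^ n) \<le> (1 + D * real n) * l ^ n"
      using one_le_power[OF l, of n] by (simp add: algebra_simps)
    finally show ?thesis by simp
  qed
  have le: "(SUP E\<in>{E. finite E \<and> dyn_separated {0..1} T n e E}. ereal (ln (real (card E)))) / ereal (real n)
      \<le> ereal (ln (1 + D) / n + ln n / n + ln l)" if n: "n \<ge> 1" for n
  proof -
    have "(SUP E\<in>{E. finite E \<and> dyn_separated {0..1} T n e E}. ereal (ln (real (card E)))) \<le> ereal (ln (1 + D * real n) + n * ln l)"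
    proof (rule SUP_least)
      fix E assume E: "E \<in> {E. finite E \<and> dyn_separated {0..1} T n e E}"
      have pos: "0 < 1 + D * real n" "0 < l ^ n" using D l n by (auto intro: add_pos_nonneg)
      show "ereal (ln (real (card E))) \<le> ereal (ln (1 + D * real n) + n * ln l)"
      proof (cases "card E = 0")
        case True
        have "0 \<le> ln (1 + D * real n)" "0 \<le> n * ln l" using D l by auto
        then show ?thesis unfolding True by simp
      next
        case False
        then have "ln (real (card E)) \<le> ln ((1 + D * real n) * l ^ n)"
          using card[of E n] E pos by (subst ln_le_cancel_iff) auto
        also have "\<dots> = ln (1 + D * real n) + n * ln l" using pos l by (simp add: ln_mult ln_realpow)
        finally show ?thesis by simp
      qed
    qed
    then have "(SUP E\<in>{E. finite E \<and> dyn_separated {0..1} T n e E}. ereal (ln (real (card E)))) / ereal (real n)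
       \<le> ereal (ln (1 + D * real n) + n * ln l) / ereal (real n)"
      using n by (intro ereal_divide_right_mono) auto
    also have "\<dots> = ereal (ln (1 + D * real n) / n + ln l)" using n by (simp add: field_simps)
    also have "ln (1 + D * real n) \<le> ln ((1 + D) * n)"
      using n D by (subst ln_le_cancel_iff) (auto simp: algebra_simps intro: add_pos_nonneg)
    then have "ereal (ln (1 + D * real n) / n + ln l) \<le> ereal (ln (1 + D) / n + ln n / n + ln l)"
      using n D by (simp add: ln_mult divide_right_mono flip: add_divide_distrib)
    finally show ?thesis .
  qed
  have "(\<lambda>n. ln (1 + D) / n + ln n / n + ln l) \<longlonglongrightarrow> 0 + 0 + ln l"
    by (intro tendsto_add tendsto_const lim_const_over_n lim_ln_over_n)
  then have lim: "(\<lambda>n. ereal (ln (1 + D) / n + ln n / n + ln l)) \<longlonglongrightarrow> ereal (ln l)" by simp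
  have "limsup (\<lambda>n. (SUP E\<in>{E. finite E \<and> dyn_separated {0..1} T n e E}. ereal (ln (real (card E)))) / ereal (real n))
     \<le> limsup (\<lambda>n. ereal (ln (1 + D) / n + ln n / n + ln l))"
    by (rule Limsup_mono) (use le in \<open>auto simp: eventually_sequentially intro!: exI[of _ 1]\<close>)
  also have "\<dots> = ereal (ln l)" using lim by (intro lim_imp_Limsup) auto
  finally show "limsup (\<lambda>n. (SUP E\<in>{E. finite E \<and> dyn_separated {0..1} T n e E}. ereal (ln (real (card E)))) / ereal (real n)) \<le> ereal (ln l)" .
qed

section \<open>Markov maps and counting of preimages\<close>

text \<open>Uniqueness of the tile is required only where \<open>h\<close> does not vanish, so
  common end points of tiles do no harm.\<close>

lemma csum_tiling:
  assumes uniq: "\<And>x. x \<in> A \<Longrightarrow> h x \<noteq> 0 \<Longrightarrow> \<exists>!\<alpha>. \<alpha> \<in> F \<and> x \<in> \<alpha>" and sub: "\<And>\<alpha>. \<alpha> \<in> F \<Longrightarrow> \<alpha> \<subseteq> A"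
  shows "csum A h = csum F (\<lambda>\<alpha>. csum \<alpha> h)"
proof -
  have "csum A h = csum A (\<lambda>x. csum F (\<lambda>\<alpha>. h x * indicator \<alpha> x))"
  proof (rule csum_cong)
    fix x assume x: "x \<in> A"
    show "h x = csum F (\<lambda>\<alpha>. h x * indicator \<alpha> x)"
    proof (cases "h x = 0")
      case False
      from uniq[OF x False] obtain \<alpha> where \<alpha>0: "\<alpha> \<in> F \<and> x \<in> \<alpha>" and uni': "\<forall>\<beta>. \<beta> \<in> F \<and> x \<in> \<beta> \<longrightarrow> \<beta> = \<alpha>"
        by (rule ex1E)
      have \<alpha>: "\<alpha> \<in> F" "x \<in> \<alpha>" using \<alpha>0 by simp_all
      have uni: "\<beta> = \<alpha>" if "\<beta> \<in> F" "x \<in> \<beta>" for \<beta>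
        using uni' that by simp
      have "csum F (\<lambda>\<beta>. h x * indicator \<beta> x) = csum F (\<lambda>\<beta>. h x * (if \<beta> = \<alpha> then 1 else 0))"
        using \<alpha> by (intro csum_cong) (auto simp: indicator_def dest: uni)
      then show ?thesis using csum_single[OF \<alpha>(1), of "\<lambda>_. h x"] by simp
    qed simp
  qed
  also have "\<dots> = csum F (\<lambda>\<alpha>. csum A (\<lambda>x. h x * indicator \<alpha> x))" by (rule csum_swap)
  also have "\<dots> = csum F (\<lambda>\<alpha>. csum \<alpha> h)"
  proof (rule csum_cong)
    fix \<alpha> assume "\<alpha> \<in> F"
    then have "csum \<alpha> (\<lambda>x. h x * indicator \<alpha> x) = csum A (\<lambda>x. h x * indicator \<alpha> x)"
      using sub by (intro nn_integral_count_space_eq) auto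
    moreover have "csum \<alpha> (\<lambda>x. h x * indicator \<alpha> x) = csum \<alpha> h" by (rule csum_cong) simp
    ultimately show "csum A (\<lambda>x. h x * indicator \<alpha> x) = csum \<alpha> h" by simp
  qed
  finally show ?thesis .
qed

text \<open>A subset of \<open>A\<close> mapped bijectively onto \<open>B\<close> already carries
  the left-hand side.\<close>

lemma csum_image_le:
  assumes "B \<subseteq> g ` A" shows "csum B f \<le> csum A (\<lambda>x. f (g x))"
proof -
  obtain A' where A': "A' \<subseteq> A" "bij_betw g A' B"
    using assms by (metis subset_image_inj inj_on_imp_bij_betw)
  have "csum B f = csum A' (\<lambda>x. f (g x))" by (rule nn_integral_bij_count_space[OF A'(2), symmetric])
  also have "\<dots> \<le> csum A (\<lambda>x. f (g x))" by (rule csum_mono_set[OF A'(1)])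
  finally show ?thesis .
qed

lemma csum_image_inj: "inj_on g A \<Longrightarrow> csum (g ` A) f = csum A (\<lambda>x. f (g x))"
  by (rule nn_integral_bij_count_space[OF inj_on_imp_bij_betw, symmetric])

lemma csum_indicator_card:
  "csum A (\<lambda>x. if Q x then 1 else 0) = (if finite {x\<in>A. Q x} then of_nat (card {x\<in>A. Q x}) else \<infinity>)"
proof -
  have "csum A (\<lambda>x. if Q x then 1 else 0) = csum A (indicator {x\<in>A. Q x})"
    by (intro csum_cong) auto
  also have "\<dots> = emeasure (count_space A) {x\<in>A. Q x}" by (rule nn_integral_indicator) auto
  finally show ?thesis by (subst (asm) emeasure_count_space) auto
qed

lemma image_closed_interval_inj:
  fixes f :: "real \<Rightarrow> real"
  assumes "continuous_on {p..q} f" "inj_on f {p..q}" "p \<le> q"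
  shows "f ` {p..q} = closed_segment (f p) (f q)"
proof
  have "f x \<in> closed_segment (f p) (f q)" if "x \<in> {p..q}" for x
  proof (cases "x = p \<or> x = q")
    case False
    then have "p < x" "x < q" using that by auto
    from continuous_inj_imp_mono[OF this assms(1,2)] show ?thesis
      by (auto simp: closed_segment_eq_real_ivl)
  qed auto
  then show "f ` {p..q} \<subseteq> closed_segment (f p) (f q)" by auto
  show "closed_segment (f p) (f q) \<subseteq> f ` {p..q}"
    using assms(1,3) connected_continuous_image[OF assms(1)]
    by (metis atLeastAtMost_iff connected_Icc connected_contains_Icc closed_segment_commute closed_segment_eq_real_ivl imageI order_refl)
qed

text \<open>The family \<open>L\<close> of laps is kept abstract: injectivity and the position of
  the end point images replace maximality. Thus the pieces of a perturbation serve as laps on the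
  partition of the unperturbed map, and both maps are counted over the same index set.\<close>

locale markov_map =
  fixes T :: "real \<Rightarrow> real" and P L :: "real set set" and M :: "real set \<Rightarrow> real set \<Rightarrow> real"
  assumes T: "interval_map T" and mixing: "topologically_mixing {0..1} T"
    and P_countable: "countable P"
    and P_ivl: "\<And>i. i \<in> P \<Longrightarrow> \<exists>a b. 0 \<le> a \<and> a < b \<and> b \<le> 1 \<and> i = {a..b}"
    and P_disj: "\<And>i j. i \<in> P \<Longrightarrow> j \<in> P \<Longrightarrow> i \<noteq> j \<Longrightarrow> interior i \<inter> interior j = {}"
    and P_cover: "countable ({0..1} - (\<Union>i\<in>P. interior i))"
    and L_ivl: "\<And>U. U \<in> L \<Longrightarrow> \<exists>a b. a < b \<and> U = {a..b}"
    and L_sub: "\<And>U. U \<in> L \<Longrightarrow> \<exists>i\<in>P. U \<subseteq> i"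
    and L_disj: "\<And>U V. U \<in> L \<Longrightarrow> V \<in> L \<Longrightarrow> U \<noteq> V \<Longrightarrow> interior U \<inter> interior V = {}"
    and L_cover: "countable ({0..1} - (\<Union>U\<in>L. interior U))"
    and L_inj: "\<And>U. U \<in> L \<Longrightarrow> inj_on T U"
    and L_ends: "\<And>a b. a < b \<Longrightarrow> {a..b} \<in> L \<Longrightarrow> T a \<notin> (\<Union>i\<in>P. interior i) \<and> T b \<notin> (\<Union>i\<in>P. interior i)"
    and M_card: "\<And>i j. i \<in> P \<Longrightarrow> j \<in> P \<Longrightarrow> finite {U\<in>L. U \<subseteq> i \<and> j \<subseteq> T ` U} \<and> M i j = real (card {U\<in>L. U \<subseteq> i \<and> j \<subseteq> T ` U})"
begin

lemma T_cont: "continuous_on {0..1} T" and T_image: "T ` {0..1} \<subseteq> {0..1}"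
  using T by (auto simp: interval_map_def)

lemma T_in: "x \<in> {0..1} \<Longrightarrow> T x \<in> {0..1}" using T_image by blast

lemma Tn_in: "x \<in> {0..1} \<Longrightarrow> (T ^^ n) x \<in> {0..1}" by (rule funpow_in[OF T_image])

lemma Tn_cont: "continuous_on {0..1} (T ^^ n)" by (rule continuous_on_funpow[OF T_cont T_image])

lemma P_sub: "i \<in> P \<Longrightarrow> i \<subseteq> {0..1}" using P_ivl by fastforce

lemma L_sub01: "U \<in> L \<Longrightarrow> U \<subseteq> {0..1}" using L_sub P_sub by blast

text \<open>Forward images of the points outside lap interiors, so that genericity passes to
  preimages: the whole backward orbit of a generic point stays inside lap interiors. The set is
  countable, hence generic points are dense.\<close>

definition "nongen = (\<Union>n. (T ^^ n) ` ({0..1} - (\<Union>U\<in>L. interior U)))"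

definition "gen y \<longleftrightarrow> y \<in> {0..1} \<and> y \<notin> nongen"

lemma nongen_countable: "countable nongen"
  unfolding nongen_def using L_cover by auto

lemma gen_back: "gen ((T ^^ n) x) \<Longrightarrow> x \<in> {0..1} \<Longrightarrow> gen x"
  unfolding gen_def nongen_def
proof safe
  fix m d assume "(T ^^ n) ((T ^^ m) d) \<notin> (\<Union>n. (T ^^ n) ` ({0..1} - \<Union> (interior ` L)))"
    "d \<in> {0..1}" "d \<notin> \<Union> (interior ` L)"
  moreover have "(T ^^ n) ((T ^^ m) d) = (T ^^ (n + m)) d" by (simp add: funpow_add)
  ultimately show False by (metis (no_types, lifting) DiffI UNIV_I UN_I imageI)
qed

lemma gen_L: "gen x \<Longrightarrow> \<exists>U\<in>L. x \<in> interior U"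
proof (rule ccontr)
  assume x: "gen x" "\<not> (\<exists>U\<in>L. x \<in> interior U)"
  then have "x \<in> (T ^^ 0) ` ({0..1} - (\<Union>U\<in>L. interior U))" by (auto simp: gen_def)
  then show False using x unfolding gen_def nongen_def by blast
qed

lemma gen_P: "gen x \<Longrightarrow> \<exists>i\<in>P. x \<in> interior i"
  using gen_L L_sub interior_mono by (metis subsetD)

lemma interior_meets:
  fixes i V :: "real set"
  assumes "x \<in> i" "i = {a..b}" "a < b" "x \<in> V" "open V" shows "interior i \<inter> V \<noteq> {}"
proof -
  have "x \<in> closure (interior i)" using assms by simp
  then show ?thesis using assms by (metis Int_commute closure_iff_nhds_not_empty[THEN iffD1, rule_format] disjoint_iff interior_open interior_subset open_Int_closure_eq_empty)
qed

lemma P_unique: "i \<in> P \<Longrightarrow> j \<in> P \<Longrightarrow> x \<in> i \<Longrightarrow> x \<in> interior j \<Longrightarrow> i = j"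
  using P_disj[of i j] P_ivl[of i] interior_meets[of x i _ _ "interior j"] by blast

lemma L_unique: "U \<in> L \<Longrightarrow> V \<in> L \<Longrightarrow> x \<in> U \<Longrightarrow> x \<in> interior V \<Longrightarrow> U = V"
  using L_disj[of U V] L_ivl[of U] interior_meets[of x U _ _ "interior V"] by blast

lemma gen_P_unique: "gen x \<Longrightarrow> \<exists>!i. i \<in> P \<and> x \<in> i"
  using gen_P P_unique interior_subset by blast

lemma gen_L_unique: "gen x \<Longrightarrow> \<exists>!U. U \<in> L \<and> x \<in> U"
  using gen_L L_unique interior_subset by blast

lemma gen_P_interior: "gen x \<Longrightarrow> i \<in> P \<Longrightarrow> x \<in> i \<Longrightarrow> x \<in> interior i"
  using gen_P P_unique by blast

lemma gen_dense:
  assumes "0 \<le> p" "p < q" "q \<le> 1" "countable N"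
  shows "\<exists>y. gen y \<and> y \<notin> N \<and> p < y \<and> y < q"
proof -
  have "uncountable ({p<..<q} - (nongen \<union> N))"
    using assms nongen_countable by (intro uncountable_minus_countable) (auto simp: uncountable_open_interval)
  then obtain y where "y \<in> {p<..<q} - (nongen \<union> N)" by (metis countable_empty ex_in_conv)
  then show ?thesis using assms by (intro exI[of _ y]) (auto simp: gen_def)
qed

lemma gen_in_P:
  assumes "i \<in> P" "countable N" shows "\<exists>y. gen y \<and> y \<notin> N \<and> y \<in> interior i"
proof -
  obtain a b where ab: "0 \<le> a" "a < b" "b \<le> 1" "i = {a..b}" using P_ivl[OF assms(1)] by blast
  then show ?thesis using gen_dense[OF ab(1-3) assms(2)] by auto
qed

lemma P_interior_sub: "i \<in> P \<Longrightarrow> interior i \<subseteq> {0<..<1}"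
  using P_ivl by fastforce

lemma T_image_L:
  assumes U: "{a..b} \<in> L" and ab: "a \<le> s" "s \<le> t" "t \<le> b"
  shows "T ` {s..t} = closed_segment (T s) (T t)"
proof (rule image_closed_interval_inj)
  have "{s..t} \<subseteq> {a..b}" using ab by auto
  then show "continuous_on {s..t} T" "inj_on T {s..t}"
    using L_sub01[OF U] L_inj[OF U] continuous_on_subset[OF T_cont] inj_on_subset by blast+
qed (use ab in auto)

lemma P_sub_interval:
  assumes j: "j \<in> P" and y: "y \<in> interior j" "c \<le> y" "y \<le> d"
    and c: "c \<notin> interior j" and d: "d \<notin> interior j"
  shows "j \<subseteq> {c..d}"
  using P_ivl[OF j] assms by auto

text \<open>The Markov property in terms of laps: the image is the segment between the images of the
  end points, and these avoid the interior of \<open>j\<close>.\<close>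

lemma L_covers:
  assumes U: "U \<in> L" and j: "j \<in> P" and y: "y \<in> interior j" "y \<in> T ` U"
  shows "j \<subseteq> T ` U"
proof -
  obtain a b where ab: "a < b" "U = {a..b}" using L_ivl[OF U] by blast
  have im: "T ` U = closed_segment (T a) (T b)" using T_image_L[of a b a b] U ab by auto
  have "T a \<notin> interior j" "T b \<notin> interior j" using L_ends[of a b] U ab j by auto
  then show ?thesis unfolding im
    using P_sub_interval[OF j y(1), of "T a" "T b"] P_sub_interval[OF j y(1), of "T b" "T a"] y(2)
    unfolding im by (auto simp: closed_segment_eq_real_ivl split: if_splits)
qed

text \<open>Each preimage of \<open>y\<close> is generic and thus interior to exactly one lap, and a
  lap contains at most one preimage. Preimages therefore correspond to the laps that cover
  \<open>j\<close>.\<close>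

lemma count_one:
  assumes i: "i \<in> P" and j: "j \<in> P" and y: "gen y" "y \<in> interior j"
  shows "csum i (\<lambda>x. if T x = y then 1 else 0) = ennreal (M i j)"
proof -
  define lap where "lap x = (THE U. U \<in> L \<and> x \<in> U)" for x
  have lap: "lap x \<in> L" "x \<in> interior (lap x)" "\<And>U. U \<in> L \<Longrightarrow> x \<in> U \<Longrightarrow> U = lap x" "gen x"
    if "x \<in> i" "T x = y" for x
  proof -
    show g: "gen x" using gen_back[of 1 x] that y P_sub[OF i] by auto
    obtain U where U: "U \<in> L" "x \<in> interior U" using gen_L[OF g] by blast
    have "lap x = U" unfolding lap_def
      using U L_unique interior_subset by (intro the_equality) blast+
    then show "lap x \<in> L" "x \<in> interior (lap x)" "\<And>U. U \<in> L \<Longrightarrow> x \<in> U \<Longrightarrow> U = lap x"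
      using U L_unique by auto
  qed
  have "bij_betw lap {x\<in>i. T x = y} {U\<in>L. U \<subseteq> i \<and> j \<subseteq> T ` U}"
    unfolding bij_betw_def
  proof (intro conjI equalityI subsetI)
    show "inj_on lap {x \<in> i. T x = y}"
    proof (rule inj_onI)
      fix x x' assume x: "x \<in> {x \<in> i. T x = y}" "x' \<in> {x \<in> i. T x = y}" "lap x = lap x'"
      then have "x \<in> lap x" "x' \<in> lap x" using lap(2) interior_subset by blast+
      then show "x = x'" using L_inj[of "lap x"] lap(1)[of x] x by (auto dest: inj_onD)
    qed
  next
    fix U assume "U \<in> lap ` {x \<in> i. T x = y}"
    then obtain x where x: "x \<in> i" "T x = y" "U = lap x" by auto
    have xU: "x \<in> U" using lap(2)[OF x(1,2)] interior_subset x(3) by blast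
    obtain i' where "i' \<in> P" "U \<subseteq> i'" using L_sub lap(1)[OF x(1,2)] x(3) by blast
    moreover have "i' = i" using gen_P_unique[OF lap(4)[OF x(1,2)]] calculation xU x i by blast
    moreover have "j \<subseteq> T ` U" using L_covers[OF _ j y(2)] lap(1)[OF x(1,2)] x xU by auto
    ultimately show "U \<in> {U \<in> L. U \<subseteq> i \<and> j \<subseteq> T ` U}" using lap(1)[OF x(1,2)] x(3) by auto
  next
    fix U assume U: "U \<in> {U \<in> L. U \<subseteq> i \<and> j \<subseteq> T ` U}"
    then obtain x where x: "x \<in> U" "T x = y" using y(2) interior_subset by blast
    then have "U = lap x" using lap(3)[of x U] U by auto
    then show "U \<in> lap ` {x \<in> i. T x = y}" using x U by auto
  qed
  then have "finite {x\<in>i. T x = y}" "card {x\<in>i. T x = y} = card {U\<in>L. U \<subseteq> i \<and> j \<subseteq> T ` U}"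
    using M_card[OF i j] by (auto simp: bij_betw_finite dest: bij_betw_same_card)
  then show ?thesis unfolding csum_indicator_card using M_card[OF i j] by (simp add: ennreal_of_nat_eq_real_of_nat)
qed

text \<open>Stated for any weight supported on generic points: the indicator of a point gives the
  powers of \<open>M\<close>, an atomic weight gives the masses of the pulled back measures.\<close>

lemma count_Suc:
  assumes f: "\<And>x. x \<in> {0..1} \<Longrightarrow> \<not> gen x \<Longrightarrow> f x = 0" and i: "i \<in> P"
  shows "csum i (\<lambda>x. f ((T ^^ Suc n) x)) = csum P (\<lambda>\<alpha>. ennreal (M i \<alpha>) * csum \<alpha> (\<lambda>x. f ((T ^^ n) x)))"
proof -
  define g where "g z = f ((T ^^ n) z)" for z
  have g: "g z = 0" if "z \<in> {0..1}" "\<not> gen z" for z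
    unfolding g_def using gen_back[of n z] that f Tn_in by blast
  have "csum i (\<lambda>x. f ((T ^^ Suc n) x)) = csum i (\<lambda>x. g (T x))"
    by (intro csum_cong) (simp add: g_def funpow_swap1)
  \<comment> \<open>Inserting z = T x as a summation variable allows the sums over x and z to be
    exchanged.\<close>
  also have "\<dots> = csum i (\<lambda>x. csum {0..1} (\<lambda>z. g z * (if T x = z then 1 else 0)))"
  proof (rule csum_cong)
    fix x assume "x \<in> i"
    then have "T x \<in> {0..1}" using P_sub[OF i] T_in by blast
    from csum_single[OF this, of g] show "g (T x) = csum {0..1} (\<lambda>z. g z * (if T x = z then 1 else 0))"
      by (simp add: eq_commute)
  qed
  also have "\<dots> = csum {0..1} (\<lambda>z. csum i (\<lambda>x. g z * (if T x = z then 1 else 0)))" by (rule csum_swap)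
  also have "\<dots> = csum {0..1} (\<lambda>z. g z * csum i (\<lambda>x. if T x = z then 1 else 0))" by (simp only: csum_cmult)
  also have "\<dots> = csum P (\<lambda>\<alpha>. csum \<alpha> (\<lambda>z. g z * csum i (\<lambda>x. if T x = z then 1 else 0)))"
  proof (rule csum_tiling)
    fix z :: real assume z: "z \<in> {0..1}" and nz: "g z * csum i (\<lambda>x. if T x = z then 1 else 0) \<noteq> 0"
    have "g z \<noteq> 0" using nz by auto
    then have "gen z" using g[OF z] by blast
    then show "\<exists>!\<alpha>. \<alpha> \<in> P \<and> z \<in> \<alpha>" by (rule gen_P_unique)
  qed (rule P_sub)
  also have "\<dots> = csum P (\<lambda>\<alpha>. csum \<alpha> (\<lambda>z. ennreal (M i \<alpha>) * g z))"
  proof (intro csum_cong)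
    fix \<alpha> z assume \<alpha>: "\<alpha> \<in> P" and z: "z \<in> \<alpha>"
    show "g z * csum i (\<lambda>x. if T x = z then 1 else 0) = ennreal (M i \<alpha>) * g z"
    proof (cases "gen z")
      case True
      then show ?thesis using count_one[OF i \<alpha> True gen_P_interior[OF True \<alpha> z]] by (simp add: mult.commute)
    next
      case False
      then show ?thesis using g[of z] P_sub[OF \<alpha>] z by auto
    qed
  qed
  finally show ?thesis by (simp add: csum_cmult g_def)
qed

lemma mat_power_count:
  assumes "i \<in> P" and j: "j \<in> P" and y: "gen y" "y \<in> interior j"
  shows "mat_power P M n i j = csum i (\<lambda>x. if (T ^^ n) x = y then 1 else 0)"
  using assms(1)
proof (induction n arbitrary: i)
  case 0
  show ?case
  proof (cases "i = j")
    case True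
    have "y \<in> j" using y interior_subset by blast
    from csum_single[OF this, of "\<lambda>_. 1"] show ?thesis using True by simp
  next
    case False
    then have "y \<notin> i" using P_unique[OF 0 j _ y(2)] by blast
    then have "csum i (\<lambda>x. if (T ^^ 0) x = y then 1 else 0) = csum i (\<lambda>x. 0)" by (intro csum_cong) auto
    then show ?thesis using False by simp
  qed
next
  case (Suc n)
  have "csum i (\<lambda>x. if (T ^^ Suc n) x = y then 1 else (0::ennreal))
     = csum P (\<lambda>\<alpha>. ennreal (M i \<alpha>) * csum \<alpha> (\<lambda>x. if (T ^^ n) x = y then 1 else 0))"
    using y by (intro count_Suc[of "\<lambda>z. if z = y then 1 else 0"] Suc) auto
  then show ?case unfolding mat_power_Suc_csum[OF P_countable] using Suc.IH by (simp cong: csum_cong)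
qed

section \<open>Covering by iterates, irreducibility and the radius of convergence\<close>

text \<open>For large n the connected image meets both [0, a) and (b, 1]. Mixing only brings it
  close to 0 and 1, so the target has to stay away from both ends.\<close>

lemma mixing_covers:
  assumes "0 \<le> p" "p < q" "q \<le> 1" "0 < a" "b < 1"
  shows "\<exists>N. \<forall>n\<ge>N. {a..b} \<subseteq> (T ^^ n) ` {p<..<q}"
proof (cases "a \<le> b")
  case True
  have op: "openin (top_of_set {0..1}) ({0..1} \<inter> W)" if "open W" for W :: "real set"
    using that by (rule openin_open_Int)
  have U: "{p<..<q} = {0..1} \<inter> {p<..<q}" "{0..<a} = {0..1} \<inter> {..<a}" "{b<..1} = {0..1} \<inter> {b<..}"
    using assms True by auto
  obtain N1 where N1: "\<And>n. n \<ge> N1 \<Longrightarrow> (T ^^ n) ` {p<..<q} \<inter> {0..<a} \<noteq> {}"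
  proof -
    have "openin (top_of_set {0..1}) {p<..<q}" "openin (top_of_set {0..1}) {0..<a}"
      using op[OF open_greaterThanLessThan, of p q] op[OF open_lessThan, of a] by (simp_all only: U(1,2)[symmetric])
    moreover have "{p<..<q} \<noteq> {}" "{0..<a} \<noteq> {}" using assms by auto
    ultimately show ?thesis using mixing that unfolding topologically_mixing_def by blast
  qed
  obtain N2 where N2: "\<And>n. n \<ge> N2 \<Longrightarrow> (T ^^ n) ` {p<..<q} \<inter> {b<..1} \<noteq> {}"
  proof -
    have "openin (top_of_set {0..1}) {p<..<q}" "openin (top_of_set {0..1}) {b<..1}"
      using op[OF open_greaterThanLessThan, of p q] op[OF open_greaterThan, of b] by (simp_all only: U(1,3)[symmetric])
    moreover have "{p<..<q} \<noteq> {}" "{b<..1} \<noteq> {}" using assms by auto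
    ultimately show ?thesis using mixing that unfolding topologically_mixing_def by blast
  qed
  have "{a..b} \<subseteq> (T ^^ n) ` {p<..<q}" if n: "n \<ge> max N1 N2" for n
  proof -
    have "continuous_on {p<..<q} (T ^^ n)" using assms by (intro continuous_on_subset[OF Tn_cont]) auto
    then have conn: "connected ((T ^^ n) ` {p<..<q})" by (rule connected_continuous_image) auto
    have "N1 \<le> n" "N2 \<le> n" using n by auto
    then obtain u v where uv: "u \<in> (T ^^ n) ` {p<..<q} \<inter> {0..<a}" "v \<in> (T ^^ n) ` {p<..<q} \<inter> {b<..1}"
      using N1[of n] N2[of n] by (meson ex_in_conv)
    then have "u \<in> (T ^^ n) ` {p<..<q}" "u < a" "v \<in> (T ^^ n) ` {p<..<q}" "b < v" by auto
    then have "{u..v} \<subseteq> (T ^^ n) ` {p<..<q}" using connected_contains_Icc[OF conn] by blast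
    then show ?thesis using \<open>u < a\<close> \<open>b < v\<close> by fastforce
  qed
  then show ?thesis by blast
qed auto

lemma P_covers:
  assumes "i \<in> P" "0 < a" "b < 1"
  shows "\<exists>N. \<forall>n\<ge>N. {a..b} \<subseteq> (T ^^ n) ` interior i"
  using P_ivl[OF assms(1)] mixing_covers[OF _ _ _ assms(2,3)] by fastforce

text \<open>Covering a single generic point of \<open>j\<close> is enough. This is irreducibility
  and aperiodicity in one statement.\<close>

lemma mat_power_eventually_ge_1:
  assumes i: "i \<in> P" and j: "j \<in> P"
  shows "\<exists>N. \<forall>n\<ge>N. 1 \<le> mat_power P M n i j"
proof -
  obtain y where y: "gen y" "y \<in> interior j" using gen_in_P[OF j, of "{}"] by auto
  have "y \<in> {0<..<1}" using P_interior_sub[OF j] y by auto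
  then obtain N where N: "\<And>n. n \<ge> N \<Longrightarrow> {y..y} \<subseteq> (T ^^ n) ` interior i" using P_covers[OF i, of y y] by auto
  have "1 \<le> mat_power P M n i j" if n: "n \<ge> N" for n
  proof -
    obtain x where x: "x \<in> i" "(T ^^ n) x = y" using N[OF n] interior_subset by fastforce
    then show ?thesis unfolding mat_power_count[OF i j y]
      using csum_upper[OF x(1), of "\<lambda>x. if (T ^^ n) x = y then 1 else 0"] by simp
  qed
  then show ?thesis by blast
qed

text \<open>Every path from i' to j' extends to one from i to j by fixed paths of lengths a and b,
  at the cost of the factor z ^ (a + b).\<close>

lemma green_finite_transfer:
  assumes ij: "i \<in> P" "j \<in> P" and ij': "i' \<in> P" "j' \<in> P" and z: "0 < z" and fin: "green P M i j z < \<infinity>"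
  shows "green P M i' j' z < \<infinity>"
proof -
  obtain a where a: "1 \<le> mat_power P M a i i'" using mat_power_eventually_ge_1[OF ij(1) ij'(1)] by blast
  obtain b where b: "1 \<le> mat_power P M b j' j" using mat_power_eventually_ge_1[OF ij'(2) ij(2)] by blast
  have "z ^ (a + b) * green P M i' j' z = (\<Sum>n. z ^ (a + b) * (mat_power P M n i' j' * z ^ n))"
    unfolding green_def by simp
  also have "\<dots> \<le> (\<Sum>n. mat_power P M (n + (a + b)) i j * z ^ (n + (a + b)))"
  proof (rule suminf_le)
    fix n
    have "mat_power P M n i' j' \<le> mat_power P M a i i' * (mat_power P M n i' j' * mat_power P M b j' j)"
      using mult_mono[OF a mult_left_mono[OF b, of "mat_power P M n i' j'"]] by simp
    also have "\<dots> \<le> mat_power P M a i i' * mat_power P M (n + b) i' j"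
      using P_countable ij ij' by (intro mult_left_mono mat_power_add_ge) auto
    also have "\<dots> \<le> mat_power P M (a + (n + b)) i j"
      using P_countable ij ij' by (intro mat_power_add_ge) auto
    finally have "mat_power P M n i' j' \<le> mat_power P M (n + (a + b)) i j" by (simp add: ac_simps)
    then have "z ^ (n + (a + b)) * mat_power P M n i' j' \<le> z ^ (n + (a + b)) * mat_power P M (n + (a + b)) i j"
      by (rule mult_left_mono) simp
    then show "z ^ (a + b) * (mat_power P M n i' j' * z ^ n) \<le> mat_power P M (n + (a + b)) i j * z ^ (n + (a + b))"
      by (simp add: power_add ac_simps)
  qed auto
  also have "\<dots> \<le> green P M i j z"
    unfolding green_def using suminf_offset[of "\<lambda>n. mat_power P M n i j * z ^ n" "a + b"] by (simp add: summableI)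
  finally have "z ^ (a + b) * green P M i' j' z < \<infinity>" using fin by (rule le_less_trans)
  then show ?thesis using z by (auto simp: ennreal_mult_less_top)
qed

definition "rad = common_conv_radius P M"

lemma green_0_finite: "green P M i j 0 < \<infinity>"
proof -
  have "green P M i j 0 = (\<Sum>n\<in>{0}. mat_power P M n i j * 0 ^ n)"
    unfolding green_def by (rule suminf_finite) auto
  then show ?thesis by simp
qed

text \<open>Shows that the definite description in \<open>common_conv_radius\<close> denotes. The
  point 0 is treated apart because the transfer of finiteness needs z > 0.\<close>

lemma conv_radius_eq_rad:
  assumes ij: "i \<in> P" "j \<in> P" shows "ennreal_conv_radius (\<lambda>n. mat_power P M n i j) = rad"
proof -
  have "{r. green P M i j r < \<infinity>} = {r. green P M i' j' r < \<infinity>}" if "i' \<in> P" "j' \<in> P" for i' j'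
  proof -
    have "green P M i j r < \<infinity> \<longleftrightarrow> green P M i' j' r < \<infinity>" for r
      using green_finite_transfer[OF ij that, of r] green_finite_transfer[OF that ij, of r] green_0_finite
      by (cases "r = 0") (auto simp: zero_less_iff_neq_zero)
    then show ?thesis by auto
  qed
  then have eq: "ennreal_conv_radius (\<lambda>n. mat_power P M n i' j') = ennreal_conv_radius (\<lambda>n. mat_power P M n i j)"
    if "i' \<in> P" "j' \<in> P" for i' j'
    using that unfolding ennreal_conv_radius_def green_def[symmetric] by metis
  have "common_conv_radius P M = ennreal_conv_radius (\<lambda>n. mat_power P M n i j)"
    unfolding common_conv_radius_def
  proof (rule the_equality)
    show "\<forall>i'\<in>P. \<forall>j'\<in>P. ennreal_conv_radius (\<lambda>n. mat_power P M n i' j') = ennreal_conv_radius (\<lambda>n. mat_power P M n i j)"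
      using eq by blast
    fix r assume "\<forall>i\<in>P. \<forall>j\<in>P. ennreal_conv_radius (\<lambda>n. mat_power P M n i j) = r"
    then show "r = ennreal_conv_radius (\<lambda>n. mat_power P M n i j)" using ij by metis
  qed
  then show ?thesis by (simp add: rad_def)
qed

lemma green_finite_below_rad:
  assumes ij: "i \<in> P" "j \<in> P" and z: "z < rad" shows "green P M i j z < \<infinity>"
proof -
  obtain r where r: "green P M i j r < \<infinity>" "z < r"
    using z unfolding conv_radius_eq_rad[OF ij, symmetric] ennreal_conv_radius_def green_def[symmetric]
    by (auto simp: less_Sup_iff)
  have "green P M i j z \<le> green P M i j r"
    unfolding green_def using r by (intro suminf_le mult_left_mono power_mono) auto
  then show ?thesis using r by (auto intro: le_less_trans)
qed

lemma green_infinite_above_rad: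
  assumes ij: "i \<in> P" "j \<in> P" and z: "rad < z" shows "green P M i j z = \<infinity>"
proof (rule ccontr)
  assume "green P M i j z \<noteq> \<infinity>"
  then have "z \<in> {r. green P M i j r < \<infinity>}" by (simp add: less_top)
  then have "z \<le> rad"
    unfolding conv_radius_eq_rad[OF ij, symmetric] ennreal_conv_radius_def green_def[symmetric] by (rule Sup_upper)
  with z show False by simp
qed

lemma P_nonempty: "\<exists>i. i \<in> P"
  using gen_dense[of 0 1 "{}"] gen_P by auto

lemma green_1_infinite:
  assumes ij: "i \<in> P" "j \<in> P" and z: "1 \<le> z" shows "green P M i j z = \<infinity>"
proof -
  obtain N where N: "\<And>n. n \<ge> N \<Longrightarrow> 1 \<le> mat_power P M n i j" using mat_power_eventually_ge_1[OF ij] by blast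
  have le: "of_nat k \<le> green P M i j z" for k
  proof -
    have "of_nat k = (\<Sum>n\<in>{N..<N+k}. (1::ennreal))" by simp
    also have "\<dots> \<le> (\<Sum>n\<in>{N..<N+k}. mat_power P M n i j * z ^ n)"
      using N one_le_power[OF z] by (intro sum_mono) (metis atLeastLessThan_iff mult.left_neutral mult_mono zero_le)
    also have "\<dots> \<le> green P M i j z" unfolding green_def by (rule sum_le_suminf) auto
    finally show ?thesis .
  qed
  have "green P M i j z = ennreal g \<Longrightarrow> 0 \<le> g \<Longrightarrow> False" for g
  proof -
    assume g: "green P M i j z = ennreal g" "0 \<le> g"
    obtain k :: nat where "g < real k" using reals_Archimedean2 by blast
    moreover have "ennreal (real k) \<le> ennreal g" using le[of k] g(1) by (simp add: ennreal_of_nat_eq_real_of_nat)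
    ultimately show False using g(2) by (simp add: ennreal_le_iff)
  qed
  then show ?thesis by (cases "green P M i j z") auto
qed

lemma rad_le_1: "rad \<le> 1"
proof (rule ccontr)
  assume "\<not> rad \<le> 1"
  obtain i where "i \<in> P" using P_nonempty by blast
  then show False using green_finite_below_rad[of i i 1] green_1_infinite[of i i 1] \<open>\<not> rad \<le> 1\<close>
    by (simp add: not_le)
qed

section \<open>Monotone branches and the entropy\<close>

text \<open>Induction along the orbit: the branch at T x lies in a partition interval that the lap
  of x covers, so it can be pulled back through this lap.\<close>

lemma branch:
  assumes j: "j \<in> P" and "gen y" "y \<in> interior j" and "x \<in> {0..1}" "(T ^^ n) x = y"
  shows "\<exists>a b. \<exists>i\<in>P. a \<le> b \<and> x \<in> {a..b} \<and> {a..b} \<subseteq> i \<and> inj_on (T ^^ n) {a..b} \<and> (T ^^ n) ` {a..b} = j"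
  using assms(4,5)
proof (induction n arbitrary: x)
  case 0
  then have "x \<in> j" using assms(3) interior_subset by auto
  moreover obtain a b where "a < b" "j = {a..b}" using P_ivl[OF j] by blast
  ultimately show ?case using j by (intro exI[of _ a] exI[of _ b] bexI[of _ j]) auto
next
  case (Suc n)
  have gx: "gen x" using gen_back[of "Suc n" x] Suc.prems assms(2) by metis
  obtain U where U: "U \<in> L" "x \<in> interior U" using gen_L[OF gx] by blast
  obtain u v where uv: "u < v" "U = {u..v}" using L_ivl[OF U(1)] by blast
  have Tx: "T x \<in> {0..1}" "(T ^^ n) (T x) = y" using Suc.prems T_in by (auto simp: funpow_swap1)
  from Suc.IH[OF this] obtain a b i where ab: "i \<in> P" "a \<le> b" "T x \<in> {a..b}" "{a..b} \<subseteq> i"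
    "inj_on (T ^^ n) {a..b}" "(T ^^ n) ` {a..b} = j" by blast
  have "gen (T x)" using gen_back[of n "T x"] Tx assms(2) by metis
  then have "T x \<in> interior i" using gen_P_interior ab by blast
  then have sub: "i \<subseteq> T ` U" using L_covers[OF U(1) ab(1)] U(2) interior_subset by blast
  obtain s t where st: "s \<in> U" "T s = a" "t \<in> U" "T t = b"
  proof -
    have "a \<in> T ` U" "b \<in> T ` U" using sub ab(2,4) by auto
    then show ?thesis using that by blast
  qed
  \<comment> \<open>\<open>T\<close> may decrease on the lap, so \<open>s\<close> and
    \<open>t\<close> come in either order.\<close>
  define p q where "p = min s t" and "q = max s t"
  have pq: "u \<le> p" "p \<le> q" "q \<le> v" using st uv by (auto simp: p_def q_def)
  have im: "T ` {p..q} = {a..b}"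
  proof -
    have "T ` {p..q} = closed_segment (T p) (T q)" using T_image_L[of u v p q] pq U uv by auto
    also have "\<dots> = {a..b}" using st ab(2) unfolding p_def q_def min_def max_def
      by (auto simp: closed_segment_eq_real_ivl)
    finally show ?thesis .
  qed
  have sub': "{p..q} \<subseteq> U" using pq uv by auto
  have xpq: "x \<in> {p..q}"
  proof -
    obtain x' where "x' \<in> {p..q}" "T x' = T x" using im ab(3) by (metis imageE)
    then show ?thesis using L_inj[OF U(1)] U(2) sub' interior_subset by (metis inj_onD subsetD)
  qed
  have inj: "inj_on (T ^^ Suc n) {p..q}"
    using ab(5) im inj_on_subset[OF L_inj[OF U(1)] sub'] unfolding funpow_Suc_right by (intro comp_inj_on) auto
  have img: "(T ^^ Suc n) ` {p..q} = j" using im ab(6) unfolding funpow_Suc_right by (simp only: image_comp[symmetric])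
  obtain i' where i': "i' \<in> P" "U \<subseteq> i'" using L_sub[OF U(1)] by blast
  have "{p..q} \<subseteq> i'" using sub' i' by blast
  with i'(1) pq(2) xpq inj img show ?case by (intro exI[of _ p] exI[of _ q] bexI[of _ i'] conjI)
qed

text \<open>Neighbouring points of the fibre over \<open>y\<close> separate the branches, so every second branch gives a
  disjoint family.\<close>

lemma entropy_ge_count:
  assumes i: "i \<in> P" and n: "n \<ge> 1" and y: "gen y" "y \<in> interior i"
    and X: "finite X" "X \<subseteq> {x\<in>i. (T ^^ n) x = y}" "X \<noteq> {}"
  shows "ereal (ln (real (card X) / 2) / n) \<le> h_top T"
proof -
  \<comment> \<open>\<open>rk\<close> numbers the fibre points from the left; two points of equal
    parity have a third one between them.\<close>
  define rk where "rk x = card {x'\<in>X. x' < x}" for x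
  have Xx: "x \<in> i" "x \<in> {0..1}" "(T ^^ n) x = y" if "x \<in> X" for x using that X P_sub[OF i] by auto
  define Q where "Q x C \<longleftrightarrow> x \<in> C \<and> C \<subseteq> i \<and> (\<exists>a b. C = {a..b}) \<and> inj_on (T ^^ n) C \<and> (T ^^ n) ` C = i" for x C
  have "\<exists>C. Q x C" if x: "x \<in> X" for x
  proof -
    obtain a b i' where "i' \<in> P" "x \<in> {a..b}" "{a..b} \<subseteq> i'" "inj_on (T ^^ n) {a..b}" "(T ^^ n) ` {a..b} = i"
      using branch[OF i y Xx(2,3)[OF x]] by blast
    moreover have "gen x" using gen_back[of n x] Xx[OF x] y by auto
    then have "i' = i" using gen_P_unique calculation Xx[OF x] i by blast
    ultimately show ?thesis unfolding Q_def by blast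
  qed
  then obtain C where C: "\<And>x. x \<in> X \<Longrightarrow> Q x (C x)" by metis
  have rk: "rk x = Suc (rk x')" if "x \<in> X" "x' \<in> X" "x' < x" "\<And>z. z \<in> X \<Longrightarrow> \<not> (x' < z \<and> z < x)" for x x'
  proof -
    have "z < x \<longleftrightarrow> z = x' \<or> z < x'" if "z \<in> X" for z
      using \<open>\<And>z. z \<in> X \<Longrightarrow> \<not> (x' < z \<and> z < x)\<close>[OF that] \<open>x' < x\<close> by linarith
    then have "{z\<in>X. z < x} = insert x' {z\<in>X. z < x'}" using \<open>x' \<in> X\<close> by auto
    then show ?thesis unfolding rk_def using X(1) by simp
  qed
  have disj: "C x \<inter> C x' = {}" if xx: "x \<in> X" "x' \<in> X" "x' < x" "even (rk x) = even (rk x')" for x x'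
  proof -
    have "rk x \<noteq> Suc (rk x')" using xx(4) by auto
    then obtain z where z: "z \<in> X" "x' < z" "z < x" using rk[of x x'] xx(1-3) by blast
    \<comment> \<open>Each branch is injective and already contains a fibre point, so it misses
      \<open>z\<close>. Being intervals, the two branches lie on opposite sides of
      \<open>z\<close>.\<close>
    have "z \<notin> C x" "z \<notin> C x'"
      using C[OF xx(1)] C[OF xx(2)] Xx(3)[OF z(1)] Xx(3)[OF xx(1)] Xx(3)[OF xx(2)] z unfolding Q_def
      by (metis inj_onD less_irrefl)+
    then show ?thesis using C[OF xx(1)] C[OF xx(2)] z unfolding Q_def by fastforce
  qed
  obtain Y where Y: "Y \<subseteq> X" "card X \<le> 2 * card Y" "\<And>x x'. x \<in> Y \<Longrightarrow> x' \<in> Y \<Longrightarrow> even (rk x) = even (rk x')"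
  proof -
    define E O' where "E = {x\<in>X. even (rk x)}" and "O' = {x\<in>X. odd (rk x)}"
    have "X = E \<union> O'" "E \<inter> O' = {}" by (auto simp: E_def O'_def)
    then have "card X = card E + card O'" using X(1) by (metis card_Un_disjoint finite_Un)
    then have "card X \<le> 2 * card E \<or> card X \<le> 2 * card O'" by linarith
    then show ?thesis
    proof
      assume "card X \<le> 2 * card E" then show ?thesis by (intro that[of E]) (auto simp: E_def)
    next
      assume "card X \<le> 2 * card O'" then show ?thesis by (intro that[of O']) (auto simp: O'_def)
    qed
  qed
  have dY: "C x \<inter> C x' = {}" if "x \<in> Y" "x' \<in> Y" "x \<noteq> x'" for x x'
    using disj[of x x'] disj[of x' x] Y that by (metis Int_commute linorder_neqE subsetD)
  have inj: "inj_on C Y"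
    by (rule inj_onI) (metis C Q_def Y(1) dY disjoint_iff subsetD)
  have "0 < card X" using X by (simp add: card_gt_0_iff)
  then have cY: "0 < card Y" using Y(2) by linarith
  have "ereal (ln (real (card (C ` Y))) / n) \<le> h_top T"
  proof (rule entropy_ge_horseshoe[OF T_image n])
    show "finite (C ` Y)" using Y X finite_subset by blast
    show "disjoint (C ` Y)" unfolding disjoint_def using dY by blast
    show "C ` Y \<noteq> {}" using cY by auto
    fix A assume "A \<in> C ` Y"
    then obtain x where x: "x \<in> X" "A = C x" using Y by auto
    show "compact A \<and> A \<noteq> {} \<and> A \<subseteq> {0..1}" using C[OF x(1)] x(2) P_sub[OF i] unfolding Q_def by auto
    have "\<Union>(C ` Y) \<subseteq> i" using C Y(1) unfolding Q_def by blast
    then show "\<Union>(C ` Y) \<subseteq> (T ^^ n) ` A" using C[OF x(1)] x(2) unfolding Q_def by simp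
  qed
  moreover have "ln (real (card X) / 2) / n \<le> ln (real (card (C ` Y))) / n"
  proof (intro divide_right_mono)
    have "real (card X) / 2 \<le> real (card Y)" using Y(2) by linarith
    then show "ln (real (card X) / 2) \<le> ln (real (card (C ` Y)))"
      unfolding card_image[OF inj] using \<open>0 < card X\<close> cY by (subst ln_le_cancel_iff) auto
  qed simp
  ultimately show ?thesis by (meson ereal_less_eq(3) order_trans)
qed

text \<open>If the entropy were below some h < - ln z, the horseshoe estimate would bound the
  diagonal entries by 2 * exp h ^ n, and the series would be dominated by a geometric one.\<close>

lemma entropy_ge_of_green_infinite:
  assumes i: "i \<in> P" and z: "0 < z" and inf: "green P M i i (ennreal z) = \<infinity>"
  shows "ereal (- ln z) \<le> h_top T"
proof (rule ccontr)
  assume "\<not> ?thesis"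
  then have "h_top T < ereal (- ln z)" by simp
  then obtain h where h: "h_top T < ereal h" "h < - ln z" using ereal_dense2 by (metis less_ereal.simps(1))
  obtain y where y: "gen y" "y \<in> interior i" using gen_in_P[OF i, of "{}"] by auto
  have bound: "mat_power P M n i i \<le> ennreal (2 * exp h ^ n)" if n: "n \<ge> 1" for n
  proof -
    have cardX: "real (card X) \<le> 2 * exp h ^ n" if X: "finite X" "X \<subseteq> {x\<in>i. (T ^^ n) x = y}" for X
    proof (cases "X = {}")
      case False
      have "ereal (ln (real (card X) / 2) / n) < ereal h" using entropy_ge_count[OF i n y X False] h(1) by (rule le_less_trans)
      then have "ln (real (card X) / 2) < n * h" using n by (simp add: field_simps)
      moreover have "0 < card X" using X False by (simp add: card_gt_0_iff)
      ultimately have "real (card X) / 2 < exp (n * h)" by (metis exp_less_mono exp_ln half_gt_zero of_nat_0_less_iff)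
      then show ?thesis by (simp add: exp_of_nat_mult)
    qed simp
    have "finite {x\<in>i. (T ^^ n) x = y}"
    proof (rule ccontr)
      assume "infinite {x\<in>i. (T ^^ n) x = y}"
      then obtain X where "finite X" "card X = nat \<lceil>2 * exp h ^ n\<rceil> + 1" "X \<subseteq> {x\<in>i. (T ^^ n) x = y}"
        using infinite_arbitrarily_large by blast
      then show False using cardX[of X] by linarith
    qed
    then show ?thesis unfolding mat_power_count[OF i i y] csum_indicator_card
      using cardX[of "{x\<in>i. (T ^^ n) x = y}"] by (simp add: ennreal_of_nat_eq_real_of_nat ennreal_leI del: Collect_empty_eq)
  qed
  have q: "exp h * z < 1" "0 < exp h * z"
  proof -
    have "exp h < exp (- ln z)" using h(2) by simp
    then show "exp h * z < 1" using z by (simp add: exp_minus field_simps)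
  qed (use z in simp)
  have "green P M i i (ennreal z) \<le> (\<Sum>n. ennreal (2 * (exp h * z) ^ n))"
    unfolding green_def
  proof (rule suminf_le)
    fix n
    show "mat_power P M n i i * ennreal z ^ n \<le> ennreal (2 * (exp h * z) ^ n)"
    proof (cases "n = 0")
      case False
      then have "mat_power P M n i i * ennreal z ^ n \<le> ennreal (2 * exp h ^ n) * ennreal z ^ n"
        by (intro mult_right_mono bound) auto
      also have "\<dots> = ennreal (2 * (exp h * z) ^ n)"
        using z by (simp add: ennreal_power ennreal_mult[symmetric] power_mult_distrib ac_simps)
      finally show ?thesis .
    qed simp
  qed auto
  also have "\<dots> < \<infinity>"
  proof -
    have "summable (\<lambda>n. 2 * (exp h * z) ^ n)" using q by (intro summable_mult summable_geometric) auto
    then have "(\<Sum>n. ennreal (2 * (exp h * z) ^ n)) = ennreal (\<Sum>n. 2 * (exp h * z) ^ n)"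
      using q by (intro suminf_ennreal2) auto
    then show ?thesis by simp
  qed
  finally show False using inf by simp
qed

text \<open>Fibre points in the outer thirds confine the injective branch of the one in the middle
  third. Its domain is then a compact subset of the open unit interval, which mixing can
  cover.\<close>

lemma inner_branch:
  assumes i: "i \<in> P" and y: "gen y" "y \<in> interior i"
  shows "\<exists>p a b. 0 < a \<and> a \<le> b \<and> b < 1 \<and> inj_on (T ^^ p) {a..b} \<and> (T ^^ p) ` {a..b} = i"
proof -
  have y01: "0 < y" "y < 1" using P_interior_sub[OF i] y by auto
  obtain N1 where N1: "\<And>n. n \<ge> N1 \<Longrightarrow> {y..y} \<subseteq> (T ^^ n) ` {0<..<1/3}"
    using mixing_covers[of 0 "1/3" y y] y01 by auto
  obtain N2 where N2: "\<And>n. n \<ge> N2 \<Longrightarrow> {y..y} \<subseteq> (T ^^ n) ` {1/3<..<2/3}"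
    using mixing_covers[of "1/3" "2/3" y y] y01 by auto
  obtain N3 where N3: "\<And>n. n \<ge> N3 \<Longrightarrow> {y..y} \<subseteq> (T ^^ n) ` {2/3<..<1}"
    using mixing_covers[of "2/3" 1 y y] y01 by auto
  define p where "p = max N1 (max N2 N3)"
  have "N1 \<le> p" "N2 \<le> p" "N3 \<le> p" by (auto simp: p_def)
  then have "y \<in> (T ^^ p) ` {0<..<1/3}" "y \<in> (T ^^ p) ` {1/3<..<2/3}" "y \<in> (T ^^ p) ` {2/3<..<1}"
    using N1[of p] N2[of p] N3[of p] by auto
  then obtain x1 x2 x3 where x: "0 < x1" "x1 < 1/3" "(T ^^ p) x1 = y" "1/3 < x2" "x2 < 2/3" "(T ^^ p) x2 = y"
     "2/3 < x3" "x3 < 1" "(T ^^ p) x3 = y" by (auto simp: image_iff)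
  obtain a b where ab: "x2 \<in> {a..b}" "inj_on (T ^^ p) {a..b}" "(T ^^ p) ` {a..b} = i" "a \<le> b"
    using branch[OF i y, of x2 p] x by auto
  have "x1 \<notin> {a..b}" "x3 \<notin> {a..b}"
    using inj_onD[OF ab(2), of x1 x2] inj_onD[OF ab(2), of x3 x2] ab(1) x by force+
  then show ?thesis using ab x by (intro exI[of _ p] exI[of _ a] exI[of _ b]) auto
qed

end

section \<open>Independence of the partition\<close>

text \<open>A point \<open>y\<close> generic for both structures links the matrices. The inner
  branch moves the fibre in \<open>k\<close> into [a, b], which an iterate of \<open>k'\<close>
  covers; returns to \<open>k\<close> of order n thus give at least as many returns to
  \<open>k'\<close> of order n + p + N.\<close>

lemma green_infinite_change_partition:
  assumes m1: "markov_map T P L M" and m2: "markov_map T P' L' M'" and z: "0 < z"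
    and i: "i \<in> P" "j \<in> P" and inf: "green P M i j z = \<infinity>" and i': "i' \<in> P'" "j' \<in> P'"
  shows "green P' M' i' j' z = \<infinity>"
proof -
  interpret A: markov_map T P L M by fact
  interpret B: markov_map T P' L' M' by fact
  obtain y where y: "A.gen y" "y \<notin> B.nongen" "0 < y" "y < 1"
    using A.gen_dense[of 0 1 B.nongen] B.nongen_countable by auto
  then have yB: "B.gen y" by (simp add: B.gen_def)
  obtain k where k: "k \<in> P" "y \<in> interior k" using A.gen_P[OF y(1)] by blast
  obtain k' where k': "k' \<in> P'" "y \<in> interior k'" using B.gen_P[OF yB] by blast
  have infk: "green P M k k z = \<infinity>"
    using A.green_finite_transfer[OF k(1) k(1) i z] inf by (metis infinity_ennreal_def less_irrefl top.not_eq_extremum)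
  obtain p a b where ab: "0 < a" "a \<le> b" "b < 1" "inj_on (T ^^ p) {a..b}" "(T ^^ p) ` {a..b} = k"
    using A.inner_branch[OF k(1) y(1) k(2)] by blast
  obtain N where N: "{a..b} \<subseteq> (T ^^ N) ` interior k'" using B.P_covers[OF k'(1) ab(1,3)] by blast
  have le: "mat_power P M n k k \<le> mat_power P' M' (n + (p + N)) k' k'" for n
  proof -
    have "mat_power P M n k k = csum ((T ^^ p) ` {a..b}) (\<lambda>x. if (T ^^ n) x = y then 1 else 0)"
      unfolding ab(5) by (rule A.mat_power_count) fact+
    also have "\<dots> = csum {a..b} (\<lambda>x. if (T ^^ (n + p)) x = y then 1 else 0)"
      by (simp add: csum_image_inj[OF ab(4)] funpow_add)
    also have "\<dots> \<le> csum (interior k') (\<lambda>x. if (T ^^ (n + p)) ((T ^^ N) x) = y then 1 else 0)"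
      by (rule csum_image_le[OF N])
    also have "\<dots> \<le> csum k' (\<lambda>x. if (T ^^ (n + p)) ((T ^^ N) x) = y then 1 else 0)"
      by (rule csum_mono_set) (rule interior_subset)
    also have "\<dots> = mat_power P' M' (n + (p + N)) k' k'"
      unfolding B.mat_power_count[OF k'(1) k'(1) yB k'(2)] by (simp add: funpow_add)
    finally show ?thesis .
  qed
  have "z ^ (p + N) * green P M k k z = (\<Sum>n. z ^ (p + N) * (mat_power P M n k k * z ^ n))"
    unfolding green_def by simp
  also have "\<dots> \<le> (\<Sum>n. mat_power P' M' (n + (p + N)) k' k' * z ^ (n + (p + N)))"
  proof (rule suminf_le)
    fix n
    show "z ^ (p + N) * (mat_power P M n k k * z ^ n) \<le> mat_power P' M' (n + (p + N)) k' k' * z ^ (n + (p + N))"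
      using mult_right_mono[OF le[of n], of "z ^ (n + (p + N))"] by (simp add: power_add ac_simps)
  qed auto
  also have "\<dots> \<le> green P' M' k' k' z"
    unfolding green_def using suminf_offset[of "\<lambda>n. mat_power P' M' n k' k' * z ^ n" "p + N"] by (simp add: summableI)
  finally have "z ^ (p + N) * green P M k k z \<le> green P' M' k' k' z" .
  moreover have "z ^ (p + N) \<noteq> 0" using z by auto
  then have "z ^ (p + N) * green P M k k z = \<infinity>" unfolding infk by (simp add: ennreal_mult_eq_top_iff)
  ultimately have "green P' M' k' k' z = \<infinity>" by (simp add: top_unique)
  then show ?thesis
    using B.green_finite_transfer[OF i' k'(1) k'(1) z] by (metis infinity_ennreal_def less_irrefl top.not_eq_extremum)
qed

section \<open>Laps of a map with a Markov partition\<close>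

text \<open>Comparisons across the common point \<open>s\<close> are chained by transitivity. The
  relation \<open>R\<close> is left abstract to serve increasing and decreasing maps.\<close>

lemma monotone_on_Un_interval:
  fixes f :: "real \<Rightarrow> real"
  assumes A: "monotone_on A (\<le>) R f" and B: "monotone_on B (\<le>) R f" and R: "transp R"
    and iv: "is_interval A" "is_interval B" and s: "s \<in> A" "s \<in> B"
  shows "monotone_on (A \<union> B) (\<le>) R f"
proof -
  have *: "R (f x) (f y)" if xy: "x \<in> A" "y \<in> B" "x \<le> y" and A: "monotone_on A (\<le>) R f" and B: "monotone_on B (\<le>) R f"
    and s: "s \<in> A" "s \<in> B" and iv: "is_interval A" "is_interval B" for x y A B
  proof -
    consider "y \<le> s" | "s \<le> x" | "x \<le> s" "s \<le> y" by linarith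
    then show ?thesis
    proof cases
      case 1
      then have "y \<in> A" using iv(1) xy s unfolding is_interval_1 by blast
      then show ?thesis using A xy by (auto dest: monotone_onD)
    next
      case 2
      then have "x \<in> B" using iv(2) xy s unfolding is_interval_1 by blast
      then show ?thesis using B xy by (auto dest: monotone_onD)
    next
      case 3
      then have "R (f x) (f s)" "R (f s) (f y)" using A B xy s by (auto dest: monotone_onD)
      then show ?thesis using R by (auto dest: transpD)
    qed
  qed
  show ?thesis
  proof (rule monotone_onI)
    fix x y assume "x \<in> A \<union> B" "y \<in> A \<union> B" "x \<le> y"
    then show "R (f x) (f y)"
      using *[of x A y B] *[of x B y A] A B s iv by (auto dest: monotone_onD)
  qed
qed

lemma monotone_map_on_alt: "monotone_map_on A T \<longleftrightarrow> monotone_on A (\<le>) (\<le>) T \<or> monotone_on A (\<le>) (\<ge>) T"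
  unfolding monotone_map_on_def ..

lemma monotone_map_direction:
  assumes "monotone_map_on C T" "s \<in> C" "t \<in> C" "s < t" "T s \<noteq> T t"
  shows "monotone_on C (\<le>) (if T s < T t then (\<le>) else (\<ge>)) T"
  using assms(1) unfolding monotone_map_on_alt
proof
  assume m: "monotone_on C (\<le>) (\<le>) T"
  then have "T s < T t" using monotone_onD[OF m assms(2,3)] assms(4,5) by simp
  then show ?thesis using m by simp
next
  assume m: "monotone_on C (\<le>) (\<ge>) T"
  then have "\<not> T s < T t" using monotone_onD[OF m assms(2,3)] assms(4) by simp
  then show ?thesis using m by simp
qed

lemma monotone_map_between:
  assumes "monotone_map_on K T" "x1 \<in> K" "x \<in> K" "x2 \<in> K" "T x1 < T x" "T x < T x2"
  shows "(x1 < x \<and> x < x2) \<or> (x2 < x \<and> x < x1)"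
  using assms unfolding monotone_map_on_def monotone_on_def by (meson leD linorder_le_cases linorder_not_le order.strict_trans2)

locale mixing_interval_map =
  fixes T :: "real \<Rightarrow> real"
  assumes T: "interval_map T" and mixing: "topologically_mixing {0..1} T"
begin

lemma T_cont: "continuous_on {0..1} T" and T_image: "T ` {0..1} \<subseteq> {0..1}"
  using T by (auto simp: interval_map_def)

text \<open>Iterates would collapse a constant piece to a point, which cannot meet both halves of
  the unit interval.\<close>

lemma not_constant:
  assumes "0 \<le> p" "p < q" "q \<le> 1"
  shows "\<not> (\<forall>x\<in>{p..q}. T x = c)"
proof
  assume const: "\<forall>x\<in>{p..q}. T x = c"
  have op: "openin (top_of_set {0..1}) ({0..1} \<inter> W)" if "open W" for W :: "real set"
    using that by (rule openin_open_Int)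
  have eq: "{0..1} \<inter> {p<..<q} = {p<..<q}" "{0..1} \<inter> {..<1/2} = {0..<1/2::real}" "{0..1} \<inter> {1/2<..} = {1/2<..1::real}"
    using assms by auto
  have o: "openin (top_of_set {0..1}) {p<..<q}" "openin (top_of_set {0..1}) {0..<1/2::real}"
    "openin (top_of_set {0..1}) {1/2<..1::real}"
    using op[OF open_greaterThanLessThan, of p q] op[OF open_lessThan, of "1/2"] op[OF open_greaterThan, of "1/2"] eq by simp_all
  have ne: "{p<..<q} \<noteq> {}" "{0..<1/2::real} \<noteq> {}" "{1/2<..1::real} \<noteq> {}" using assms by auto
  obtain n1 where n1: "\<And>m. m \<ge> n1 \<Longrightarrow> (T ^^ m) ` {p<..<q} \<inter> {0..<1/2} \<noteq> {}"
    using mixing[unfolded topologically_mixing_def, rule_format, of "{p<..<q}" "{0..<1/2}"] o(1,2) ne(1,2) by auto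
  obtain n2 where n2: "\<And>m. m \<ge> n2 \<Longrightarrow> (T ^^ m) ` {p<..<q} \<inter> {1/2<..1} \<noteq> {}"
    using mixing[unfolded topologically_mixing_def, rule_format, of "{p<..<q}" "{1/2<..1}"] o(1,3) ne(1,3) by auto
  define m where "m = max n1 n2"
  have "(T ^^ Suc m) x = (T ^^ m) c" if "x \<in> {p<..<q}" for x
    using const that by (simp add: funpow_swap1)
  then have "(T ^^ Suc m) ` {p<..<q} \<subseteq> {(T ^^ m) c}" by auto
  moreover have "n1 \<le> Suc m" "n2 \<le> Suc m" by (auto simp: m_def)
  from n1[OF this(1)] n2[OF this(2)]
  obtain u v where uv: "u \<in> (T ^^ Suc m) ` {p<..<q}" "u \<in> {0..<1/2}" "v \<in> (T ^^ Suc m) ` {p<..<q}" "v \<in> {1/2<..1}"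
    unfolding disjoint_iff by metis
  ultimately have "u = (T ^^ m) c" "v = (T ^^ m) c" by (meson singletonD subsetD)+
  with uv have "(T ^^ m) c \<in> {0..<1/2}" "(T ^^ m) c \<in> {1/2<..1}" by simp_all
  then show False by auto
qed

lemma monotone_inj:
  assumes A: "is_interval A" "A \<subseteq> {0..1}" and mono: "monotone_map_on A T"
  shows "inj_on T A"
proof (rule linorder_inj_onI)
  fix x y assume xy: "x < y" "x \<in> A" "y \<in> A"
  show "T x \<noteq> T y"
  proof
    assume eq: "T x = T y"
    have sub: "{x..y} \<subseteq> A" using mem_is_interval_1_I[OF A(1) xy(2,3)] by auto
    have "T z = T x" if z: "z \<in> {x..y}" for z
    proof -
      have zA: "z \<in> A" "x \<le> z" "z \<le> y" using z sub by auto
      from mono have "(T x \<le> T z \<and> T z \<le> T y) \<or> (T z \<le> T x \<and> T y \<le> T z)"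
        unfolding monotone_map_on_alt using zA xy(2,3) by (auto dest: monotone_onD)
      then show ?thesis using eq by linarith
    qed
    then have "\<forall>z\<in>{x..y}. T z = T x" by blast
    moreover have "0 \<le> x" "y \<le> 1" using subsetD[OF A(2) xy(2)] subsetD[OF A(2) xy(3)] by simp_all
    ultimately show False using not_constant[OF _ xy(1), of "T x"] by blast
  qed
qed auto

text \<open>Two common points have different values by injectivity, and this fixes the same
  direction on both intervals.\<close>

lemma monotone_map_Un:
  assumes A: "is_interval A" "A \<subseteq> {0..1}" "monotone_map_on A T"
    and B: "is_interval B" "B \<subseteq> {0..1}" "monotone_map_on B T"
    and s: "s \<in> A \<inter> B" "t \<in> A \<inter> B" "s < t"
  shows "monotone_map_on (A \<union> B) T"
proof -
  have ne: "T s \<noteq> T t" using monotone_inj[OF A] s by (auto dest: inj_onD)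
  have tr: "transp ((\<le>) :: real \<Rightarrow> _)" "transp ((\<ge>) :: real \<Rightarrow> _)" by (auto intro: transpI)
  have dir: "monotone_on C (\<le>) (if T s < T t then (\<le>) else (\<ge>)) T" if "monotone_map_on C T" "s \<in> C" "t \<in> C" for C
    by (rule monotone_map_direction[OF that s(3) ne])
  show ?thesis
  proof (cases "T s < T t")
    case True
    then show ?thesis using monotone_on_Un_interval[OF _ _ tr(1) A(1) B(1), of T s] dir[OF A(3)] dir[OF B(3)] s
      unfolding monotone_map_on_alt by auto
  next
    case False
    then show ?thesis using monotone_on_Un_interval[OF _ _ tr(2) A(1) B(1), of T s] dir[OF A(3)] dir[OF B(3)] s
      unfolding monotone_map_on_alt by auto
  qed
qed

lemma monotone_map_closure:
  assumes U: "U \<subseteq> {0..1}" "monotone_map_on U T"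
  shows "monotone_map_on (closure U) T"
proof -
  have cl: "closure U \<subseteq> {0..1}" using U(1) by (simp add: closure_minimal)
  have lim: "\<exists>u. (\<forall>n. u n \<in> U) \<and> u \<longlonglongrightarrow> x \<and> (\<lambda>n. T (u n)) \<longlonglongrightarrow> T x" if x: "x \<in> closure U" for x
  proof -
    have "\<exists>u. (\<forall>n. u n \<in> U) \<and> u \<longlonglongrightarrow> x" using x unfolding closure_sequential .
    then obtain u where u: "\<forall>n. u n \<in> U" "u \<longlonglongrightarrow> x" by (elim exE conjE)
    moreover have "(\<lambda>n. T (u n)) \<longlonglongrightarrow> T x"
      using T_cont[unfolded continuous_on_sequentially comp_def] u subsetD[OF cl x] subsetD[OF U(1)] by simp
    ultimately show ?thesis by blast
  qed
  have ev: "eventually (\<lambda>n. u n \<le> v n) sequentially" if "u \<longlonglongrightarrow> x" "v \<longlonglongrightarrow> y" "x < y" for u v :: "nat \<Rightarrow> real" and x y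
  proof -
    have "eventually (\<lambda>n. u n < (x + y) / 2) sequentially" "eventually (\<lambda>n. (x + y) / 2 < v n) sequentially"
      using order_tendstoD(2)[OF that(1), of "(x + y) / 2"] order_tendstoD(1)[OF that(2), of "(x + y) / 2"] that(3)
      by simp_all
    then show ?thesis by eventually_elim linarith
  qed
  from U(2) show ?thesis unfolding monotone_map_on_alt
  proof (elim disjE)
    assume m: "monotone_on U (\<le>) (\<le>) T"
    have "monotone_on (closure U) (\<le>) (\<le>) T"
    proof (rule monotone_onI)
      fix x y assume xy: "x \<in> closure U" "y \<in> closure U" "x \<le> y"
      show "T x \<le> T y"
      proof (cases "x = y")
        case False
        obtain u v where uv: "\<And>n. u n \<in> U" "u \<longlonglongrightarrow> x" "(\<lambda>n. T (u n)) \<longlonglongrightarrow> T x"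
          "\<And>n. v n \<in> U" "v \<longlonglongrightarrow> y" "(\<lambda>n. T (v n)) \<longlonglongrightarrow> T y" using lim xy(1,2) by metis
        have "eventually (\<lambda>n. T (u n) \<le> T (v n)) sequentially"
          using ev[OF uv(2,5)] False xy(3) by (auto elim!: eventually_mono intro: monotone_onD[OF m] uv)
        then show ?thesis using uv by (intro tendsto_le[OF _ uv(6,3)]) auto
      qed simp
    qed
    then show "monotone_on (closure U) (\<le>) (\<le>) T \<or> monotone_on (closure U) (\<le>) (\<ge>) T" ..
  next
    assume m: "monotone_on U (\<le>) (\<ge>) T"
    have "monotone_on (closure U) (\<le>) (\<ge>) T"
    proof (rule monotone_onI)
      fix x y assume xy: "x \<in> closure U" "y \<in> closure U" "x \<le> y"
      show "T x \<ge> T y"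
      proof (cases "x = y")
        case False
        obtain u v where uv: "\<And>n. u n \<in> U" "u \<longlonglongrightarrow> x" "(\<lambda>n. T (u n)) \<longlonglongrightarrow> T x"
          "\<And>n. v n \<in> U" "v \<longlonglongrightarrow> y" "(\<lambda>n. T (v n)) \<longlonglongrightarrow> T y" using lim xy(1,2) by metis
        have "eventually (\<lambda>n. T (u n) \<ge> T (v n)) sequentially"
          using ev[OF uv(2,5)] False xy(3) by (auto elim!: eventually_mono intro: monotone_onD[OF m] uv)
        then show ?thesis using uv by (intro tendsto_le[OF _ uv(3,6)]) auto
      qed simp
    qed
    then show "monotone_on (closure U) (\<le>) (\<le>) T \<or> monotone_on (closure U) (\<le>) (\<ge>) T" ..
  qed
qed

text \<open>The union of all monotone intervals between [s, t] and \<open>i\<close>. Since T s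
  \<noteq> T t, all of them share one direction, so points taken from two members are ordered
  correctly.\<close>

lemma maximal_exists:
  assumes i: "i \<subseteq> {0..1}" and K: "{s..t} \<subseteq> i" "s < t" "monotone_map_on {s..t} T"
  shows "\<exists>U. maximal_monotone_interval T i U \<and> {s..t} \<subseteq> U"
proof -
  define \<F> where "\<F> = {A. is_interval A \<and> {s..t} \<subseteq> A \<and> A \<subseteq> i \<and> monotone_map_on A T}"
  define U where "U = \<Union>\<F>"
  have KF: "{s..t} \<in> \<F>" using K by (auto simp: \<F>_def is_interval_cc)
  have sF: "s \<in> A" "t \<in> A" if "A \<in> \<F>" for A using that K(2) by (auto simp: \<F>_def)
  have sub: "{s..t} \<subseteq> U" "U \<subseteq> i" unfolding U_def by (rule Union_upper[OF KF]) (auto simp: \<F>_def)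
  have "connected U" unfolding U_def
  proof (rule connected_Union)
    show "\<Inter>\<F> \<noteq> {}" using sF(1) by blast
  qed (simp add: \<F>_def is_interval_connected_1)
  then have iv: "is_interval U" by (simp add: is_interval_connected_1)
  have "inj_on T {s..t}" by (rule monotone_inj[OF is_interval_cc subset_trans[OF K(1) i] K(3)])
  then have ne: "T s \<noteq> T t" using inj_onD[of T "{s..t}" s t] K(2) by auto
  have dir: "monotone_on C (\<le>) (if T s < T t then (\<le>) else (\<ge>)) T" if "monotone_map_on C T" "s \<in> C" "t \<in> C" for C
    by (rule monotone_map_direction[OF that K(2) ne])
  have "monotone_on U (\<le>) (if T s < T t then (\<le>) else (\<ge>)) T"
  proof (rule monotone_onI)
    fix x y assume "x \<in> U" "y \<in> U" and le: "x \<le> y"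
    then obtain A B where AB: "A \<in> \<F>" "x \<in> A" "B \<in> \<F>" "y \<in> B" by (auto simp: U_def)
    have "monotone_map_on (A \<union> B) T"
      using AB sF i K(2) by (intro monotone_map_Un[of A B s t]) (auto simp: \<F>_def)
    from dir[OF this] show "(if T s < T t then (\<le>) else (\<ge>)) (T x) (T y)"
      using AB sF le by (auto dest: monotone_onD)
  qed
  then have mono: "monotone_map_on U T" unfolding monotone_map_on_alt by (auto split: if_splits)
  have "A = U" if "is_interval A" "U \<subseteq> A" "A \<subseteq> i" "monotone_map_on A T" for A
  proof -
    have "A \<in> \<F>" using that sub by (auto simp: \<F>_def)
    then show ?thesis using that(2) by (auto simp: U_def)
  qed
  then have "maximal_monotone_interval T i U"
    unfolding maximal_monotone_interval_def using iv mono sub K(2) by auto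
  then show ?thesis using sub by blast
qed

lemma maximal_eq:
  assumes i: "i \<subseteq> {0..1}" and U: "maximal_monotone_interval T i U" and V: "maximal_monotone_interval T i V"
    and meet: "interior U \<inter> interior V \<noteq> {}"
  shows "U = V"
proof -
  obtain x e where "x \<in> interior U \<inter> interior V" "e > 0" "ball x e \<subseteq> interior U \<inter> interior V"
    using meet by (metis open_Int open_interior open_contains_ball ex_in_conv)
  moreover from this have "x \<in> ball x e" "x + e/2 \<in> ball x e" by (auto simp: dist_real_def)
  ultimately have st: "x \<in> U \<inter> V" "x + e/2 \<in> U \<inter> V" "x < x + e/2"
    using interior_subset[of U] interior_subset[of V] by auto
  have Ui: "is_interval U" "U \<subseteq> i" "monotone_map_on U T" and Vi: "is_interval V" "V \<subseteq> i" "monotone_map_on V T"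
    using U V by (auto simp: maximal_monotone_interval_def)
  have "monotone_map_on (U \<union> V) T"
    using Ui Vi st i by (intro monotone_map_Un[of U V x "x + e/2"]) auto
  moreover have "is_interval (U \<union> V)"
    using Ui(1) Vi(1) st unfolding is_interval_connected_1 by (intro connected_Un) auto
  ultimately have "U \<union> V = U" "U \<union> V = V"
    using U V Ui(2) Vi(2) unfolding maximal_monotone_interval_def by (metis Un_least Un_upper1 Un_upper2)+
  then show ?thesis by simp
qed

text \<open>Monotonicity passes to the closure by continuity, so maximality forces \<open>U\<close>
  to be closed.\<close>

lemma maximal_closed_interval:
  assumes i: "i = {a..b}" "0 \<le> a" "b \<le> 1" and U: "maximal_monotone_interval T i U" and ne: "interior U \<noteq> {}"
  shows "\<exists>c d. c < d \<and> U = {c..d}"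
proof -
  have Ui: "is_interval U" "U \<noteq> {}" "U \<subseteq> i" "monotone_map_on U T" using U by (auto simp: maximal_monotone_interval_def)
  have "closure U \<subseteq> i" using Ui(3) i(1) by (simp add: closure_minimal)
  moreover have "is_interval (closure U)" using Ui(1) by (simp add: is_interval_connected_1 connected_imp_connected_closure)
  moreover have "monotone_map_on (closure U) T" using Ui i by (intro monotone_map_closure) auto
  ultimately have "closure U = U" using U closure_subset[of U] by (auto simp: maximal_monotone_interval_def)
  then have "closed U" by (metis closed_closure)
  moreover have "bounded U" using Ui(3) i(1) bounded_subset[OF bounded_closed_interval] by blast
  ultimately have "compact U" by (simp add: compact_eq_bounded_closed)
  then obtain c d where cd: "U = {c..d}" using Ui(1,2) connected_compact_interval_1[of U] by (auto simp: is_interval_connected_1)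
  then show ?thesis using ne by (intro exI[of _ c] exI[of _ d]) (auto simp: interior_atLeastAtMost_real)
qed

end

section \<open>Laps as maximal intervals of monotonicity, and the transition matrix as their
  count\<close>

definition laps :: "(real \<Rightarrow> real) \<Rightarrow> real set set \<Rightarrow> real set set" where
  "laps T P = {U. interior U \<noteq> {} \<and> (\<exists>i\<in>P. maximal_monotone_interval T i U)}"

locale markov_setting = mixing_interval_map +
  fixes P :: "real set set"
  assumes mp: "markov_partition T P"
begin

lemma P_countable: "countable P"
  and P_ivl: "\<And>i. i \<in> P \<Longrightarrow> \<exists>a b. 0 \<le> a \<and> a < b \<and> b \<le> 1 \<and> i = {a..b}"
  and P_disj: "\<And>i j. i \<in> P \<Longrightarrow> j \<in> P \<Longrightarrow> i \<noteq> j \<Longrightarrow> interior i \<inter> interior j = {}"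
  and P_co: "countable ({0..1} - \<Union>P)"
  and P_pm: "\<And>i. i \<in> P \<Longrightarrow> piecewise_monotone_on i T"
  and P_markov: "\<And>i j i'. i \<in> P \<Longrightarrow> j \<in> P \<Longrightarrow> maximal_monotone_interval T i i' \<Longrightarrow> T ` i' \<inter> interior j \<noteq> {} \<Longrightarrow> j \<subseteq> T ` i'"
proof -
  note m = mp[unfolded markov_partition_def]
  show "countable P" "countable ({0..1} - \<Union>P)" using m by simp_all
  have "\<forall>i\<in>P. \<exists>a b. 0 \<le> a \<and> a < b \<and> b \<le> 1 \<and> i = {a..b}" using m by (elim conjE)
  then show "\<exists>a b. 0 \<le> a \<and> a < b \<and> b \<le> 1 \<and> i = {a..b}" if "i \<in> P" for i using that by (rule bspec)
  have "\<forall>i\<in>P. piecewise_monotone_on i T" using m by (elim conjE)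
  then show "piecewise_monotone_on i T" if "i \<in> P" for i using that by (rule bspec)
  have "\<forall>i\<in>P. \<forall>j\<in>P. i \<noteq> j \<longrightarrow> interior i \<inter> interior j = {}" using m by (elim conjE)
  then show "interior i \<inter> interior j = {}" if "i \<in> P" "j \<in> P" "i \<noteq> j" for i j using that by simp
  have "\<forall>i\<in>P. \<forall>j\<in>P. \<forall>i'. maximal_monotone_interval T i i' \<longrightarrow> T ` i' \<inter> interior j \<noteq> {} \<longrightarrow> j \<subseteq> T ` i'"
    using m by (elim conjE)
  then show "j \<subseteq> T ` i'" if "i \<in> P" "j \<in> P" "maximal_monotone_interval T i i'" "T ` i' \<inter> interior j \<noteq> {}" for i j i'
    using that by blast
qed

lemma P_sub: "i \<in> P \<Longrightarrow> i \<subseteq> {0..1}" using P_ivl by fastforce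

lemma P_cover: "countable ({0..1} - (\<Union>i\<in>P. interior i))"
proof (rule countable_subset)
  show "{0..1} - (\<Union>i\<in>P. interior i) \<subseteq> ({0..1} - \<Union>P) \<union> (\<Union>i\<in>P. {Inf i, Sup i})"
  proof
    fix x :: real assume x: "x \<in> {0..1} - (\<Union>i\<in>P. interior i)"
    show "x \<in> ({0..1} - \<Union>P) \<union> (\<Union>i\<in>P. {Inf i, Sup i})"
    proof (cases "x \<in> \<Union>P")
      case True
      then obtain i where i: "i \<in> P" "x \<in> i" by blast
      obtain a b where ab: "a < b" "i = {a..b}" using P_ivl[OF i(1)] by blast
      have "x \<notin> {a<..<b}" using x i(1) ab by (auto simp: interior_atLeastAtMost_real)
      then have "x = Inf i \<or> x = Sup i" using i(2) ab by auto
      then show ?thesis using i by auto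
    qed (use x in auto)
  qed
qed (use P_co P_countable in auto)

lemma P_unique: "i \<in> P \<Longrightarrow> j \<in> P \<Longrightarrow> interior i \<inter> interior j \<noteq> {} \<Longrightarrow> i = j" using P_disj by blast

lemma lap_ivl:
  assumes "U \<in> laps T P" shows "\<exists>a b. a < b \<and> U = {a..b}"
proof -
  obtain i where i: "interior U \<noteq> {}" "i \<in> P" "maximal_monotone_interval T i U" using assms unfolding laps_def by blast
  obtain a b where ab: "0 \<le> a" "b \<le> 1" "i = {a..b}" using P_ivl[OF i(2)] by blast
  show ?thesis by (rule maximal_closed_interval[OF ab(3,1,2) i(3,1)])
qed

lemma lap_maximal:
  assumes "U \<in> laps T P" "i \<in> P" "U \<subseteq> i" shows "maximal_monotone_interval T i U"
proof -
  obtain i' where i': "i' \<in> P" "maximal_monotone_interval T i' U" "interior U \<noteq> {}" using assms(1) unfolding laps_def by auto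
  then have "U \<subseteq> i'" by (auto simp: maximal_monotone_interval_def)
  then have "interior i \<inter> interior i' \<noteq> {}" using i'(3) interior_mono[OF assms(3)] interior_mono[of U i'] by auto
  then show ?thesis using P_unique assms(2) i' by blast
qed

lemma lap_sub: "U \<in> laps T P \<Longrightarrow> \<exists>i\<in>P. U \<subseteq> i"
  unfolding laps_def maximal_monotone_interval_def by auto

lemma lap_disj:
  assumes "U \<in> laps T P" "V \<in> laps T P" "U \<noteq> V" shows "interior U \<inter> interior V = {}"
proof (rule ccontr)
  assume meet: "interior U \<inter> interior V \<noteq> {}"
  obtain i j where ij: "i \<in> P" "U \<subseteq> i" "j \<in> P" "V \<subseteq> j" using lap_sub assms(1,2) by meson
  then have "interior i \<inter> interior j \<noteq> {}" using meet interior_mono[of U i] interior_mono[of V j] by auto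
  then have "i = j" using P_unique ij by blast
  then show False using maximal_eq[OF P_sub[OF ij(1)] lap_maximal[OF assms(1) ij(1,2)] lap_maximal[OF assms(2) ij(3,4)[folded \<open>i = j\<close>]] meet] assms(3)
    by blast
qed

lemma lap_inj: "U \<in> laps T P \<Longrightarrow> inj_on T U"
proof (rule monotone_inj)
  assume "U \<in> laps T P"
  then obtain i where i: "i \<in> P" "maximal_monotone_interval T i U" unfolding laps_def by blast
  then show "is_interval U" "monotone_map_on U T" by (simp_all add: maximal_monotone_interval_def)
  show "U \<subseteq> {0..1}" using i(2) P_sub[OF i(1)] by (auto simp: maximal_monotone_interval_def)
qed

lemma lap_monotone: "U \<in> laps T P \<Longrightarrow> monotone_map_on U T"
  unfolding laps_def maximal_monotone_interval_def by auto

definition "pieces i = (SOME J. J division_of i \<and> (\<forall>K\<in>J. monotone_map_on K T))"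

lemma pieces: assumes "i \<in> P" shows "pieces i division_of i" "\<And>K. K \<in> pieces i \<Longrightarrow> monotone_map_on K T"
  using someI_ex[OF P_pm[OF assms, unfolded piecewise_monotone_on_def]] unfolding pieces_def by blast+

definition "ends i = (\<Union>K\<in>pieces i. {Inf K, Sup K})"

lemma ends_finite: "i \<in> P \<Longrightarrow> finite (ends i)"
  unfolding ends_def using pieces(1) by (auto dest: division_of_finite)

lemma piece_interior:
  assumes i: "i \<in> P" and x: "x \<in> i" "x \<notin> ends i"
  shows "\<exists>K\<in>pieces i. x \<in> interior K \<and> (\<exists>U\<in>laps T P. U \<subseteq> i \<and> K \<subseteq> U)"
proof -
  obtain K where K: "K \<in> pieces i" "x \<in> K" using division_ofD(6)[OF pieces(1)[OF i]] x by blast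
  obtain c d where cd: "K = {c..d}" using division_ofD(4)[OF pieces(1)[OF i] K(1)] by (auto simp: box_real)
  have "c \<le> d" using K(2) cd by auto
  have "x \<noteq> c" "x \<noteq> d" using x(2) K(1) cd \<open>c \<le> d\<close> unfolding ends_def by force+
  then have lt: "c < x" "x < d" using K(2) cd by auto
  have "K \<subseteq> i" using division_ofD(2)[OF pieces(1)[OF i] K(1)] .
  then obtain U where U: "maximal_monotone_interval T i U" "K \<subseteq> U"
    using maximal_exists[OF P_sub[OF i], of c d] pieces(2)[OF i K(1)] cd lt by auto
  have xK: "x \<in> interior K" using lt cd by (simp add: interior_atLeastAtMost_real)
  then have "interior U \<noteq> {}" using interior_mono[OF U(2)] by auto
  then have "U \<in> laps T P" unfolding laps_def using U i by auto
  then show ?thesis using K(1) xK U by (auto simp: maximal_monotone_interval_def)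
qed

lemma lap_cover: "countable ({0..1} - (\<Union>U\<in>laps T P. interior U))"
proof (rule countable_subset)
  show "{0..1} - (\<Union>U\<in>laps T P. interior U) \<subseteq> ({0..1} - \<Union>P) \<union> (\<Union>i\<in>P. ends i)"
  proof
    fix x :: real assume x: "x \<in> {0..1} - (\<Union>U\<in>laps T P. interior U)"
    show "x \<in> ({0..1} - \<Union>P) \<union> (\<Union>i\<in>P. ends i)"
    proof (rule ccontr)
      assume "x \<notin> ({0..1} - \<Union>P) \<union> (\<Union>i\<in>P. ends i)"
      then obtain i where i: "i \<in> P" "x \<in> i" "x \<notin> ends i" using x by blast
      from piece_interior[OF this] obtain K U where "x \<in> interior K" "U \<in> laps T P" "K \<subseteq> U" by blast
      then show False using x interior_mono[of K U] by blast
    qed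
  qed
  show "countable (({0..1} - \<Union>P) \<union> (\<Union>i\<in>P. ends i))"
    using P_co P_countable ends_finite by (auto intro: countable_finite)
qed

lemma interior_infinite:
  fixes A :: "real set" assumes "interior A \<noteq> {}" "countable N" shows "\<exists>x\<in>interior A. x \<notin> N"
proof -
  obtain x e where "e > 0" "ball x e \<subseteq> interior A" using assms(1) by (metis open_interior open_contains_ball ex_in_conv)
  moreover have "uncountable (ball x e)" using \<open>e > 0\<close> by (rule uncountable_ball)
  ultimately show ?thesis by (meson assms(2) countable_subset subset_iff)
qed

text \<open>Each lap has an interior point off the ends of the pieces, and is the only lap extending
  the piece around that point. So there are no more laps than pieces.\<close>

lemma laps_finite:
  assumes i: "i \<in> P" shows "finite {U \<in> laps T P. U \<subseteq> i}"
proof (rule finite_subset)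
  define g where "g K = (SOME U. U \<in> laps T P \<and> U \<subseteq> i \<and> K \<subseteq> U)" for K
  show "{U \<in> laps T P. U \<subseteq> i} \<subseteq> g ` pieces i"
  proof
    fix U assume U: "U \<in> {U \<in> laps T P. U \<subseteq> i}"
    then obtain x where x: "x \<in> interior U" "x \<notin> ends i"
      using interior_infinite[of U "ends i"] ends_finite[OF i] by (auto simp: laps_def intro: countable_finite)
    then have "x \<in> i" using U interior_subset by blast
    then obtain K where K: "K \<in> pieces i" "x \<in> interior K" "\<exists>V. V \<in> laps T P \<and> V \<subseteq> i \<and> K \<subseteq> V"
      using piece_interior[OF i _ x(2)] by blast
    have "g K \<in> laps T P \<and> g K \<subseteq> i \<and> K \<subseteq> g K" unfolding g_def by (rule someI_ex[OF K(3)])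
    moreover from this have "g K = U" using lap_disj[of "g K" U] U K(2) x(1) interior_mono[of K "g K"] by blast
    ultimately show "U \<in> g ` pieces i" using K(1) by blast
  qed
  show "finite (g ` pieces i)" using pieces(1)[OF i] by auto
qed

text \<open>If an end point were sent into the interior of some \<open>j\<close>, the Markov
  property would put all of \<open>j\<close> into the image segment and make an end of this segment
  an interior point of it.\<close>

lemma lap_ends:
  assumes ab: "a < b" "{a..b} \<in> laps T P"
  shows "T a \<notin> (\<Union>j\<in>P. interior j) \<and> T b \<notin> (\<Union>j\<in>P. interior j)"
proof -
  obtain i where i: "i \<in> P" "{a..b} \<subseteq> i" using lap_sub ab(2) by blast
  have mx: "maximal_monotone_interval T i {a..b}" by (rule lap_maximal[OF ab(2) i])
  have "continuous_on {a..b} T" using i P_sub continuous_on_subset[OF T_cont] by blast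
  then have im: "T ` {a..b} = closed_segment (T a) (T b)"
    using lap_inj[OF ab(2)] ab(1) by (intro image_closed_interval_inj) auto
  have "T c \<notin> interior j" if j: "j \<in> P" and c: "c = a \<or> c = b" for j c
  proof
    assume "T c \<in> interior j"
    moreover have "T c \<in> T ` {a..b}" using c ab by auto
    ultimately have "j \<subseteq> T ` {a..b}" using P_markov[OF i(1) j mx] by blast
    then have "interior j \<subseteq> interior (closed_segment (T a) (T b))" unfolding im by (rule interior_mono)
    then have "T c \<in> interior (closed_segment (T a) (T b))" using \<open>T c \<in> interior j\<close> by blast
    then show False using c by (auto simp: closed_segment_eq_real_ivl interior_atLeastAtMost_real split: if_splits)
  qed
  then show ?thesis by blast
qed

lemma lap_covers:
  assumes "U \<in> laps T P" "j \<in> P" "y \<in> interior j" "y \<in> T ` U" shows "j \<subseteq> T ` U"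
proof -
  obtain i where i: "i \<in> P" "U \<subseteq> i" using lap_sub assms(1) by blast
  show ?thesis using P_markov[OF i(1) assms(2) lap_maximal[OF assms(1) i]] assms(3,4) by blast
qed

text \<open>The laps attain the maximum in the definition. A competing family injects into them:
  each member contains a preimage of one fixed \<open>y\<close>, the lap of this preimage covers
  \<open>j\<close>, and two members with the same lap would share the preimage.\<close>

lemma transition_matrix_card:
  assumes i: "i \<in> P" and j: "j \<in> P"
  shows "transition_matrix T i j = real (card {U\<in>laps T P. U \<subseteq> i \<and> j \<subseteq> T ` U})"
proof -
  define A where "A = {U\<in>laps T P. U \<subseteq> i \<and> j \<subseteq> T ` U}"
  have finA: "finite A" unfolding A_def by (rule finite_subset[OF _ laps_finite[OF i]]) auto
  define valid where "valid I \<longleftrightarrow> finite I \<and>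
       (\<forall>K\<in>I. is_interval K \<and> K \<subseteq> i \<and> monotone_map_on K T \<and> j \<subseteq> T ` K) \<and>
       (\<forall>K\<in>I. \<forall>L\<in>I. K \<noteq> L \<longrightarrow> interior K \<inter> interior L = {})" for I
  have vA: "valid A"
    unfolding valid_def A_def using finA[unfolded A_def] lap_ivl lap_monotone lap_disj by (auto simp: is_interval_cc) (metis is_interval_cc)
  have le: "card I \<le> card A" if v: "valid I" for I
  proof -
    obtain y1 y2 where y12: "y1 < y2" "j = {y1..y2}" using P_ivl[OF j] by blast
    have "countable (T ` ({0..1} - (\<Union>U\<in>laps T P. interior U)))" using lap_cover by auto
    moreover have "interior j \<noteq> {}" using y12 by (simp add: interior_atLeastAtMost_real)
    ultimately obtain y where y: "y \<in> interior j" "y \<notin> T ` ({0..1} - (\<Union>U\<in>laps T P. interior U))"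
      using interior_infinite[of j] by blast
    have yy: "y1 < y" "y < y2" using y(1) y12 by (auto simp: interior_atLeastAtMost_real)
    have "\<exists>x U. x \<in> interior K \<and> T x = y \<and> U \<in> A \<and> x \<in> U" if K: "K \<in> I" for K
    proof -
      have Ki: "is_interval K" "K \<subseteq> i" "monotone_map_on K T" "j \<subseteq> T ` K" using v K by (auto simp: valid_def)
      have "y \<in> T ` K" "y1 \<in> T ` K" "y2 \<in> T ` K" using Ki(4) y12 yy by auto
      then obtain x x1 x2 where x: "x \<in> K" "T x = y" "x1 \<in> K" "T x1 = y1" "x2 \<in> K" "T x2 = y2" by blast
      \<comment> \<open>\<open>y\<close> lies strictly between the ends of \<open>j\<close>, so its
        preimage lies strictly between preimages of these ends and is interior to
        \<open>K\<close>.\<close>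
      have btw: "(x1 < x \<and> x < x2) \<or> (x2 < x \<and> x < x1)"
        using monotone_map_between[OF Ki(3) x(3,1,5)] x yy by simp
      then have "x \<in> {min x1 x2<..<max x1 x2}" by auto
      moreover have "{min x1 x2<..<max x1 x2} \<subseteq> K" using mem_is_interval_1_I[OF Ki(1) x(3,5)] mem_is_interval_1_I[OF Ki(1) x(5,3)] by (auto simp: min_def max_def split: if_splits)
      ultimately have xK: "x \<in> interior K" by (meson interior_maximal open_greaterThanLessThan subsetD)
      have "x \<in> {0..1}" using x(1) Ki(2) P_sub[OF i] by auto
      then obtain U where U: "U \<in> laps T P" "x \<in> interior U" using y(2) x(2) by blast
      obtain i' where i': "i' \<in> P" "U \<subseteq> i'" using lap_sub U(1) by blast
      have "x \<in> interior i \<inter> interior i'" using xK U(2) interior_mono[OF Ki(2)] interior_mono[OF i'(2)] by blast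
      then have "i' = i" using P_unique i i'(1) by blast
      moreover have xU: "x \<in> U" using U(2) interior_subset by blast
      moreover have "j \<subseteq> T ` U" using lap_covers[OF U(1) j y(1)] xU x(2) by blast
      ultimately show ?thesis using U(1) i'(2) xK x(2) unfolding A_def by blast
    qed
    then obtain xf Uf where f: "\<And>K. K \<in> I \<Longrightarrow> xf K \<in> interior K \<and> T (xf K) = y \<and> Uf K \<in> A \<and> xf K \<in> Uf K" by metis
    have "inj_on Uf I"
    proof (rule inj_onI)
      fix K K' assume K: "K \<in> I" "K' \<in> I" "Uf K = Uf K'"
      have UfK: "Uf K \<in> laps T P" using f[OF K(1)] by (simp add: A_def)
      have "xf K = xf K'"
        by (rule inj_onD[OF lap_inj[OF UfK]]) (use f[OF K(1)] f[OF K(2)] K(3) in simp_all)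
      then have "interior K \<inter> interior K' \<noteq> {}" using f[OF K(1)] f[OF K(2)] by (metis disjoint_iff)
      then show "K = K'" using v K unfolding valid_def by blast
    qed
    moreover have "Uf ` I \<subseteq> A" using f by blast
    ultimately show ?thesis using finA by (metis card_image card_mono)
  qed
  show ?thesis
  proof (cases "j \<subseteq> T ` i")
    case True
    have "Max {card I | I. valid I} = card A"
    proof (rule Max_eqI)
      show "finite {card I | I. valid I}" by (rule finite_subset[of _ "{..card A}"]) (use le in auto)
        show "c \<le> card A" if "c \<in> {card I | I. valid I}" for c using that le by blast
      show "card A \<in> {card I | I. valid I}" using vA by blast
    qed
    then show ?thesis using True unfolding transition_matrix_def valid_def A_def by simp
  next
    case False
    then have "A = {}" unfolding A_def by blast
    then show ?thesis using False unfolding transition_matrix_def A_def[symmetric] by simp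
  qed
qed

lemma markov_map_laps: "markov_map T P (laps T P) (transition_matrix T)"
proof
  fix i j assume ij: "i \<in> P" "j \<in> P"
  show "finite {U \<in> laps T P. U \<subseteq> i \<and> j \<subseteq> T ` U} \<and> transition_matrix T i j = real (card {U \<in> laps T P. U \<subseteq> i \<and> j \<subseteq> T ` U})"
    using transition_matrix_card[OF ij] finite_subset[OF _ laps_finite[OF ij(1)], of "{U \<in> laps T P. U \<subseteq> i \<and> j \<subseteq> T ` U}"] by auto
qed (fact T mixing P_countable P_ivl P_disj P_cover lap_ivl lap_sub lap_disj lap_cover lap_inj lap_ends)+

end

section \<open>Window perturbations\<close>

text \<open>The partition is kept. An interval of \<open>P'\<close> is a single lap of
  \<open>S\<close>, and it is replaced by 2 k + 1 laps with the same image, which multiplies its row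
  by 2 k + 1 \<ge> 3.\<close>

lemma perturbation_markov_map:
  assumes wp: "window_perturbation S P P' T"
  shows "\<exists>L c. markov_map T P L (\<lambda>i j. c i * transition_matrix S i j) \<and> (\<forall>i\<in>P'. 3 \<le> c i) \<and> (\<forall>i. i \<notin> P' \<longrightarrow> c i = (1::real))"
proof -
  note w = wp[unfolded window_perturbation_def CPMM_def mem_Collect_eq]
  have mp: "markov_partition S P" and P': "P' \<subseteq> P" and mono_P': "\<And>j. j \<in> P' \<Longrightarrow> monotone_map_on j S"
    and eq: "\<And>x. x \<in> {0..1} \<Longrightarrow> x \<notin> (\<Union>j\<in>P'. interior j) \<Longrightarrow> T x = S x"
    and S: "interval_map S" "topologically_mixing {0..1} S" and T: "interval_map T" "topologically_mixing {0..1} T"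
    using w by auto
  have ex: "\<forall>j\<in>P'. \<exists>k\<ge>1. \<exists>J. J division_of j \<and> card J = 2 * k + 1 \<and>
      (\<forall>K\<in>J. interior K \<noteq> {} \<and> T ` K = S ` j \<and> monotone_map_on K T)"
    using w by (elim conjE)
  \<comment> \<open>The order and the division are tied by the cardinality, so they are chosen
    together as a pair.\<close>
  define good where "good j kJ \<longleftrightarrow> fst kJ \<ge> (1::nat) \<and> snd kJ division_of j \<and> card (snd kJ) = 2 * fst kJ + 1 \<and>
      (\<forall>K\<in>snd kJ. interior K \<noteq> {} \<and> T ` K = S ` j \<and> monotone_map_on K T)" for j kJ
  have "\<exists>kJ. good j kJ" if j: "j \<in> P'" for j
  proof -
    from bspec[OF ex j] obtain k J where "k \<ge> (1::nat)" "J division_of j" "card J = 2 * k + 1"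
      "\<forall>K\<in>J. interior K \<noteq> {} \<and> T ` K = S ` j \<and> monotone_map_on K T" by (elim exE conjE)
    then have "good j (k, J)" by (simp add: good_def)
    then show ?thesis ..
  qed
  then obtain kJ where kJ: "\<And>j. j \<in> P' \<Longrightarrow> good j (kJ j)" by metis
  define k J where "k j = fst (kJ j)" and "J j = snd (kJ j)" for j
  interpret S: markov_setting S P by unfold_locales (use S mp in auto)
  interpret Sm: markov_map S P "laps S P" "transition_matrix S" by (rule S.markov_map_laps)
  interpret T: mixing_interval_map T by unfold_locales (use T in auto)
  have J: "J j division_of j" "card (J j) = 2 * k j + 1" "k j \<ge> 1" if "j \<in> P'" for j
    using kJ[OF that] by (simp_all add: good_def k_def J_def)
  have K: "interior K \<noteq> {}" "T ` K = S ` j" "monotone_map_on K T" "K \<subseteq> j" if "j \<in> P'" "K \<in> J j" for j K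
    using kJ[OF that(1)] that(2) division_ofD(2)[OF J(1)[OF that(1)] that(2)] by (simp_all add: good_def J_def)
  have K_ivl: "\<exists>c d. c < d \<and> K = {c..d}" if jK: "j \<in> P'" "K \<in> J j" for j K
  proof -
    obtain c d where "K = {c..d}" using division_ofD(4)[OF J(1)[OF jK(1)] jK(2)] by (auto simp: box_real)
    then show ?thesis using K(1)[OF jK] by (auto simp: interior_atLeastAtMost_real)
  qed
  have K_inj: "inj_on T K" if "j \<in> P'" "K \<in> J j" for j K
  proof -
    have "is_interval K" using K_ivl[OF that] by (auto simp: is_interval_cc)
    moreover have "K \<subseteq> {0..1}" using K(4)[OF that] S.P_sub[of j] P' that(1) by blast
    ultimately show ?thesis using K(3)[OF that] by (rule T.monotone_inj)
  qed
  have eqi: "T x = S x" if "i \<in> P" "i \<notin> P'" "x \<in> i" for i x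
  proof (rule eq)
    show "x \<in> {0..1}" using S.P_sub that by blast
    show "x \<notin> (\<Union>j\<in>P'. interior j)" using Sm.P_unique[OF that(1) _ that(3)] P' that(2) by blast
  qed
  have lap_P': "U = i" if "U \<in> laps S P" "i \<in> P'" "U \<subseteq> i" for U i
  proof -
    have "maximal_monotone_interval S i U" using S.lap_maximal that P' by blast
    moreover have "i \<in> P" using P' that(2) by blast
    then have "is_interval i" using S.P_ivl[of i] by (auto simp: is_interval_cc)
    ultimately show ?thesis using mono_P'[OF that(2)] that(3) unfolding maximal_monotone_interval_def by (metis order_refl)
  qed
  have P'_lap: "i \<in> laps S P" if i: "i \<in> P'" for i
  proof -
    have iP: "i \<in> P" using P' i by blast
    obtain a b where ab: "a < b" "i = {a..b}" using S.P_ivl[OF iP] by (elim exE conjE)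
    have "is_interval i" "i \<noteq> {}" using ab by (simp_all add: is_interval_cc)
    then have "maximal_monotone_interval S i i"
      using mono_P'[OF i] unfolding maximal_monotone_interval_def by (intro conjI allI impI subset_antisym) auto
    moreover have "interior i \<noteq> {}" using ab by (simp add: interior_atLeastAtMost_real)
    ultimately show ?thesis unfolding laps_def using iP by blast
  qed
  define L where "L = {U\<in>laps S P. \<exists>i\<in>P - P'. U \<subseteq> i} \<union> (\<Union>j\<in>P'. J j)"
  have L_ivl: "\<exists>a b. a < b \<and> U = {a..b}" if "U \<in> L" for U
    using that S.lap_ivl[of U] K_ivl[of _ U] unfolding L_def by (elim UnE UN_E CollectE) auto
  then have L_int: "interior U \<noteq> {}" if "U \<in> L" for U
    using that by (force simp: interior_atLeastAtMost_real)
  have L_in: "(i \<in> P' \<and> U \<in> J i) \<or> (i \<notin> P' \<and> U \<in> laps S P)" if U: "U \<in> L" and i: "i \<in> P" "U \<subseteq> i" for U i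
  proof -
    have same: "i' = i" if "i' \<in> P" "U \<subseteq> i'" for i'
      using S.P_unique[OF that(1) i(1)] L_int[OF U] interior_mono[OF that(2)] interior_mono[OF i(2)] by blast
    from U consider i' where "U \<in> laps S P" "i' \<in> P" "i' \<notin> P'" "U \<subseteq> i'" | j where "j \<in> P'" "U \<in> J j"
      unfolding L_def by blast
    then show ?thesis
    proof cases
      case 1
      then show ?thesis using same by blast
    next
      case 2
      then have "j = i" using same K(4) P' by blast
      then show ?thesis using 2 by blast
    qed
  qed
  have L_sub: "\<exists>i\<in>P. U \<subseteq> i" if "U \<in> L" for U
    using that P' K(4) unfolding L_def by blast
  define c where "c i = (if i \<in> P' then 2 * real (k i) + 1 else 1)" for i
  have "markov_map T P L (\<lambda>i j. c i * transition_matrix S i j)"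
  proof
    show "interior U \<inter> interior V = {}" if UV: "U \<in> L" "V \<in> L" "U \<noteq> V" for U V
    proof (rule ccontr)
      assume meet: "interior U \<inter> interior V \<noteq> {}"
      obtain i where i: "i \<in> P" "U \<subseteq> i" using L_sub UV by blast
      obtain j where j: "j \<in> P" "V \<subseteq> j" using L_sub UV by blast
      have ij: "j = i" using S.P_unique[OF j(1) i(1)] meet interior_mono[OF i(2)] interior_mono[OF j(2)] by blast
      from L_in[OF UV(1) i] L_in[OF UV(2) j] consider "U \<in> laps S P" "V \<in> laps S P" | "i \<in> P'" "U \<in> J i" "V \<in> J i"
        unfolding ij by blast
      then show False
      proof cases
        case 1
        then show ?thesis using S.lap_disj UV(3) meet by blast
      next
        case 2
        then show ?thesis using division_ofD(5)[OF J(1)[OF 2(1)] 2(2,3) UV(3)] meet by blast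
      qed
    qed
    show "countable ({0..1} - (\<Union>U\<in>L. interior U))"
    proof (rule countable_subset)
      show "{0..1} - (\<Union>U\<in>L. interior U) \<subseteq> ({0..1} - (\<Union>U\<in>laps S P. interior U)) \<union> (\<Union>j\<in>P'. \<Union>K\<in>J j. {Inf K, Sup K})"
      proof
        fix x :: real assume x: "x \<in> {0..1} - (\<Union>U\<in>L. interior U)"
        show "x \<in> ({0..1} - (\<Union>U\<in>laps S P. interior U)) \<union> (\<Union>j\<in>P'. \<Union>K\<in>J j. {Inf K, Sup K})"
        proof (rule ccontr)
          assume n: "x \<notin> ({0..1} - (\<Union>U\<in>laps S P. interior U)) \<union> (\<Union>j\<in>P'. \<Union>K\<in>J j. {Inf K, Sup K})"
          then obtain U where U: "U \<in> laps S P" "x \<in> interior U" using x by blast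
          obtain i where i: "i \<in> P" "U \<subseteq> i" using S.lap_sub U(1) by blast
          show False
          proof (cases "i \<in> P'")
            case False
            then have "U \<in> L" using U i unfolding L_def by blast
            then show False using x U(2) by blast
          next
            case True
            have "x \<in> \<Union>(J i)" using division_ofD(6)[OF J(1)[OF True]] U(2) i(2) interior_subset by blast
            then obtain K where K: "K \<in> J i" "x \<in> K" by blast
            obtain a b where ab: "a < b" "K = {a..b}" using K_ivl[OF True K(1)] by blast
            have "x \<noteq> Inf K" "x \<noteq> Sup K" using n True K(1) by blast+
            then have "x \<in> interior K" using K(2) ab by (simp add: interior_atLeastAtMost_real)
            moreover have "K \<in> L" using True K(1) unfolding L_def by blast
            ultimately show False using x by blast
          qed
        qed
      qed
      have "countable P'" using S.P_countable P' countable_subset by blast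
      moreover have "countable (\<Union>K\<in>J j. {Inf K, Sup K})" if "j \<in> P'" for j
        using division_of_finite[OF J(1)[OF that]] by (intro countable_finite) auto
      ultimately show "countable (({0..1} - (\<Union>U\<in>laps S P. interior U)) \<union> (\<Union>j\<in>P'. \<Union>K\<in>J j. {Inf K, Sup K}))"
        using S.lap_cover by (rule countable_Un[OF _ countable_UN, rotated])
    qed
    show "inj_on T U" if U: "U \<in> L" for U
    proof -
      obtain i where i: "i \<in> P" "U \<subseteq> i" using L_sub U by blast
      from L_in[OF U i] show ?thesis
      proof
        assume "i \<notin> P' \<and> U \<in> laps S P"
        moreover from this have "inj_on T U = inj_on S U" using eqi i by (intro inj_on_cong) blast
        ultimately show ?thesis using S.lap_inj by blast
      qed (use K_inj in blast)
    qed
    show "T a \<notin> (\<Union>i\<in>P. interior i) \<and> T b \<notin> (\<Union>i\<in>P. interior i)" if ab: "a < b" and U: "{a..b} \<in> L" for a b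
    proof -
      obtain i where i: "i \<in> P" "{a..b} \<subseteq> i" using L_sub U by blast
      from L_in[OF U i] show ?thesis
      proof
        assume *: "i \<notin> P' \<and> {a..b} \<in> laps S P"
        moreover have "a \<in> i" "b \<in> i" using i(2) ab by auto
        ultimately show ?thesis using S.lap_ends[OF ab] eqi[OF i(1)] by metis
      next
        assume *: "i \<in> P' \<and> {a..b} \<in> J i"
        obtain p q where pq: "p < q" "i = {p..q}" using S.P_ivl[OF i(1)] by (elim exE conjE)
        have "{a..b} \<subseteq> {0..1}" using i S.P_sub by blast
        then have "T ` {a..b} = closed_segment (T a) (T b)"
          using K_inj * ab continuous_on_subset[OF T.T_cont] by (intro image_closed_interval_inj) auto
        moreover have "S ` {p..q} = closed_segment (S p) (S q)"
          using Sm.T_image_L[of p q p q] P'_lap[of i] * pq by auto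
        ultimately have "closed_segment (T a) (T b) = closed_segment (S p) (S q)" using K(2)[of i "{a..b}"] * pq by simp
        \<comment> \<open>The two segments coincide, so the ends of a piece are sent to the images
          of the ends of \<open>i\<close>, to which the end point condition for \<open>S\<close>
          applies.\<close>
        then have t: "(T a = S p \<or> T a = S q) \<and> (T b = S p \<or> T b = S q)"
          by (auto simp: closed_segment_eq_real_ivl split: if_splits)
        have s: "S p \<notin> (\<Union>i\<in>P. interior i) \<and> S q \<notin> (\<Union>i\<in>P. interior i)"
          using P'_lap[of i] * unfolding pq(2) by (intro S.lap_ends[OF pq(1)]) simp
        from t s show ?thesis by metis
      qed
    qed
    show "finite {U \<in> L. U \<subseteq> i \<and> j \<subseteq> T ` U} \<and> c i * transition_matrix S i j = real (card {U \<in> L. U \<subseteq> i \<and> j \<subseteq> T ` U})"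
      if i: "i \<in> P" and j: "j \<in> P" for i j
    proof (cases "i \<in> P'")
      case True
      have "{U \<in> L. U \<subseteq> i \<and> j \<subseteq> T ` U} = (if j \<subseteq> S ` i then J i else {})"
      proof -
        have mem: "U \<in> L \<and> U \<subseteq> i \<longleftrightarrow> U \<in> J i" for U
          using L_in[OF _ i, of U] True K(4)[OF True, of U] unfolding L_def by blast
        have "U \<in> L \<and> U \<subseteq> i \<and> j \<subseteq> T ` U \<longleftrightarrow> U \<in> J i \<and> j \<subseteq> S ` i" for U
          using mem[of U] K(2)[OF True, of U] by metis
        then show ?thesis by simp
      qed
      moreover have "{U \<in> laps S P. U \<subseteq> i \<and> j \<subseteq> S ` U} = (if j \<subseteq> S ` i then {i} else {})"
      proof -
        have "U \<in> laps S P \<and> U \<subseteq> i \<and> j \<subseteq> S ` U \<longleftrightarrow> U = i \<and> j \<subseteq> S ` i" for U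
          using lap_P'[OF _ True, of U] P'_lap[OF True] by blast
        then show ?thesis by auto
      qed
      ultimately show ?thesis
        using S.transition_matrix_card[OF i j] J[OF True] division_of_finite[OF J(1)[OF True]] True by (auto simp: c_def)
    next
      case False
      have TS: "T ` U = S ` U" if "U \<subseteq> i" for U using eqi[OF i False] that by (intro image_cong) auto
      have "{U \<in> L. U \<subseteq> i \<and> j \<subseteq> T ` U} = {U \<in> laps S P. U \<subseteq> i \<and> j \<subseteq> S ` U}"
      proof (intro equalityI subsetI)
        fix U assume "U \<in> {U \<in> L. U \<subseteq> i \<and> j \<subseteq> T ` U}"
        then show "U \<in> {U \<in> laps S P. U \<subseteq> i \<and> j \<subseteq> S ` U}" using L_in[of U i] i False TS[of U] by auto
      next
        fix U assume "U \<in> {U \<in> laps S P. U \<subseteq> i \<and> j \<subseteq> S ` U}"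
        then show "U \<in> {U \<in> L. U \<subseteq> i \<and> j \<subseteq> T ` U}" using i False TS[of U] unfolding L_def by auto
      qed
      then show ?thesis using Sm.M_card[OF i j] False by (simp add: c_def)
    qed
  qed (fact T S.P_countable S.P_ivl S.P_disj S.P_cover L_ivl L_sub)+
  then show ?thesis using J by (intro exI[of _ L] exI[of _ c]) (force simp: c_def)
qed

section \<open>From a summable eigenvector to a constant slope model\<close>

text \<open>The eigenvector \<open>v\<close> is spread over one generic point \<open>Y i\<close> in each partition interval; the
  normalised pullbacks \<open>\<mu> n\<close> of this atomic measure under \<open>T ^^ n\<close> give every partition interval
  the same mass \<open>v i\<close>, and their distribution functions converge to the conjugacy. The
  distribution function \<open>h n\<close> counts the atom at \<open>x\<close> with weight \<open>1/2\<close>, so that \<open>h_conformal\<close>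
  holds for increasing and for decreasing branches alike.\<close>

locale markov_eigenvector = markov_map +
  fixes v :: "real set \<Rightarrow> real" and l :: real
  assumes v_pos: "\<And>i. i \<in> P \<Longrightarrow> 0 < v i"
    and v_sum: "csum P (\<lambda>i. ennreal (v i)) < \<infinity>"
    and v_eigen: "\<And>i. i \<in> P \<Longrightarrow> csum P (\<lambda>j. ennreal (M i j) * ennreal (v j)) = ennreal (l * v i)"
    and l_gt_1: "1 < l"
begin

section \<open>Atomic measures with the masses of the eigenvector\<close>

definition "Y i = (SOME y. gen y \<and> y \<in> interior i)"

lemma Y: "i \<in> P \<Longrightarrow> gen (Y i) \<and> Y i \<in> interior i"
proof -
  assume "i \<in> P"
  then have "\<exists>y. gen y \<and> y \<in> interior i" using gen_in_P[of i "{}"] by auto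
  then show ?thesis unfolding Y_def by (rule someI_ex)
qed

text \<open>Density of the atomic measure: mass \<open>v i\<close> at \<open>Y i\<close>. The
  description recovers \<open>i\<close>, which is unique because \<open>Y i\<close> is
  generic.\<close>

definition "w x = (if x \<in> Y ` P then v (THE i. i \<in> P \<and> x \<in> i) else 0)"

lemma the_P: "gen x \<Longrightarrow> i \<in> P \<Longrightarrow> x \<in> i \<Longrightarrow> (THE i. i \<in> P \<and> x \<in> i) = i"
  using gen_P_unique by (intro the_equality) blast+

lemma w_eq: "i \<in> P \<Longrightarrow> x \<in> i \<Longrightarrow> w x = v i * (if x = Y i then 1 else 0)"
proof -
  assume i: "i \<in> P" "x \<in> i"
  show ?thesis
  proof (cases "x \<in> Y ` P")
    case True
    then obtain j where j: "j \<in> P" "x = Y j" by blast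
    then have "x \<in> interior j" "gen x" using Y by auto
    then have "i = j" using P_unique[OF i(1) j(1) i(2)] by blast
    then show ?thesis using True j the_P[OF \<open>gen x\<close> i] by (simp add: w_def)
  next
    case False
    then show ?thesis using i by (auto simp: w_def)
  qed
qed

lemma w_nongen: "\<not> gen x \<Longrightarrow> w x = 0"
  using Y by (auto simp: w_def)

lemma w_nonneg: "0 \<le> w x"
proof (cases "gen x")
  case True
  then obtain i where "i \<in> P" "x \<in> i" using gen_P_unique by blast
  then show ?thesis using w_eq[of i x] v_pos[of i] by (simp add: less_imp_le)
qed (simp add: w_nongen)

lemma l_pos: "0 < l" using l_gt_1 by simp

text \<open>By the eigenvector equation each pullback multiplies the mass of every partition
  interval by \<open>l\<close>.\<close>

lemma csum_w_P: "i \<in> P \<Longrightarrow> csum i (\<lambda>x. ennreal (w ((T ^^ n) x))) = ennreal (l ^ n * v i)"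
proof (induction n arbitrary: i)
  case 0
  have "csum i (\<lambda>x. ennreal (w x)) = csum i (\<lambda>x. ennreal (v i) * (if x = Y i then 1 else 0))"
    using w_eq[OF 0] by (intro csum_cong) auto
  also have "\<dots> = ennreal (v i)"
    using Y[OF 0] interior_subset by (intro csum_single) blast
  finally show ?case by simp
next
  case (Suc n)
  have "csum i (\<lambda>x. ennreal (w ((T ^^ Suc n) x))) = csum P (\<lambda>\<alpha>. ennreal (M i \<alpha>) * csum \<alpha> (\<lambda>x. ennreal (w ((T ^^ n) x))))"
    by (rule count_Suc) (use w_nongen Suc.prems in auto)
  also have "\<dots> = csum P (\<lambda>\<alpha>. ennreal (l ^ n) * (ennreal (M i \<alpha>) * ennreal (v \<alpha>)))"
    using Suc.IH l_pos v_pos by (intro csum_cong) (simp add: ennreal_mult less_imp_le ac_simps)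
  also have "\<dots> = ennreal (l ^ n) * ennreal (l * v i)" by (simp add: csum_cmult v_eigen[OF Suc.prems])
  also have "\<dots> = ennreal (l ^ Suc n * v i)"
    using l_pos v_pos[OF Suc.prems] by (simp add: ennreal_mult[symmetric] less_imp_le ac_simps)
  finally show ?case .
qed

definition "V = enn2real (csum P (\<lambda>i. ennreal (v i)))"

lemma V: "csum P (\<lambda>i. ennreal (v i)) = ennreal V" and V_nonneg: "0 \<le> V"
  using v_sum by (auto simp: V_def)

lemma V_pos: "0 < V"
proof -
  obtain i where i: "i \<in> P" using P_nonempty by blast
  have "ennreal (v i) \<le> ennreal V" unfolding V[symmetric] by (rule csum_upper[OF i])
  then show ?thesis using v_pos[OF i] V_nonneg by (simp add: ennreal_le_iff)
qed

lemma csum_w_tiling: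
  assumes A: "A \<subseteq> {0..1}" and F: "\<And>x. x \<in> A \<Longrightarrow> gen x \<Longrightarrow> \<exists>!\<alpha>. \<alpha> \<in> F \<and> x \<in> \<alpha>" and sub: "\<And>\<alpha>. \<alpha> \<in> F \<Longrightarrow> \<alpha> \<subseteq> A"
  shows "csum A (\<lambda>x. ennreal (w ((T ^^ n) x))) = csum F (\<lambda>\<alpha>. csum \<alpha> (\<lambda>x. ennreal (w ((T ^^ n) x))))"
proof (rule csum_tiling)
  fix x assume x: "x \<in> A" and nz: "ennreal (w ((T ^^ n) x)) \<noteq> 0"
  then have "gen ((T ^^ n) x)" using w_nongen by (metis ennreal_0)
  then have "gen x" using gen_back[of n x] A x by blast
  then show "\<exists>!\<alpha>. \<alpha> \<in> F \<and> x \<in> \<alpha>" using F x by blast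
qed (rule sub)

text \<open>The division by l ^ n cancels the growth under pullback. All subsets of the unit
  interval are measurable, so images need no measurability proofs.\<close>

definition "\<mu> n = density (count_space {0..1}) (\<lambda>x. ennreal (w ((T ^^ n) x) / l ^ n))"

lemma sets_\<mu>[simp]: "A \<in> sets (\<mu> n) \<longleftrightarrow> A \<subseteq> {0..1}"
  by (simp add: \<mu>_def)

lemma emeasure_\<mu>:
  assumes A: "A \<subseteq> {0..1}"
  shows "emeasure (\<mu> n) A = csum A (\<lambda>x. ennreal (w ((T ^^ n) x))) * ennreal (1 / l ^ n)"
proof -
  have "emeasure (\<mu> n) A = csum {0..1} (\<lambda>x. ennreal (w ((T ^^ n) x) / l ^ n) * indicator A x)"
    unfolding \<mu>_def by (rule emeasure_density) (use A in auto)
  also have "\<dots> = csum A (\<lambda>x. ennreal (w ((T ^^ n) x) / l ^ n))"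
    by (subst csum_UNIV_indicator[of "{0..1}"], subst csum_UNIV_indicator[of A], rule csum_cong)
      (use A in \<open>auto split: split_indicator\<close>)
  also have "\<dots> = csum A (\<lambda>x. ennreal (w ((T ^^ n) x)) * ennreal (1 / l ^ n))"
    using l_pos w_nonneg by (intro csum_cong) (simp add: ennreal_mult[symmetric])
  finally show ?thesis by (simp add: csum_multc)
qed

lemma emeasure_\<mu>_UNIV: "emeasure (\<mu> n) {0..1} = ennreal V"
proof -
  have "csum {0..1} (\<lambda>x. ennreal (w ((T ^^ n) x))) = csum P (\<lambda>\<alpha>. csum \<alpha> (\<lambda>x. ennreal (w ((T ^^ n) x))))"
    using gen_P_unique P_sub by (intro csum_w_tiling) auto
  also have "\<dots> = csum P (\<lambda>\<alpha>. ennreal (l ^ n) * ennreal (v \<alpha>))"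
    using l_pos v_pos by (intro csum_cong) (simp add: csum_w_P ennreal_mult less_imp_le)
  finally have eq: "csum {0..1} (\<lambda>x. ennreal (w ((T ^^ n) x))) = ennreal (l ^ n) * ennreal V" by (simp add: csum_cmult V)
  have "l ^ n * V * (1 / l ^ n) = V" using l_pos by simp
  then show ?thesis
    using l_pos V_nonneg unfolding emeasure_\<mu>[OF order_refl] eq
    by (subst ennreal_mult[symmetric], simp, simp, subst ennreal_mult[symmetric]) auto
qed

lemma finite_\<mu>: "finite_measure (\<mu> n)"
  by (rule finite_measureI) (use emeasure_\<mu>_UNIV in \<open>simp add: \<mu>_def\<close>)

definition "r n A = measure (\<mu> n) A"

lemma ennreal_r: "A \<subseteq> {0..1} \<Longrightarrow> ennreal (r n A) = csum A (\<lambda>x. ennreal (w ((T ^^ n) x))) * ennreal (1 / l ^ n)"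
  unfolding r_def by (simp add: emeasure_\<mu>[symmetric] finite_measure.emeasure_eq_measure[OF finite_\<mu>])

lemma r_nonneg: "0 \<le> r n A" by (simp add: r_def)

lemma r_mono: "A \<subseteq> B \<Longrightarrow> B \<subseteq> {0..1} \<Longrightarrow> r n A \<le> r n B"
  unfolding r_def using finite_measure.finite_measure_mono[OF finite_\<mu>] by simp

lemma r_Un: "A \<subseteq> {0..1} \<Longrightarrow> B \<subseteq> {0..1} \<Longrightarrow> A \<inter> B = {} \<Longrightarrow> r n (A \<union> B) = r n A + r n B"
  unfolding r_def using finite_measure.finite_measure_Union[OF finite_\<mu>] by simp

lemma r_total: "r n {0..1} = V"
  unfolding r_def by (rule measure_eq_emeasure_eq_ennreal) (simp_all add: emeasure_\<mu>_UNIV V_nonneg)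

lemma r_eqI: "A \<subseteq> {0..1} \<Longrightarrow> B \<subseteq> {0..1} \<Longrightarrow> c \<ge> 0 \<Longrightarrow> ennreal (r n A) = ennreal c * ennreal (r m B) \<Longrightarrow> r n A = c * r m B"
  using r_nonneg by (simp add: ennreal_mult[symmetric])

text \<open>Conformality up to a shift of the stage; it becomes exact in the limit.\<close>

lemma r_Suc_inj:
  assumes A: "A \<subseteq> {0..1}" and inj: "inj_on T A" shows "r (Suc n) A = (1 / l) * r n (T ` A)"
proof (rule r_eqI)
  show sub: "T ` A \<subseteq> {0..1}" using A T_in by blast
  have "csum A (\<lambda>x. ennreal (w ((T ^^ Suc n) x))) = csum (T ` A) (\<lambda>x. ennreal (w ((T ^^ n) x)))"
    by (simp only: csum_image_inj[OF inj] funpow_Suc_right o_apply)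
  moreover have "ennreal (1 / l ^ Suc n) = ennreal (1 / l) * ennreal (1 / l ^ n)"
    using l_pos by (simp add: ennreal_mult[symmetric])
  ultimately show "ennreal (r (Suc n) A) = ennreal (1 / l) * ennreal (r n (T ` A))"
    by (simp only: ennreal_r[OF A] ennreal_r[OF sub] ac_simps)
qed (use A l_pos in auto)

text \<open>Without injectivity an inequality remains, since choosing one preimage in
  \<open>A\<close> for each point of \<open>B\<close> suffices.\<close>

lemma r_image_le:
  assumes A: "A \<subseteq> {0..1}" and B: "B \<subseteq> (T ^^ N) ` A" shows "r n B \<le> l ^ N * r (n + N) A"
proof -
  have B01: "B \<subseteq> {0..1}" using B A Tn_in by blast
  have "csum B (\<lambda>x. ennreal (w ((T ^^ n) x))) \<le> csum A (\<lambda>x. ennreal (w ((T ^^ n) ((T ^^ N) x))))"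
    by (rule csum_image_le[OF B])
  then have "ennreal (r n B) \<le> csum A (\<lambda>x. ennreal (w ((T ^^ (n + N)) x))) * ennreal (1 / l ^ n)"
    unfolding ennreal_r[OF B01] by (intro mult_right_mono) (simp_all add: funpow_add)
  also have "ennreal (1 / l ^ n) = ennreal (1 / l ^ (n + N)) * ennreal (l ^ N)"
    using l_pos by (simp add: ennreal_mult[symmetric] power_add)
  finally have "ennreal (r n B) \<le> ennreal (r (n + N) A) * ennreal (l ^ N)"
    unfolding ennreal_r[OF A] by (simp only: mult.assoc)
  then show ?thesis using l_pos r_nonneg by (simp add: ennreal_mult[symmetric] ennreal_le_iff mult.commute)
qed

lemma r_nongen:
  assumes "x \<in> {0..1}" "\<not> gen x" shows "r n {x} = 0"
proof -
  have "w ((T ^^ n) x) = 0" using w_nongen gen_back[of n x] assms by blast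
  then have "csum {x} (\<lambda>x. ennreal (w ((T ^^ n) x))) = 0" by (simp add: nn_integral_count_space_finite)
  then show ?thesis using ennreal_r[of "{x}" n] assms r_nonneg[of n "{x}"] by simp
qed

text \<open>Atoms shrink geometrically with the stage; continuity of the limit rests on
  this.\<close>

lemma r_single_le: assumes "x \<in> {0..1}" shows "r n {x} \<le> V / l ^ n"
proof -
  have "w y \<le> V" for y
  proof (cases "gen y")
    case True
    then obtain i where i: "i \<in> P" "y \<in> i" using gen_P_unique by blast
    have "ennreal (v i) \<le> ennreal V" unfolding V[symmetric] by (rule csum_upper[OF i(1)])
    then show ?thesis using V_nonneg w_eq[OF i] by (simp add: ennreal_le_iff)
  qed (simp add: w_nongen V_nonneg)
  then have "ennreal (r n {x}) \<le> ennreal V * ennreal (1 / l ^ n)"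
    using assms by (simp add: ennreal_r nn_integral_count_space_finite mult_right_mono ennreal_leI)
  also have "\<dots> = ennreal (V / l ^ n)" using V_nonneg l_pos by (simp add: ennreal_mult[symmetric])
  finally show ?thesis using V_nonneg l_pos by (simp add: ennreal_le_iff)
qed

text \<open>Up to points without mass the interval is a union of partition intervals, and their
  masses do not depend on the stage.\<close>

lemma r_P_interval:
  assumes c: "0 \<le> c" "c \<notin> (\<Union>i\<in>P. interior i)" and d: "d \<le> 1" "d \<notin> (\<Union>i\<in>P. interior i)"
  shows "r n {c..d} = r 0 {c..d}"
proof -
  have sub: "{c..d} \<subseteq> {0..1}" using c d by auto
  have tile: "csum {c..d} (\<lambda>x. ennreal (w ((T ^^ n) x)))
     = csum {i\<in>P. i \<subseteq> {c..d}} (\<lambda>\<alpha>. csum \<alpha> (\<lambda>x. ennreal (w ((T ^^ n) x))))" for n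
  proof (rule csum_w_tiling[OF sub])
    fix x assume x: "x \<in> {c..d}" "gen x"
    then obtain i where i: "i \<in> P" "x \<in> interior i" using gen_P by blast
    have "i \<subseteq> {c..d}" using P_sub_interval[OF i] x c d i(1) by auto
    then show "\<exists>!\<alpha>. \<alpha> \<in> {i\<in>P. i \<subseteq> {c..d}} \<and> x \<in> \<alpha>"
      using gen_P_unique[OF x(2)] i interior_subset by blast
  qed auto
  have eq: "csum {c..d} (\<lambda>x. ennreal (w ((T ^^ n) x))) = ennreal (l ^ n) * csum {i\<in>P. i \<subseteq> {c..d}} (\<lambda>\<alpha>. ennreal (v \<alpha>))" for n
    unfolding csum_cmult[symmetric] tile using l_pos v_pos by (intro csum_cong) (simp add: csum_w_P ennreal_mult less_imp_le)
  have "ennreal (l ^ n) * ennreal (1 / l ^ n) = 1" for n using l_pos by (simp add: ennreal_mult[symmetric])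
  then have "ennreal (r n {c..d}) = csum {i\<in>P. i \<subseteq> {c..d}} (\<lambda>\<alpha>. ennreal (v \<alpha>))" for n
    unfolding ennreal_r[OF sub] eq by (metis (no_types, lifting) mult.assoc mult.commute mult.right_neutral)
  then have "ennreal (r n {c..d}) = ennreal (r 0 {c..d})" by metis
  then show ?thesis using r_nonneg by simp
qed

text \<open>Cuts at lap ends are stable only from stage 1 on: one step of conformality turns each
  lap into an interval to which \<open>r_P_interval\<close> applies.\<close>

lemma r_L_interval:
  assumes d: "0 \<le> d" "d \<le> 1" "d \<notin> (\<Union>U\<in>L. interior U)"
  shows "r (Suc n) {0..d} = r (Suc 0) {0..d}"
proof -
  have sub: "{0..d} \<subseteq> {0..1}" using d by auto
  have tile: "csum {0..d} (\<lambda>x. ennreal (w ((T ^^ n) x)))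
     = csum {U\<in>L. U \<subseteq> {0..d}} (\<lambda>U. csum U (\<lambda>x. ennreal (w ((T ^^ n) x))))" for n
  proof (rule csum_w_tiling[OF sub])
    fix x assume x: "x \<in> {0..d}" "gen x"
    then obtain U where U: "U \<in> L" "x \<in> interior U" using gen_L by blast
    obtain a b where ab: "a < b" "U = {a..b}" using L_ivl[OF U(1)] by blast
    have "d \<notin> {a<..<b}" using d(3) U(1) ab by (auto simp: interior_atLeastAtMost_real)
    then have "U \<subseteq> {0..d}" using L_sub01[OF U(1)] U(2) x(1) ab by (auto simp: interior_atLeastAtMost_real)
    then show "\<exists>!\<alpha>. \<alpha> \<in> {U\<in>L. U \<subseteq> {0..d}} \<and> x \<in> \<alpha>"
      using gen_L_unique[OF x(2)] U interior_subset by blast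
  qed auto
  have U: "csum U (\<lambda>x. ennreal (w ((T ^^ Suc n) x))) * ennreal (1 / l ^ Suc n) = ennreal (r (Suc 0) U)" if U: "U \<in> L" for U n
  proof -
    obtain a b where ab: "a < b" "U = {a..b}" using L_ivl[OF U] by blast
    have U01: "U \<subseteq> {0..1}" by (rule L_sub01[OF U])
    have im: "T ` U = closed_segment (T a) (T b)" using T_image_L[of a b a b] U ab by auto
    have "a \<in> {0..1}" "b \<in> {0..1}" using U01 ab by auto
    then have Tab: "T a \<in> {0..1}" "T b \<in> {0..1}" by (blast intro: T_in)+
    have en: "T a \<notin> (\<Union>i\<in>P. interior i)" "T b \<notin> (\<Union>i\<in>P. interior i)" using L_ends[of a b] U ab by auto
    have "r n (T ` U) = r 0 (T ` U)"
      unfolding im closed_segment_eq_real_ivl using r_P_interval[of "T a" "T b" n] r_P_interval[of "T b" "T a" n] Tab en by auto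
    then have "r (Suc n) U = r (Suc 0) U" using r_Suc_inj[OF U01 L_inj[OF U]] by simp
    then show ?thesis by (simp only: ennreal_r[OF U01, symmetric])
  qed
  have "ennreal (r (Suc n) {0..d}) = csum {U\<in>L. U \<subseteq> {0..d}} (\<lambda>U. ennreal (r (Suc 0) U))" for n
    unfolding ennreal_r[OF sub] tile csum_multc[symmetric, where c = "ennreal (1 / l ^ Suc n)" and A = "{U\<in>L. U \<subseteq> {0..d}}"]
    by (intro csum_cong U) simp
  then have "ennreal (r (Suc n) {0..d}) = ennreal (r (Suc 0) {0..d})" by metis
  then show ?thesis using r_nonneg by simp
qed

section \<open>Distribution functions and their limit\<close>

definition "h n x = r n {0..x} - r n {x} / 2"

lemma h_diff:
  assumes "0 \<le> p" "p \<le> q" "q \<le> 1"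
  shows "h n q - h n p = r n {p..q} - (r n {p} + r n {q}) / 2"
proof -
  have e: "{0..q} = {0..p} \<union> {p<..q}" "{p..q} = {p} \<union> {p<..q}" using assms by auto
  have "r n {0..q} = r n {0..p} + r n {p<..q}" unfolding e(1) using assms by (intro r_Un) auto
  moreover have "r n {p..q} = r n {p} + r n {p<..q}" unfolding e(2) using assms by (intro r_Un) auto
  ultimately have "r n {0..q} = r n {0..p} + r n {p..q} - r n {p}" by linarith
  then show ?thesis by (simp add: h_def field_simps)
qed

lemma h_mono:
  assumes "0 \<le> p" "p \<le> q" "q \<le> 1" shows "h n p \<le> h n q"
proof (cases "p = q")
  case False
  have "r n {p} + r n {q} = r n ({p} \<union> {q})" using assms False by (intro r_Un[symmetric]) auto
  also have "\<dots> \<le> r n {p..q}" using assms by (intro r_mono) auto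
  finally show ?thesis using h_diff[OF assms, of n] r_nonneg[of n "{p}"] r_nonneg[of n "{q}"] by argo
qed simp

lemma h_conformal:
  assumes U: "U \<in> L" and pq: "p \<in> U" "q \<in> U" "p \<le> q"
  shows "h (Suc n) q - h (Suc n) p = \<bar>h n (T q) - h n (T p)\<bar> / l"
proof -
  obtain a b where ab: "a < b" "U = {a..b}" using L_ivl[OF U] by blast
  have U01: "U \<subseteq> {0..1}" by (rule L_sub01[OF U])
  have p01: "p \<in> {0..1}" and q01: "q \<in> {0..1}" using pq U01 by blast+
  have T01: "T p \<in> {0..1}" "T q \<in> {0..1}" using p01 q01 T_in by blast+
  have sub: "{p..q} \<subseteq> U" using pq ab by auto
  have inj: "inj_on T {p..q}" "inj_on T {p}" "inj_on T {q}" using inj_on_subset[OF L_inj[OF U] sub] by auto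
  have im: "T ` {p..q} = closed_segment (T p) (T q)" using T_image_L[of a b p q] U ab pq by auto
  have "h (Suc n) q - h (Suc n) p = r (Suc n) {p..q} - (r (Suc n) {p} + r (Suc n) {q}) / 2"
    using p01 q01 pq(3) by (intro h_diff) auto
  also have "\<dots> = (1 / l) * (r n (T ` {p..q}) - (r n {T p} + r n {T q}) / 2)"
    using r_Suc_inj[OF subset_trans[OF sub U01] inj(1), of n] r_Suc_inj[OF _ inj(2), of n] r_Suc_inj[OF _ inj(3), of n] p01 q01 l_pos
    by (simp add: field_simps)
  also have "r n (T ` {p..q}) - (r n {T p} + r n {T q}) / 2 = \<bar>h n (T q) - h n (T p)\<bar>"
  proof (cases "T p \<le> T q")
    case True
    then show ?thesis unfolding im closed_segment_eq_real_ivl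
      using h_diff[of "T p" "T q" n] h_mono[of "T p" "T q" n] T01 by auto
  next
    case False
    then show ?thesis unfolding im closed_segment_eq_real_ivl
      using h_diff[of "T q" "T p" n] h_mono[of "T q" "T p" n] T01 by auto
  qed
  finally show ?thesis by simp
qed

lemma h_D:
  assumes "d \<in> {0..1}" "d \<notin> (\<Union>i\<in>P. interior i)" shows "h n d = h 0 d"
proof -
  have "\<not> gen d" using gen_P assms(2) by blast
  moreover have "0 \<notin> (\<Union>i\<in>P. interior i)" using P_interior_sub by force
  ultimately show ?thesis using r_P_interval[of 0 d n] assms by (simp add: h_def r_nongen)
qed

lemma h_DL:
  assumes "d \<in> {0..1}" "d \<notin> (\<Union>U\<in>L. interior U)" shows "h (Suc n) d = h (Suc 0) d"
proof -
  have "\<not> gen d" using gen_L assms(2) by blast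
  then show ?thesis using r_L_interval[of d n] assms by (simp add: h_def r_nongen)
qed

lemma h_bounds: assumes "x \<in> {0..1}" shows "0 \<le> h n x" "h n x \<le> V"
proof -
  have "r n {x} \<le> r n {0..x}" "r n {0..x} \<le> r n {0..1}" using assms by (intro r_mono; auto)+
  then show "0 \<le> h n x" "h n x \<le> V" using r_nonneg[of n "{x}"] by (auto simp: h_def r_total)
qed

text \<open>Both stages agree at the left end of the lap of x and at its image. Conformality
  transfers the discrepancy at T x to x with a factor 1 / l, gained once per induction step. The
  base case only uses that values lie between 0 and V.\<close>

lemma h_Cauchy:
  assumes "x \<in> {0..1}" "k \<le> n" "k \<le> m" shows "\<bar>h n x - h m x\<bar> \<le> V / l ^ k"
  using assms
proof (induction k arbitrary: n m x)
  case 0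
  then show ?case using h_bounds[OF 0(1), of n] h_bounds[OF 0(1), of m] by auto
next
  case (Suc k)
  obtain n' m' where nm: "n = Suc n'" "m = Suc m'" using Suc.prems by (metis Suc_le_D)
  show ?case
  proof (cases "x \<in> (\<Union>U\<in>L. interior U)")
    case False
    have "h n x = h m x" unfolding nm using h_DL[OF Suc.prems(1) False] by metis
    then show ?thesis using V_nonneg l_pos by simp
  next
    case True
    then obtain U where U: "U \<in> L" "x \<in> interior U" by blast
    obtain a b where ab: "a < b" "U = {a..b}" using L_ivl[OF U(1)] by blast
    have x: "x \<in> U" "a \<in> U" "a \<le> x" using U(2) ab by (auto simp: interior_atLeastAtMost_real)
    have a01: "a \<in> {0..1}" using x(2) L_sub01[OF U(1)] by blast
    have T01: "T x \<in> {0..1}" "T a \<in> {0..1}" using a01 Suc.prems(1) T_in by blast+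
    have "a \<notin> interior W" if "W \<in> L" for W
    proof
      assume "a \<in> interior W"
      then have "W = U" using L_unique[OF U(1) that x(2)] by blast
      then show False using \<open>a \<in> interior W\<close> ab by (simp add: interior_atLeastAtMost_real)
    qed
    then have ha: "h n a = h m a" unfolding nm using h_DL[OF a01] by (metis UN_E)
    have Ta: "h n' (T a) = h m' (T a)" using h_D[OF T01(2)] L_ends[of a b] U(1) ab by metis
    have IH: "\<bar>h n' (T x) - h m' (T x)\<bar> \<le> V / l ^ k" using Suc.IH[OF T01(1)] Suc.prems nm by auto
    have "h n x - h m x = (\<bar>h n' (T x) - h n' (T a)\<bar> - \<bar>h m' (T x) - h m' (T a)\<bar>) / l"
      using h_conformal[OF U(1) x(2,1,3), of n'] h_conformal[OF U(1) x(2,1,3), of m'] ha nm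
      by (simp add: diff_divide_distrib)
    then have "\<bar>h n x - h m x\<bar> = \<bar>\<bar>h n' (T x) - h n' (T a)\<bar> - \<bar>h m' (T x) - h m' (T a)\<bar>\<bar> / l" using l_pos by simp
    also have "\<dots> \<le> (V / l ^ k) / l" using IH Ta l_pos by (intro divide_right_mono) linarith+
    finally show ?thesis by (simp add: mult.commute)
  qed
qed

lemma inv_l_pow_tendsto: "(\<lambda>n. c / l ^ n) \<longlonglongrightarrow> 0"
  using LIMSEQ_divide_realpow_zero[OF l_gt_1] .

definition "\<psi> x = lim (\<lambda>n. h n x)"

lemma h_tendsto: assumes x: "x \<in> {0..1}" shows "(\<lambda>n. h n x) \<longlonglongrightarrow> \<psi> x"
proof -
  have "Cauchy (\<lambda>n. h n x)"
  proof (rule CauchyI)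
    fix e :: real assume "0 < e"
    then have "eventually (\<lambda>k. V / l ^ k < e) sequentially" using inv_l_pow_tendsto[of V] by (intro order_tendstoD) auto
    then obtain k where k: "V / l ^ k < e" by (auto simp: eventually_sequentially)
    have "norm (h m x - h n x) < e" if "m \<ge> k" "n \<ge> k" for m n
      using h_Cauchy[OF x that] k by simp
    then show "\<exists>M. \<forall>m\<ge>M. \<forall>n\<ge>M. norm (h m x - h n x) < e" by blast
  qed
  then show ?thesis unfolding \<psi>_def by (simp add: Cauchy_convergent convergent_LIMSEQ_iff[symmetric])
qed

lemma \<psi>_approx: assumes x: "x \<in> {0..1}" shows "\<bar>h n x - \<psi> x\<bar> \<le> V / l ^ n"
proof -
  have "(\<lambda>m. \<bar>h n x - h m x\<bar>) \<longlonglongrightarrow> \<bar>h n x - \<psi> x\<bar>" by (intro tendsto_intros h_tendsto x)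
  then show ?thesis
    by (rule tendsto_upperbound) (use h_Cauchy[OF x, of n n] in \<open>auto simp: eventually_sequentially\<close>)
qed

lemma \<psi>_mono: "0 \<le> p \<Longrightarrow> p \<le> q \<Longrightarrow> q \<le> 1 \<Longrightarrow> \<psi> p \<le> \<psi> q"
  by (rule LIMSEQ_le[OF h_tendsto h_tendsto]) (auto intro: h_mono)

lemma \<psi>_conformal:
  assumes U: "U \<in> L" and pq: "p \<in> U" "q \<in> U" "p \<le> q"
  shows "\<psi> q - \<psi> p = \<bar>\<psi> (T q) - \<psi> (T p)\<bar> / l"
proof -
  have 01: "p \<in> {0..1}" "q \<in> {0..1}" using L_sub01[OF U] pq by blast+
  then have T01: "T p \<in> {0..1}" "T q \<in> {0..1}" using T_in by blast+
  have "(\<lambda>n. h (Suc n) q - h (Suc n) p) \<longlonglongrightarrow> \<psi> q - \<psi> p"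
    by (intro tendsto_diff LIMSEQ_Suc h_tendsto 01)
  moreover have "(\<lambda>n. \<bar>h n (T q) - h n (T p)\<bar> / l) \<longlonglongrightarrow> \<bar>\<psi> (T q) - \<psi> (T p)\<bar> / l"
    using l_pos by (intro tendsto_intros h_tendsto T01) auto
  ultimately show ?thesis using h_conformal[OF assms] LIMSEQ_unique by simp
qed

lemma \<psi>_0: "\<psi> 0 = 0" and \<psi>_1: "\<psi> 1 = V"
proof -
  have "0 \<notin> (\<Union>i\<in>P. interior i)" "1 \<notin> (\<Union>i\<in>P. interior i)" using P_interior_sub by force+
  then have "\<not> gen 0" "\<not> gen 1" using gen_P by blast+
  then have "h n 0 = 0" "h n 1 = V" for n using r_nongen[of 0 n] r_nongen[of 1 n] by (auto simp: h_def r_total)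
  then show "\<psi> 0 = 0" "\<psi> 1 = V" using h_tendsto[of 0] h_tendsto[of 1] by (auto simp: LIMSEQ_const_iff)
qed

text \<open>\<open>h n\<close> need not be continuous, but near x its oscillation is controlled by
  the atom at x, of mass at most V / l ^ n.\<close>

lemma \<psi>_cont: "continuous_on {0..1} \<psi>"
  unfolding continuous_on_iff
proof (intro ballI allI impI)
  fix x e :: real assume x: "x \<in> {0..1}" and e: "0 < e"
  \<comment> \<open>One V / l ^ n pays for the atom at x, two for replacing \<open>\<psi>\<close> by
    \<open>h n\<close> at both points.\<close>
  have "eventually (\<lambda>n. 3 * V / l ^ n < e / 2) sequentially"
    using inv_l_pow_tendsto[of "3 * V"] e by (intro order_tendstoD) auto
  then obtain n where n: "3 * V / l ^ n < e / 2" by (auto simp: eventually_sequentially)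
  define B where "B k = {x - inverse (real (Suc k))..x + inverse (real (Suc k))} \<inter> {0..1}" for k
  have dec: "decseq B"
  proof (rule decseq_SucI)
    fix k
    have "inverse (real (Suc (Suc k))) \<le> inverse (real (Suc k))" by (simp add: field_simps)
    then show "B (Suc k) \<subseteq> B k" unfolding B_def by (intro Int_mono) (simp_all del: of_nat_Suc)
  qed
  have int: "(\<Inter>k. B k) = {x}"
  proof
    show "(\<Inter>k. B k) \<subseteq> {x}"
    proof
      fix y assume y: "y \<in> (\<Inter>k. B k)"
      have "\<bar>y - x\<bar> \<le> inverse (real (Suc k))" for k
      proof -
        have "y \<in> B k" using y by blast
        then show ?thesis unfolding B_def by (simp add: abs_le_iff del: of_nat_Suc)
      qed
      then have "\<bar>y - x\<bar> \<le> 0" by (intro LIMSEQ_le_const[OF LIMSEQ_inverse_real_of_nat]) auto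
      then show "y \<in> {x}" by simp
    qed
  qed (use x in \<open>auto simp: B_def\<close>)
  have "(\<lambda>k. r n (B k)) \<longlonglongrightarrow> r n {x}"
    unfolding r_def int[symmetric]
  proof (rule finite_measure.finite_Lim_measure_decseq[OF finite_\<mu> _ dec])
    show "range B \<subseteq> sets (\<mu> n)" by (auto simp: B_def)
  qed
  then have "eventually (\<lambda>k. r n (B k) < r n {x} + e / 2) sequentially" using e by (intro order_tendstoD) auto
  then obtain k where k: "r n (B k) < r n {x} + e / 2" by (auto simp: eventually_sequentially)
  have small: "r n (B k) < e / 2 + V / l ^ n" using k r_single_le[OF x, of n] by linarith
  show "\<exists>d>0. \<forall>x'\<in>{0..1}. dist x' x < d \<longrightarrow> dist (\<psi> x') (\<psi> x) < e"
  proof (intro exI conjI ballI impI)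
    show "0 < inverse (real (Suc k))" by simp
    fix y assume y: "y \<in> {0..1}" "dist y x < inverse (real (Suc k))"
    have bound: "h n q - h n p \<le> r n (B k)" if "0 \<le> p" "p \<le> q" "q \<le> 1" "{p..q} \<subseteq> B k" for p q
    proof -
      have "h n q - h n p \<le> r n {p..q}" using h_diff[OF that(1-3), of n] r_nonneg[of n "{p}"] r_nonneg[of n "{q}"] by (simp add: field_simps)
      also have "\<dots> \<le> r n (B k)" using that(4) by (intro r_mono) (auto simp: B_def)
      finally show ?thesis .
    qed
    have "\<bar>h n y - h n x\<bar> \<le> r n (B k)"
    proof (cases "x \<le> y")
      case True
      have "{x..y} \<subseteq> B k" using x y by (auto simp: B_def dist_real_def)
      then show ?thesis using bound[of x y] h_mono[of x y n] x y True by auto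
    next
      case False
      have "{y..x} \<subseteq> B k" using x y by (auto simp: B_def dist_real_def)
      then show ?thesis using bound[of y x] h_mono[of y x n] x y False by auto
    qed
    then have "\<bar>\<psi> y - \<psi> x\<bar> \<le> r n (B k) + 2 * (V / l ^ n)"
      using \<psi>_approx[OF x, of n] \<psi>_approx[OF y(1), of n] by linarith
    also have "\<dots> < e"
    proof -
      have "3 * (V / l ^ n) < e / 2" using n by simp
      then show ?thesis using small by linarith
    qed
    finally show "dist (\<psi> y) (\<psi> x) < e" by (simp add: dist_real_def)
  qed
qed

text \<open>\<open>\<psi>\<close> gains mass on some compact interval of the open unit interval. An
  iterate of (p, q) covers that interval and expands mass at most by l ^ N, so (p, q) carries mass
  as well.\<close>

lemma \<psi>_strict:
  assumes pq: "0 \<le> p" "p < q" "q \<le> 1" shows "\<psi> p < \<psi> q"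
proof -
  \<comment> \<open>Continuity at 0 and 1 provides points with values on the two sides of V /
    2.\<close>
  obtain a b where ab: "0 < a" "b < 1" "a \<le> b" "\<psi> a < \<psi> b"
  proof -
    obtain a where a: "0 < a" "a < 1/2" "\<psi> a < V / 2"
    proof -
      obtain d where d: "d > 0" "\<And>x. x \<in> {0..1} \<Longrightarrow> dist x 0 < d \<Longrightarrow> dist (\<psi> x) (\<psi> 0) < V / 2"
        using \<psi>_cont V_pos unfolding continuous_on_iff by (metis atLeastAtMost_iff half_gt_zero order_refl zero_le_one)
      have "dist (\<psi> (min (d/2) (1/4))) (\<psi> 0) < V / 2" using d(1) by (intro d(2)) (auto simp: dist_real_def min_def)
      then show ?thesis using d(1) by (intro that[of "min (d/2) (1/4)"]) (auto simp: dist_real_def \<psi>_0 min_def split: if_splits)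
    qed
    obtain b where b: "b < 1" "1/2 < b" "V / 2 < \<psi> b"
    proof -
      obtain d where d: "d > 0" "\<And>x. x \<in> {0..1} \<Longrightarrow> dist x 1 < d \<Longrightarrow> dist (\<psi> x) (\<psi> 1) < V / 2"
        using \<psi>_cont V_pos unfolding continuous_on_iff by (metis atLeastAtMost_iff half_gt_zero order_refl zero_le_one)
      have "dist (\<psi> (max (1 - d/2) (3/4))) (\<psi> 1) < V / 2" using d(1) by (intro d(2)) (auto simp: dist_real_def max_def)
      then have "V / 2 < \<psi> (max (1 - d/2) (3/4))" unfolding dist_real_def \<psi>_1 by linarith
      moreover have "1/2 < max (1 - d/2) (3/4)" "max (1 - d/2) (3/4) < 1" using d(1) by (simp_all add: less_max_iff_disj)
      ultimately show ?thesis using that by blast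
    qed
    show ?thesis using a b by (intro that[of a b]) auto
  qed
  obtain N where N: "{a..b} \<subseteq> (T ^^ N) ` {p<..<q}" using mixing_covers[OF pq ab(1,2)] by blast
  have le: "h n b - h n a \<le> l ^ N * (h (n + N) q - h (n + N) p)" for n
  proof -
    have "h n b - h n a \<le> r n {a..b}"
      using h_diff[of a b n] ab r_nonneg[of n "{a}"] r_nonneg[of n "{b}"] by simp
    also have "\<dots> \<le> l ^ N * r (n + N) {p<..<q}" using pq by (intro r_image_le N) auto
    also have "r (n + N) {p<..<q} \<le> h (n + N) q - h (n + N) p"
    proof -
      have "{p..q} = ({p} \<union> {p<..<q}) \<union> {q}" using pq by auto
      moreover have "r (n + N) ({p} \<union> {p<..<q} \<union> {q}) = r (n + N) ({p} \<union> {p<..<q}) + r (n + N) {q}" using pq by (intro r_Un) auto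
      moreover have "r (n + N) ({p} \<union> {p<..<q}) = r (n + N) {p} + r (n + N) {p<..<q}" using pq by (intro r_Un) auto
      ultimately show ?thesis using h_diff[of p q "n + N"] pq r_nonneg[of "n + N" "{p}"] r_nonneg[of "n + N" "{q}"] by (simp add: field_simps)
    qed
    finally show ?thesis using l_pos by simp
  qed
  have "(\<lambda>n. h n b - h n a) \<longlonglongrightarrow> \<psi> b - \<psi> a" using ab by (intro tendsto_diff h_tendsto) auto
  moreover have "(\<lambda>n. l ^ N * (h (n + N) q - h (n + N) p)) \<longlonglongrightarrow> l ^ N * (\<psi> q - \<psi> p)"
    using pq by (intro tendsto_intros LIMSEQ_ignore_initial_segment h_tendsto) auto
  ultimately have "\<psi> b - \<psi> a \<le> l ^ N * (\<psi> q - \<psi> p)" using le by (intro LIMSEQ_le) auto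
  then have "0 < l ^ N * (\<psi> q - \<psi> p)" using ab by linarith
  then show ?thesis using l_pos by (simp add: zero_less_mult_iff)
qed

text \<open>A continuous injective map of an interval has one direction, so the absolute value in
  \<open>\<psi>_conformal\<close> is resolved by the same sign on the whole lap.\<close>

lemma \<psi>_slope:
  assumes U: "U \<in> L"
  shows "\<exists>s. \<bar>s\<bar> = l \<and> (\<forall>p\<in>U. \<forall>q\<in>U. \<psi> (T q) - \<psi> (T p) = s * (\<psi> q - \<psi> p))"
proof -
  obtain a b where ab: "a < b" "U = {a..b}" using L_ivl[OF U] by blast
  have U01: "U \<subseteq> {0..1}" by (rule L_sub01[OF U])
  have cont: "continuous_on U T" using continuous_on_subset[OF T_cont U01] .
  have "strict_mono_on U T \<or> strict_antimono_on U T"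
    using injective_eq_monotone_map[OF _ cont] L_inj[OF U] ab by (simp add: is_interval_cc)
  then have dir: "(\<forall>p\<in>U. \<forall>q\<in>U. p \<le> q \<longrightarrow> T p \<le> T q) \<or> (\<forall>p\<in>U. \<forall>q\<in>U. p \<le> q \<longrightarrow> T q \<le> T p)"
    unfolding monotone_on_def by (metis order_le_less)
  have T01: "T p \<in> {0..1}" if "p \<in> U" for p using that U01 T_in by blast
  from dir show ?thesis
  proof
    assume d: "\<forall>p\<in>U. \<forall>q\<in>U. p \<le> q \<longrightarrow> T p \<le> T q"
    have *: "\<psi> (T q) - \<psi> (T p) = l * (\<psi> q - \<psi> p)" if "p \<in> U" "q \<in> U" "p \<le> q" for p q
    proof -
      have "\<psi> (T p) \<le> \<psi> (T q)" using d that T01[of p] T01[of q] by (intro \<psi>_mono) auto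
      then show ?thesis using \<psi>_conformal[OF U that] l_pos by (simp add: field_simps)
    qed
    have "\<psi> (T q) - \<psi> (T p) = l * (\<psi> q - \<psi> p)" if "p \<in> U" "q \<in> U" for p q
      using *[OF that] *[OF that(2,1)] by (cases "p \<le> q") (auto simp: algebra_simps)
    then show ?thesis using l_pos by (intro exI[of _ l]) auto
  next
    assume d: "\<forall>p\<in>U. \<forall>q\<in>U. p \<le> q \<longrightarrow> T q \<le> T p"
    have *: "\<psi> (T q) - \<psi> (T p) = - l * (\<psi> q - \<psi> p)" if "p \<in> U" "q \<in> U" "p \<le> q" for p q
    proof -
      have "\<psi> (T q) \<le> \<psi> (T p)" using d that T01[of p] T01[of q] by (intro \<psi>_mono) auto
      then show ?thesis using \<psi>_conformal[OF U that] l_pos by (simp add: field_simps)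
    qed
    have "\<psi> (T q) - \<psi> (T p) = - l * (\<psi> q - \<psi> p)" if "p \<in> U" "q \<in> U" for p q
      using *[OF that] *[OF that(2,1)] by (cases "p \<le> q") (auto simp: algebra_simps)
    then show ?thesis using l_pos by (intro exI[of _ "- l"]) auto
  qed
qed

text \<open>Division by V normalises the range. The conjugate map is affine on the image of each
  lap, so exceptional points come only from the countable set outside lap interiors.\<close>

theorem conjugate_constant_slope: "\<exists>g. constant_slope g l \<and> topologically_conjugate {0..1} T {0..1} g"
proof -
  define f where "f x = \<psi> x / V" for x
  have f_less: "f p < f q" if "0 \<le> p" "p < q" "q \<le> 1" for p q
    using \<psi>_strict[OF that] V_pos by (simp add: f_def divide_strict_right_mono)
  have f_cont: "continuous_on {0..1} f" unfolding f_def using V_pos by (intro continuous_intros \<psi>_cont) auto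
  have inj: "inj_on f {0..1}" by (rule linorder_inj_onI) (auto dest: f_less)
  have "f ` {0..1} = closed_segment (f 0) (f 1)" by (rule image_closed_interval_inj[OF f_cont inj]) simp
  then have im: "f ` {0..1} = {0..1}" using V_pos by (simp add: f_def \<psi>_0 \<psi>_1 closed_segment_eq_real_ivl)
  obtain \<phi> where hom: "homeomorphism {0..1} {0..1} f \<phi>"
    using homeomorphism_compact[OF compact_Icc f_cont im inj] by blast
  have \<phi>f: "\<phi> (f x) = x" if "x \<in> {0..1}" for x using homeomorphism_apply1[OF hom that] .
  have f\<phi>: "f (\<phi> y) = y" if "y \<in> {0..1}" for y using homeomorphism_apply2[OF hom that] .
  have \<phi>01: "\<phi> y \<in> {0..1}" if "y \<in> {0..1}" for y using hom that unfolding homeomorphism_def by blast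
  have f01: "f x \<in> {0..1}" if "x \<in> {0..1}" for x using im that by blast
  define g where "g y = f (T (\<phi> y))" for y
  have "continuous_on {0..1} g"
    unfolding g_def
    by (rule continuous_on_compose2[OF f_cont continuous_on_compose2[OF T_cont homeomorphism_cont2[OF hom]]])
      (use \<phi>01 T_in in blast)+
  then have gmap: "interval_map g" unfolding interval_map_def g_def using f01 T_in \<phi>01 by blast
  have "\<exists>d. (g has_real_derivative d) (at y within {0..1}) \<and> \<bar>d\<bar> = l"
    if y: "y \<in> {0..1} - f ` ({0..1} - (\<Union>U\<in>L. interior U))" for y
  proof -
    define x where "x = \<phi> y"
    have x01: "x \<in> {0..1}" and fx: "f x = y" using y \<phi>01 f\<phi> by (auto simp: x_def)
    then obtain U where U: "U \<in> L" "x \<in> interior U" using y by blast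
    obtain a b where ab: "a < b" "U = {a..b}" using L_ivl[OF U(1)] by blast
    have x: "a < x" "x < b" using U(2) ab by (auto simp: interior_atLeastAtMost_real)
    have U01: "U \<subseteq> {0..1}" by (rule L_sub01[OF U(1)])
    have ab01: "0 \<le> a" "b \<le> 1" using U01 ab by auto
    obtain s where s: "\<bar>s\<bar> = l" "\<And>p q. p \<in> U \<Longrightarrow> q \<in> U \<Longrightarrow> \<psi> (T q) - \<psi> (T p) = s * (\<psi> q - \<psi> p)"
      using \<psi>_slope[OF U(1)] by blast
    \<comment> \<open>Within distance \<open>d\<close> of y the points stay in the image of the lap,
      where the affine formula holds.\<close>
    define d where "d = min (y - f a) (f b - y)"
    have d: "d > 0" unfolding d_def fx[symmetric] using f_less[of a x] f_less[of x b] x ab01 by auto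
    have eq: "g y + s * (y' - y) = g y'" if y': "y' \<in> {0..1}" "dist y' y < d" for y'
    proof -
      have x'01: "\<phi> y' \<in> {0..1}" using \<phi>01 y'(1) .
      have "f a < y'" "y' < f b" using y'(2) unfolding d_def dist_real_def by (auto simp: abs_less_iff)
      then have "f a < f (\<phi> y')" "f (\<phi> y') < f b" using f\<phi>[OF y'(1)] by auto
      then have "a \<le> \<phi> y'" "\<phi> y' \<le> b"
        using f_less[of "\<phi> y'" a] f_less[of b "\<phi> y'"] x'01 ab01 ab(1) by force+
      then have "\<phi> y' \<in> U" "x \<in> U" using ab x by auto
      from s(2)[OF this(2,1)] have "(\<psi> (T (\<phi> y')) - \<psi> (T x)) / V = s * (\<psi> (\<phi> y') - \<psi> x) / V" by simp
      then have "f (T (\<phi> y')) - f (T x) = s * (f (\<phi> y') - f x)" by (simp add: f_def diff_divide_distrib right_diff_distrib)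
      then show ?thesis using fx f\<phi>[OF y'(1)] by (simp add: g_def x_def)
    qed
    have "((\<lambda>y'. g y + s * (y' - y)) has_real_derivative s) (at y within {0..1})"
      by (auto intro!: derivative_eq_intros)
    then have "(g has_real_derivative s) (at y within {0..1})"
      by (rule has_field_derivative_transform_within[OF _ d]) (use y eq in auto)
    then show ?thesis using s(1) by blast
  qed
  moreover have "countable (f ` ({0..1} - (\<Union>U\<in>L. interior U)))" using L_cover by (rule countable_image)
  ultimately have "constant_slope g l" unfolding constant_slope_def using gmap by blast
  moreover have "topologically_conjugate {0..1} T {0..1} g"
    unfolding topologically_conjugate_def using hom \<phi>f by (intro exI[of _ f] exI[of _ \<phi>]) (auto simp: g_def)
  ultimately show ?thesis by blast
qed

end

section \<open>Superharmonic vectors\<close>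

text \<open>First-step analysis. Dropping the diagonal term shows that each column of the Green
  function is superharmonic.\<close>

lemma green_eq:
  assumes P: "countable P"
  shows "green P M i j z = (if i = j then 1 else 0) + z * csum P (\<lambda>\<alpha>. ennreal (M i \<alpha>) * green P M \<alpha> j z)"
proof -
  have "green P M i j z = (\<Sum>n. mat_power P M (Suc n) i j * z ^ Suc n) + mat_power P M 0 i j"
    unfolding green_def by (subst suminf_offset[where i=1]) (auto simp: summableI)
  also have "(\<Sum>n. mat_power P M (Suc n) i j * z ^ Suc n)
      = (\<Sum>n. csum P (\<lambda>\<alpha>. z * (ennreal (M i \<alpha>) * (mat_power P M n \<alpha> j * z ^ n))))"
    unfolding mat_power_Suc_csum[OF P] csum_multc[symmetric]
    by (intro suminf_cong csum_cong) (simp add: ac_simps)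
  also have "\<dots> = z * csum P (\<lambda>\<alpha>. ennreal (M i \<alpha>) * green P M \<alpha> j z)"
    unfolding csum_suminf[symmetric] green_def csum_cmult[symmetric] ennreal_suminf_cmult[symmetric] ..
  finally show ?thesis by (simp add: add.commute)
qed

lemma superharmonic_power:
  assumes P: "countable P"
    and super: "\<And>i. i \<in> P \<Longrightarrow> z * csum P (\<lambda>\<alpha>. ennreal (M i \<alpha>) * x \<alpha>) \<le> x i" and i: "i \<in> P"
  shows "z ^ n * csum P (\<lambda>\<alpha>. mat_power P M n i \<alpha> * x \<alpha>) \<le> x i"
  using i
proof (induction n arbitrary: i)
  case 0
  have "csum P (\<lambda>\<alpha>. mat_power P M 0 i \<alpha> * x \<alpha>) = csum P (\<lambda>\<alpha>. x \<alpha> * (if \<alpha> = i then 1 else 0))"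
    by (intro csum_cong) auto
  then show ?case using csum_single[OF 0, of x] by simp
next
  case (Suc n)
  have "csum P (\<lambda>\<alpha>. mat_power P M (Suc n) i \<alpha> * x \<alpha>)
      = csum P (\<lambda>\<alpha>. csum P (\<lambda>\<beta>. ennreal (M i \<beta>) * (mat_power P M n \<beta> \<alpha> * x \<alpha>)))"
    by (simp only: mat_power_Suc_csum[OF P] csum_multc[symmetric] mult.assoc)
  also have "\<dots> = csum P (\<lambda>\<beta>. ennreal (M i \<beta>) * csum P (\<lambda>\<alpha>. mat_power P M n \<beta> \<alpha> * x \<alpha>))"
    by (subst csum_swap) (simp only: csum_cmult)
  finally have eq: "csum P (\<lambda>\<alpha>. mat_power P M (Suc n) i \<alpha> * x \<alpha>)
      = csum P (\<lambda>\<beta>. ennreal (M i \<beta>) * csum P (\<lambda>\<alpha>. mat_power P M n \<beta> \<alpha> * x \<alpha>))" .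
  have "z ^ Suc n * csum P (\<lambda>\<alpha>. mat_power P M (Suc n) i \<alpha> * x \<alpha>)
      = z * csum P (\<lambda>\<beta>. z ^ n * (ennreal (M i \<beta>) * csum P (\<lambda>\<alpha>. mat_power P M n \<beta> \<alpha> * x \<alpha>)))"
    by (simp only: eq csum_cmult power_Suc mult.assoc)
  also have "\<dots> = z * csum P (\<lambda>\<beta>. ennreal (M i \<beta>) * (z ^ n * csum P (\<lambda>\<alpha>. mat_power P M n \<beta> \<alpha> * x \<alpha>)))"
    by (simp only: mult.left_commute)
  also have "\<dots> \<le> z * csum P (\<lambda>\<beta>. ennreal (M i \<beta>) * x \<beta>)"
    by (intro mult_left_mono csum_mono Suc.IH) auto
  also have "\<dots> \<le> x i" by (rule super[OF Suc.prems])
  finally show ?case .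
qed

text \<open>A vector that is superharmonic for \<open>c * M\<close> and summable over \<open>P'\<close> dominates a summable one, namely
  the potential \<open>u\<close> of the charge \<open>w\<close> that \<open>M\<close> leaves on \<open>P'\<close>. Raising the weight \<open>c\<close> above \<open>1\<close> only
  helps: if \<open>u = w + A\<close>, \<open>v = w + B\<close>, \<open>A \<le> B\<close> and \<open>c * B \<le> v\<close>, then \<open>c * A \<le> u\<close>.\<close>

lemma summable_superharmonic:
  fixes M :: "'a \<Rightarrow> 'a \<Rightarrow> real" and v :: "'a \<Rightarrow> ennreal" and l l' :: real
  assumes P: "countable P" and M: "\<And>i j. 0 \<le> M i j" and P': "P' \<subseteq> P"
    and c: "\<And>i. i \<in> P' \<Longrightarrow> 3 \<le> c i" "\<And>i. i \<notin> P' \<Longrightarrow> c i = (1::real)"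
    and l: "0 < l'" "l' < l" and col: "\<And>n j. j \<in> P \<Longrightarrow> csum P (\<lambda>i. mat_power P M n i j) \<le> ennreal (C * l' ^ n)"
    and v_fin: "\<And>i. i \<in> P \<Longrightarrow> v i < \<infinity>" and v_pos: "\<And>i. i \<in> P \<Longrightarrow> 0 < v i" and v_sum: "csum P' v < \<infinity>"
    and super: "\<And>i. i \<in> P \<Longrightarrow> ennreal (1 / l) * csum P (\<lambda>\<alpha>. ennreal (c i * M i \<alpha>) * v \<alpha>) \<le> v i"
  shows "\<exists>u. csum P u < \<infinity> \<and> (\<forall>i\<in>P'. 0 < u i) \<and>
    (\<forall>i\<in>P. ennreal (1 / l) * csum P (\<lambda>\<alpha>. ennreal (c i * M i \<alpha>) * u \<alpha>) \<le> u i)"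
proof -
  define z where "z = ennreal (1 / l)"
  have l0: "0 < l" using l by simp
  define S where "S x i = z * csum P (\<lambda>\<alpha>. ennreal (M i \<alpha>) * x \<alpha>)" for x and i
  have S_mono: "S x i \<le> S y i" if "\<And>\<alpha>. \<alpha> \<in> P \<Longrightarrow> x \<alpha> \<le> y \<alpha>" for x y i
    unfolding S_def using that by (intro mult_left_mono csum_mono) auto
  have c1: "1 \<le> c i" for i using c[of i] by (cases "i \<in> P'") auto
  have cS: "z * csum P (\<lambda>\<alpha>. ennreal (c i * M i \<alpha>) * x \<alpha>) = ennreal (c i) * S x i" for x i
  proof -
    have "csum P (\<lambda>\<alpha>. ennreal (c i * M i \<alpha>) * x \<alpha>) = csum P (\<lambda>\<alpha>. ennreal (c i) * (ennreal (M i \<alpha>) * x \<alpha>))"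
      using c1[of i] M by (intro csum_cong) (simp add: ennreal_mult mult.assoc)
    also have "\<dots> = ennreal (c i) * csum P (\<lambda>\<alpha>. ennreal (M i \<alpha>) * x \<alpha>)" by (rule csum_cmult)
    finally show ?thesis by (simp only: S_def mult.left_commute)
  qed
  have cSv: "ennreal (c i) * S v i \<le> v i" if "i \<in> P" for i using super[OF that] cS unfolding z_def by metis
  have le_c: "y \<le> ennreal (c i) * y" for y i
    using mult_right_mono[of 1 "ennreal (c i)" y] c1[of i] by simp
  have Sv: "S v i \<le> v i" if "i \<in> P" for i using le_c cSv[OF that] by (rule order_trans)
  \<comment> \<open>Off \<open>P'\<close> the excess of \<open>v\<close> is discarded, so that the
    sum of \<open>v\<close> over \<open>P'\<close> bounds the total charge.\<close>
  define w where "w i = (if i \<in> P' then v i - S v i else 0)" for i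
  have wS: "w i + S v i \<le> v i" if "i \<in> P" for i
    using Sv[OF that] by (simp add: w_def diff_add_cancel_ennreal)
  \<comment> \<open>Here c i \<ge> 3 enters: 3 * S v i \<le> v i together with v i > 0 leaves a
    strict excess.\<close>
  have w_pos: "0 < w i" if i: "i \<in> P'" for i
  proof -
    have iP: "i \<in> P" using i P' by blast
    obtain a where a: "v i = ennreal a" "0 \<le> a" using v_fin[OF iP] by (cases "v i") auto
    have "S v i < \<infinity>" using Sv[OF iP] v_fin[OF iP] by (rule le_less_trans)
    then obtain b where b: "S v i = ennreal b" "0 \<le> b" by (cases "S v i") auto
    have "ennreal (c i * b) \<le> ennreal a" using cSv[OF iP] c1[of i] a b by (simp add: ennreal_mult)
    then have "c i * b \<le> a" using a by (simp add: ennreal_le_iff)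
    moreover have "3 * b \<le> c i * b" using c(1)[OF i] b by (intro mult_right_mono) auto
    moreover have "0 < a" using v_pos[OF iP] a by simp
    ultimately have "b < a" using b by linarith
    then show ?thesis using i a b by (simp add: w_def ennreal_minus)
  qed
  have w_sum: "csum P w \<le> csum P' v"
  proof -
    have "csum P w = csum P' w" by (rule nn_integral_count_space_eq) (use P' in \<open>auto simp: w_def\<close>)
    also have "\<dots> \<le> csum P' v" by (intro csum_mono) (simp add: w_def diff_le_self_ennreal)
    finally show ?thesis .
  qed
  define t where "t n i = z ^ n * csum P (\<lambda>\<alpha>. mat_power P M n i \<alpha> * w \<alpha>)" for n i
  have t0: "t 0 i = w i" if "i \<in> P" for i
  proof -
    have "csum P (\<lambda>\<alpha>. mat_power P M 0 i \<alpha> * w \<alpha>) = csum P (\<lambda>\<alpha>. w \<alpha> * (if \<alpha> = i then 1 else 0))"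
      by (intro csum_cong) auto
    then show ?thesis using csum_single[OF that, of w] by (simp add: t_def)
  qed
  have tS: "t (Suc n) i = S (t n) i" for n i
  proof -
    have "csum P (\<lambda>\<alpha>. mat_power P M (Suc n) i \<alpha> * w \<alpha>)
        = csum P (\<lambda>\<alpha>. csum P (\<lambda>\<beta>. ennreal (M i \<beta>) * (mat_power P M n \<beta> \<alpha> * w \<alpha>)))"
      by (simp only: mat_power_Suc_csum[OF P] csum_multc[symmetric] mult.assoc)
    also have "\<dots> = csum P (\<lambda>\<beta>. ennreal (M i \<beta>) * csum P (\<lambda>\<alpha>. mat_power P M n \<beta> \<alpha> * w \<alpha>))"
      by (subst csum_swap) (simp only: csum_cmult)
    finally show ?thesis
      unfolding t_def S_def by (simp add: csum_cmult[symmetric] ac_simps)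
  qed
  \<comment> \<open>The Neumann series of z M applied to the charge.\<close>
  define u where "u i = (\<Sum>n. t n i)" for i
  have u_eq: "u i = w i + S u i" if i: "i \<in> P" for i
  proof -
    have "u i = (\<Sum>n. t (Suc n) i) + t 0 i"
      unfolding u_def by (subst suminf_offset[where i=1]) (auto simp: summableI)
    also have "(\<Sum>n. t (Suc n) i) = S u i"
      unfolding tS S_def u_def by (simp add: csum_suminf ennreal_suminf_cmult[symmetric] del: ennreal_suminf_cmult)
    finally show ?thesis using t0[OF i] by (simp add: add.commute)
  qed
  \<comment> \<open>Partial sums of the potential stay below \<open>v\<close> because w + S v \<le>
    v.\<close>
  have "(\<Sum>n<N. t n i) \<le> v i" if "i \<in> P" for N i
    using that
  proof (induction N arbitrary: i)
    case (Suc N)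
    have "(\<Sum>n<Suc N. t n i) = w i + (\<Sum>n<N. S (t n) i)"
      by (subst sum.lessThan_Suc_shift) (simp add: t0[OF Suc.prems] tS)
    also have "(\<Sum>n<N. S (t n) i) = S (\<lambda>\<alpha>. \<Sum>n<N. t n \<alpha>) i"
      unfolding S_def by (simp add: sum_distrib_left nn_integral_sum)
    also have "\<dots> \<le> S v i" by (intro S_mono Suc.IH)
    finally show ?case using wS[OF Suc.prems] by (meson add_left_mono order_trans)
  qed simp
  then have uv: "u i \<le> v i" if "i \<in> P" for i
    unfolding u_def suminf_eq_SUP using that by (intro SUP_least) auto
  have "ennreal (c i) * S u i \<le> u i" if i: "i \<in> P" for i
  proof (cases "i \<in> P'")
    case False
    then show ?thesis using u_eq[OF i] c(2)[OF False] by (simp add: w_def)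
  next
    case True
    have "u i < \<infinity>" using uv[OF i] v_fin[OF i] by (rule le_less_trans)
    then obtain a where a: "u i = ennreal a" "0 \<le> a" by (cases "u i") auto
    have "w i \<le> u i" "S u i \<le> u i" using u_eq[OF i] by (metis le_iff_add add.commute)+
    then obtain b d where b: "S u i = ennreal b" "0 \<le> b" and d: "w i = ennreal d" "0 \<le> d"
      using a by (cases "S u i"; cases "w i") (auto simp: top_unique)
    obtain e where e: "v i = ennreal e" "0 \<le> e" using v_fin[OF i] by (cases "v i") auto
    obtain f where f: "S v i = ennreal f" "0 \<le> f" using Sv[OF i] e by (cases "S v i") (auto simp: top_unique)
    have "S u i \<le> S v i" by (intro S_mono uv)
    then have bf: "b \<le> f" using b f by (simp add: ennreal_le_iff)
    have "v i = w i + S v i" using True Sv[OF i] by (simp add: w_def diff_add_cancel_ennreal)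
    then have ef: "e = d + f" using e d f by (simp add: ennreal_plus[symmetric] del: ennreal_plus)
    have ab: "a = d + b" using u_eq[OF i] a b d by (simp add: ennreal_plus[symmetric] del: ennreal_plus)
    have "ennreal (c i * f) \<le> ennreal e" using cSv[OF i] c1[of i] e f by (simp add: ennreal_mult)
    then have "c i * f \<le> e" using e by (simp add: ennreal_le_iff)
    \<comment> \<open>Passing from S v to S u lowers the left side of c * S v \<le> v by c * (f -
      b), but the right side only by f - b.\<close>
    moreover have "1 * (f - b) \<le> c i * (f - b)" using c1[of i] bf by (intro mult_right_mono) auto
    ultimately have "c i * b \<le> a" unfolding ab ef by (simp add: algebra_simps)
    then show ?thesis using a b c1[of i] by (simp add: ennreal_mult[symmetric] ennreal_le_iff)
  qed
  then have 1: "\<forall>i\<in>P. z * csum P (\<lambda>\<alpha>. ennreal (c i * M i \<alpha>) * u \<alpha>) \<le> u i" by (simp only: cS) blast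
  have 2: "0 < u i" if i: "i \<in> P'" for i
  proof -
    have "i \<in> P" using i P' by blast
    then have "w i \<le> u i" using u_eq[of i] by (metis le_iff_add)
    then show ?thesis using w_pos[OF i] by simp
  qed
  \<comment> \<open>Column growth at rate \<open>l'\<close> against the factor z ^ n: the gap
    between \<open>l'\<close> and \<open>l\<close> makes the potential a geometric series.\<close>
  have C: "csum P (\<lambda>i. t n i) \<le> ennreal ((l' / l) ^ n) * (ennreal \<bar>C\<bar> * csum P' v)" for n
  proof -
    have "csum P (\<lambda>i. t n i) = z ^ n * csum P (\<lambda>\<alpha>. csum P (\<lambda>i. mat_power P M n i \<alpha>) * w \<alpha>)"
      unfolding t_def csum_cmult by (subst csum_swap) (simp add: csum_multc)
    also have "\<dots> \<le> z ^ n * csum P (\<lambda>\<alpha>. ennreal (\<bar>C\<bar> * l' ^ n) * w \<alpha>)"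
    proof (intro mult_left_mono csum_mono mult_right_mono)
      fix \<alpha> assume "\<alpha> \<in> P"
      have "C * l' ^ n \<le> \<bar>C\<bar> * l' ^ n" using l by (intro mult_right_mono) auto
      then show "csum P (\<lambda>i. mat_power P M n i \<alpha>) \<le> ennreal (\<bar>C\<bar> * l' ^ n)"
        using col[OF \<open>\<alpha> \<in> P\<close>, of n] by (meson ennreal_leI order_trans)
    qed auto
    also have "\<dots> = z ^ n * (ennreal (\<bar>C\<bar> * l' ^ n) * csum P w)" by (simp add: csum_cmult)
    also have "\<dots> \<le> z ^ n * (ennreal (\<bar>C\<bar> * l' ^ n) * csum P' v)" by (intro mult_left_mono w_sum) auto
    also have "\<dots> = ennreal ((l' / l) ^ n) * (ennreal \<bar>C\<bar> * csum P' v)"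
    proof -
      have "z ^ n * ennreal (\<bar>C\<bar> * l' ^ n) = ennreal ((l' / l) ^ n) * ennreal \<bar>C\<bar>"
        unfolding z_def using l l0 by (simp add: ennreal_power ennreal_mult[symmetric] power_divide field_simps)
      then show ?thesis by (metis mult.assoc)
    qed
    finally show ?thesis .
  qed
  have "csum P u = (\<Sum>n. csum P (t n))" unfolding u_def by (rule csum_suminf)
  also have "\<dots> \<le> (\<Sum>n. ennreal ((l' / l) ^ n) * (ennreal \<bar>C\<bar> * csum P' v))" by (intro suminf_le C) auto
  also have "\<dots> = (\<Sum>n. ennreal ((l' / l) ^ n)) * (ennreal \<bar>C\<bar> * csum P' v)" by simp
  also have "(\<Sum>n. ennreal ((l' / l) ^ n)) = ennreal (\<Sum>n. (l' / l) ^ n)"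
    using l l0 by (intro suminf_ennreal2 summable_geometric) auto
  also have "ennreal (\<Sum>n. (l' / l) ^ n) * (ennreal \<bar>C\<bar> * csum P' v) < \<infinity>"
    using v_sum by (simp add: ennreal_mult_less_top)
  finally have "csum P u < \<infinity>" .
  then show ?thesis using 1 2 unfolding z_def by (intro exI[of _ u]) auto
qed

section \<open>Entropy bounds from columns and superharmonic vectors\<close>

context markov_map
begin

text \<open>The sum of column j counts all preimages of order n of a generic point of j, wherever
  they lie.\<close>

lemma entropy_le_of_column_growth:
  assumes l: "1 \<le> l" and col: "\<And>j. j \<in> P \<Longrightarrow> \<exists>C. \<forall>n. csum P (\<lambda>i. mat_power P M n i j) \<le> ennreal (C * l ^ n)"
  shows "h_top T \<le> ereal (ln l)"
proof (rule entropy_le_of_preimage_growth[OF T l, of "{y. gen y}"])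
  fix p q :: real assume "0 \<le> p" "p < q" "q \<le> 1"
  then show "\<exists>y\<in>{y. gen y}. p < y \<and> y < q" using gen_dense[of p q "{}"] by auto
next
  fix y assume "y \<in> {y. gen y}"
  then have y: "gen y" by simp
  then obtain j where j: "j \<in> P" "y \<in> interior j" using gen_P by blast
  obtain C where C: "\<And>n. csum P (\<lambda>i. mat_power P M n i j) \<le> ennreal (C * l ^ n)" using col[OF j(1)] by blast
  have "finite {x\<in>{0..1}. (T ^^ n) x = y} \<and> real (card {x\<in>{0..1}. (T ^^ n) x = y}) \<le> \<bar>C\<bar> * l ^ n" for n
  proof -
    have "csum {0..1} (\<lambda>x. if (T ^^ n) x = y then 1 else 0) = csum P (\<lambda>i. csum i (\<lambda>x. if (T ^^ n) x = y then 1 else 0))"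
    proof (rule csum_tiling)
      fix x :: real assume x: "x \<in> {0..1}" "(if (T ^^ n) x = y then 1 else (0::ennreal)) \<noteq> 0"
      then have "gen x" using gen_back[of n x] y by (auto split: if_splits)
      then show "\<exists>!i. i \<in> P \<and> x \<in> i" by (rule gen_P_unique)
    qed (rule P_sub)
    also have "\<dots> = csum P (\<lambda>i. mat_power P M n i j)"
      by (intro csum_cong) (simp add: mat_power_count[OF _ j(1) y j(2)])
    also have "\<dots> \<le> ennreal (C * l ^ n)" by (rule C)
    also have "\<dots> \<le> ennreal (\<bar>C\<bar> * l ^ n)" using l by (intro ennreal_leI mult_right_mono) auto
    finally have le: "csum {0..1} (\<lambda>x. if (T ^^ n) x = y then 1 else 0) \<le> ennreal (\<bar>C\<bar> * l ^ n)" .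
    then have "finite {x\<in>{0..1}. (T ^^ n) x = y}"
      unfolding csum_indicator_card by (rule_tac ccontr) (simp add: top_unique)
    then show ?thesis using le l unfolding csum_indicator_card
      by (simp add: ennreal_of_nat_eq_real_of_nat ennreal_le_iff)
  qed
  then show "\<exists>C. \<forall>n. finite {x\<in>{0..1}. (T ^^ n) x = y} \<and> real (card {x\<in>{0..1}. (T ^^ n) x = y}) \<le> C * l ^ n" by blast
qed

text \<open>A path from i to j bounds x i below by a positive multiple of x j.\<close>

lemma superharmonic_pos:
  assumes super: "\<And>i. i \<in> P \<Longrightarrow> ennreal z * csum P (\<lambda>\<alpha>. ennreal (M i \<alpha>) * x \<alpha>) \<le> x i" and z: "0 < z"
    and j: "j \<in> P" "0 < x j" and i: "i \<in> P"
  shows "0 < x i"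
proof -
  obtain n where n: "1 \<le> mat_power P M n i j" using mat_power_eventually_ge_1[OF i j(1)] by blast
  have "ennreal z ^ n * x j \<le> ennreal z ^ n * (mat_power P M n i j * x j)"
    using mult_right_mono[OF n, of "x j"] by (intro mult_left_mono) auto
  also have "\<dots> \<le> ennreal z ^ n * csum P (\<lambda>\<alpha>. mat_power P M n i \<alpha> * x \<alpha>)"
    by (intro mult_left_mono csum_upper[OF j(1)]) auto
  also have "\<dots> \<le> x i" by (rule superharmonic_power[OF P_countable super i])
  finally have le: "ennreal z ^ n * x j \<le> x i" .
  have "ennreal z ^ n * x j \<noteq> 0" using z j(2) by simp
  then show ?thesis using le by (metis le_zero_eq not_gr_zero)
qed

lemma superharmonic_finite:
  assumes super: "\<And>i. i \<in> P \<Longrightarrow> ennreal z * csum P (\<lambda>\<alpha>. ennreal (M i \<alpha>) * x \<alpha>) \<le> x i" and z: "0 < z"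
    and j: "j \<in> P" "x j < \<infinity>" and i: "i \<in> P"
  shows "x i < \<infinity>"
proof -
  obtain n where n: "1 \<le> mat_power P M n j i" using mat_power_eventually_ge_1[OF j(1) i] by blast
  have "ennreal z ^ n * x i \<le> ennreal z ^ n * (mat_power P M n j i * x i)"
    using mult_right_mono[OF n, of "x i"] by (intro mult_left_mono) auto
  also have "\<dots> \<le> ennreal z ^ n * csum P (\<lambda>\<alpha>. mat_power P M n j \<alpha> * x \<alpha>)"
    by (intro mult_left_mono csum_upper[OF i]) auto
  also have "\<dots> \<le> x j" by (rule superharmonic_power[OF P_countable super j(1)])
  finally have "ennreal z ^ n * x i < \<infinity>" using j(2) by (rule le_less_trans)
  then show ?thesis using z by (auto simp: ennreal_mult_less_top)
qed

text \<open>In the iterated inequality at i the single term with target k is at most x i. Summing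
  over i bounds column k of the n-th power by a multiple of l ^ n.\<close>

lemma entropy_le_of_summable_superharmonic:
  assumes super: "\<And>i. i \<in> P \<Longrightarrow> ennreal (1 / l) * csum P (\<lambda>\<alpha>. ennreal (M i \<alpha>) * x \<alpha>) \<le> x i" and l: "1 \<le> l"
    and j: "j \<in> P" "0 < x j" and sum: "csum P x < \<infinity>"
  shows "h_top T \<le> ereal (ln l)"
proof (rule entropy_le_of_column_growth[OF l])
  fix k assume k: "k \<in> P"
  have l0: "0 < 1 / l" using l by simp
  have "0 < x k" by (rule superharmonic_pos[OF super l0 j k])
  moreover have "x k < \<infinity>" using csum_upper[OF k, of x] sum by (rule le_less_trans)
  ultimately obtain a where a: "x k = ennreal a" "0 < a" by (cases "x k") auto
  obtain s where s: "csum P x = ennreal s" "0 \<le> s" using sum by (cases "csum P x") auto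
  have "csum P (\<lambda>i. mat_power P M n i k) \<le> ennreal (s / a * l ^ n)" for n
  proof -
    have ln: "ennreal (1 / l) ^ n = ennreal (1 / l ^ n)" using l by (simp add: ennreal_power power_divide)
    have "ennreal (1 / l ^ n) * (csum P (\<lambda>i. mat_power P M n i k) * ennreal a)
       = csum P (\<lambda>i. ennreal (1 / l) ^ n * (mat_power P M n i k * x k))"
      by (simp add: csum_cmult csum_multc a ln)
    also have "\<dots> \<le> csum P x"
    proof (rule csum_mono)
      fix i assume i: "i \<in> P"
      have "ennreal (1 / l) ^ n * (mat_power P M n i k * x k) \<le> ennreal (1 / l) ^ n * csum P (\<lambda>\<alpha>. mat_power P M n i \<alpha> * x \<alpha>)"
        by (intro mult_left_mono csum_upper[OF k]) auto
      also have "\<dots> \<le> x i" by (rule superharmonic_power[OF P_countable super i])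
      finally show "ennreal (1 / l) ^ n * (mat_power P M n i k * x k) \<le> x i" .
    qed
    finally have le: "ennreal (1 / l ^ n) * (csum P (\<lambda>i. mat_power P M n i k) * ennreal a) \<le> ennreal s" unfolding s .
    have "csum P (\<lambda>i. mat_power P M n i k) = ennreal (l ^ n / a) * (ennreal (1 / l ^ n) * (csum P (\<lambda>i. mat_power P M n i k) * ennreal a))"
    proof -
      have "ennreal (l ^ n / a) * ennreal (1 / l ^ n) * ennreal a = 1" using a l by (simp add: ennreal_mult[symmetric])
      then show ?thesis by (metis (no_types, lifting) mult.assoc mult.commute mult.right_neutral)
    qed
    also have "\<dots> \<le> ennreal (l ^ n / a) * ennreal s" by (intro mult_left_mono le) auto
    also have "\<dots> = ennreal (s / a * l ^ n)" using a l s by (simp add: ennreal_mult[symmetric] field_simps)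
    finally show ?thesis .
  qed
  then show "\<exists>C. \<forall>n. csum P (\<lambda>i. mat_power P M n i k) \<le> ennreal (C * l ^ n)" by blast
qed

text \<open>One N serves all k, because the iterate covers the entire window. A single inequality at
  j then contains every x k with coefficient at least z ^ N.\<close>

lemma superharmonic_window_summable:
  assumes super: "\<And>i. i \<in> P \<Longrightarrow> ennreal z * csum P (\<lambda>\<alpha>. ennreal (M i \<alpha>) * x \<alpha>) \<le> x i" and z: "0 < z"
    and j: "j \<in> P" "x j < \<infinity>" and ab: "0 < a" "b < 1" and P': "P' \<subseteq> P" "\<Union>P' \<subseteq> {a..b}"
  shows "csum P' x < \<infinity>"
proof -
  obtain N where N: "{a..b} \<subseteq> (T ^^ N) ` interior j" using P_covers[OF j(1) ab] by blast
  have one: "1 \<le> mat_power P M N j k" if k: "k \<in> P'" for k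
  proof -
    have kP: "k \<in> P" using k P' by blast
    obtain y where y: "gen y" "y \<in> interior k" using gen_in_P[OF kP, of "{}"] by auto
    have "y \<in> {a..b}" using y(2) interior_subset k P'(2) by blast
    then obtain x where x: "x \<in> j" "(T ^^ N) x = y" using N interior_subset[of j] by blast
    then show ?thesis unfolding mat_power_count[OF j(1) kP y]
      using csum_upper[OF x(1), of "\<lambda>x. if (T ^^ N) x = y then 1 else 0"] by simp
  qed
  have "ennreal z ^ N * csum P' x \<le> ennreal z ^ N * csum P' (\<lambda>k. mat_power P M N j k * x k)"
    using one mult_right_mono[of 1 "mat_power P M N j _" "x _"] by (intro mult_left_mono csum_mono) auto
  also have "\<dots> \<le> ennreal z ^ N * csum P (\<lambda>k. mat_power P M N j k * x k)"
    by (intro mult_left_mono csum_mono_set P') auto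
  also have "\<dots> \<le> x j" by (rule superharmonic_power[OF P_countable super j(1)])
  finally have "ennreal z ^ N * csum P' x < \<infinity>" using j(2) by (rule le_less_trans)
  then show ?thesis using z by (auto simp: ennreal_mult_less_top)
qed

text \<open>Divergence is known beyond the radius but not at it, so the horseshoe bound is applied
  slightly above \<rho>.\<close>

lemma entropy_ge_rad:
  assumes rad: "rad = ennreal \<rho>" and \<rho>: "0 < \<rho>" shows "ereal (- ln \<rho>) \<le> h_top T"
proof (rule ccontr)
  assume "\<not> ?thesis"
  then have "h_top T < ereal (- ln \<rho>)" by simp
  then obtain h where h: "h_top T < ereal h" "h < - ln \<rho>" using ereal_dense2 by (metis less_ereal.simps(1))
  obtain i where i: "i \<in> P" using P_nonempty by blast
  have "exp (ln \<rho>) < exp (- h)" using h(2) by (subst exp_less_cancel_iff) simp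
  then have "\<rho> < exp (- h)" using \<rho> by simp
  then have "green P M i i (ennreal (exp (- h))) = \<infinity>"
    by (intro green_infinite_above_rad i) (simp add: rad ennreal_less_iff less_imp_le \<rho>)
  then have "ereal (- ln (exp (- h))) \<le> h_top T" by (rule entropy_ge_of_green_infinite[OF i exp_gt_zero])
  then show False using h(1) by simp
qed

end

section \<open>Comparison of the perturbed with the unperturbed map\<close>

lemma le_ereal_lnI:
  assumes "0 < m" and le: "\<And>l. m < l \<Longrightarrow> x \<le> ereal (ln l)" shows "x \<le> ereal (ln m)"
proof (rule ccontr)
  assume "\<not> ?thesis"
  then have "ereal (ln m) < x" by simp
  then obtain h where h: "ln m < h" "ereal h < x" using ereal_dense2 by (metis less_ereal.simps(1))
  then have "exp (ln m) < exp h" by (subst exp_less_cancel_iff)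
  then have "x \<le> ereal (ln (exp h))" using assms(1) by (intro le) simp
  then show False using h(2) by simp
qed

text \<open>Recurrence is witnessed on some partition \<open>Q\<close> for
  \<open>transition_matrix T\<close>, whereas \<open>P\<close> may carry a matrix obtained from
  another map. The divergence of the Green function at R and its finiteness below R survive this
  change, so recurrence is carried over in that form.\<close>

lemma recurrent_green:
  assumes mm: "markov_map T P L M" and T: "T \<in> CPMM" and rec: "recurrent_map T"
  shows "\<exists>R. 0 < R \<and> (\<forall>i\<in>P. \<forall>j\<in>P. green P M i j (ennreal R) = \<infinity> \<and> (\<forall>z. 0 < z \<longrightarrow> z < R \<longrightarrow> green P M i j (ennreal z) < \<infinity>))"
proof -
  obtain Q where Q: "markov_partition T Q" "recurrent_matrix Q (transition_matrix T)"
    using rec unfolding recurrent_map_def by blast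
  interpret Q: markov_setting T Q by unfold_locales (use T Q in \<open>auto simp: CPMM_def\<close>)
  have mQ: "markov_map T Q (laps T Q) (transition_matrix T)" by (rule Q.markov_map_laps)
  interpret Qm: markov_map T Q "laps T Q" "transition_matrix T" by (rule mQ)
  obtain q where q: "q \<in> Q" using Qm.P_nonempty by blast
  have F: "first_passage_series Q (transition_matrix T) q q Qm.rad = 1"
    using Q(2) q unfolding recurrent_matrix_def Qm.rad_def by blast
  have "Qm.rad < \<infinity>" using Qm.rad_le_1 by (auto intro: le_less_trans)
  then obtain R where R: "Qm.rad = ennreal R" "0 \<le> R" by (cases Qm.rad) auto
  have "R \<noteq> 0"
  proof
    assume "R = 0"
    then have "first_passage_series Q (transition_matrix T) q q Qm.rad = 0" by (simp add: first_passage_series_def R)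
    then show False using F by simp
  qed
  then have R0: "0 < R" using R by simp
  have inf: "green Q (transition_matrix T) q q (ennreal R) = \<infinity>"
    using green_infinite_of_passage_ge[OF Q.P_countable q, of "transition_matrix T" Qm.rad] F R by simp
  have "green P M i j (ennreal R) = \<infinity>" if "i \<in> P" "j \<in> P" for i j
    using green_infinite_change_partition[OF mQ mm _ q q inf that] R0 by simp
  moreover have "green P M i j (ennreal z) < \<infinity>" if ij: "i \<in> P" "j \<in> P" and z: "0 < z" "z < R" for i j z
  proof (rule ccontr)
    assume "\<not> green P M i j (ennreal z) < \<infinity>"
    then have "green P M i j (ennreal z) = \<infinity>" by (metis infinity_ennreal_def top.not_eq_extremum)
    then have "green Q (transition_matrix T) q q (ennreal z) = \<infinity>"
      using green_infinite_change_partition[OF mm mQ _ ij _ q q] z by simp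
    moreover have "green Q (transition_matrix T) q q (ennreal z) < \<infinity>"
      using z R by (intro Qm.green_finite_below_rad q) (simp add: ennreal_less_iff)
    ultimately show False by simp
  qed
  ultimately show ?thesis using R0 by blast
qed

lemma transition_matrix_nonneg: "0 \<le> transition_matrix S i j"
  by (simp add: transition_matrix_def)

lemma window_perturbation_trivial:
  assumes "window_perturbation S P {} T" shows "h_top T = h_top S"
  using assms by (intro topological_entropy_cong) (auto simp: window_perturbation_def CPMM_def interval_map_def)

lemma first_passage_mono:
  assumes P: "countable P" and le: "\<And>i \<alpha>. i \<in> P \<Longrightarrow> M i \<alpha> \<le> M' i \<alpha>" and i: "i \<in> P"
  shows "first_passage P M n i j \<le> first_passage P M' n i j"
  using i
proof (induction n arbitrary: i rule: less_induct)
  case (less n)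
  consider "n = 0" | "n = Suc 0" | m where "n = Suc (Suc m)" by (metis not0_implies_Suc)
  then show ?case
  proof cases
    case 2
    then show ?thesis using le[OF less.prems] by (simp add: ennreal_leI)
  next
    case 3
    then show ?thesis unfolding 3 first_passage_Suc_csum[OF P]
      using less.IH[of "Suc m"] 3 less.prems le by (intro csum_mono mult_mono ennreal_leI) auto
  qed simp
qed

text \<open>Both maps are viewed on the same partition, with matrices that differ only by the row
  factors \<open>c\<close>. This makes their first passage series and superharmonic vectors
  comparable.\<close>

locale centralized_setting =
  fixes S :: "real \<Rightarrow> real" and P P' :: "real set set" and T :: "real \<Rightarrow> real" and sr :: real
    and L and c :: "real set \<Rightarrow> real"
  assumes S: "S \<in> CPMM" and mp: "markov_partition S P"
    and rep: "represents_l1_operator P (transition_matrix S)"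
    and sr: "sr = l1_spectral_radius P (matrix_operator P (transition_matrix S))"
    and perron: "ennreal sr = perron_value P (transition_matrix S)"
    and cp: "centralized_perturbation S P P' T" and ne: "P' \<noteq> {}" and rec: "recurrent_map T"
    and mT: "markov_map T P L (\<lambda>i j. c i * transition_matrix S i j)"
    and c: "\<And>i. i \<in> P' \<Longrightarrow> 3 \<le> c i" "\<And>i. i \<notin> P' \<Longrightarrow> c i = 1"
begin

abbreviation "matS \<equiv> transition_matrix S"
abbreviation "matT \<equiv> \<lambda>i j. c i * transition_matrix S i j"

sublocale S: markov_setting S P
  by unfold_locales (use S mp in \<open>auto simp: CPMM_def\<close>)

sublocale A: markov_map S P "laps S P" matS by (rule S.markov_map_laps)

sublocale B: markov_map T P L matT by (rule mT)

lemma T: "T \<in> CPMM" and P': "P' \<subseteq> P"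
proof -
  have "window_perturbation S P P' T" using cp unfolding centralized_perturbation_def by (rule conjunct1)
  then show "T \<in> CPMM" "P' \<subseteq> P" by (simp_all only: window_perturbation_def)
qed

text \<open>The radius is at most 1, and it is not 0 because its reciprocal is the finite number
  \<open>sr\<close>.\<close>

lemma rad_S: "A.rad = ennreal (1 / sr)" and sr_ge_1: "1 \<le> sr"
proof -
  have p: "ennreal sr = 1 / A.rad" unfolding perron perron_value_def A.rad_def ..
  obtain \<rho> where \<rho>: "A.rad = ennreal \<rho>" "0 \<le> \<rho>" "\<rho> \<le> 1"
    using A.rad_le_1 by (cases A.rad) (auto simp flip: ennreal_1 simp: top_unique)
  have "\<rho> \<noteq> 0" using p \<rho> by (auto simp: ennreal_divide_zero)
  then have \<rho>0: "0 < \<rho>" using \<rho> by simp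
  have "1 / A.rad = ennreal (1 / \<rho>)" unfolding \<rho>(1) using \<rho>0 by (simp add: divide_ennreal flip: ennreal_1)
  then have "ennreal sr = ennreal (1 / \<rho>)" using p by simp
  moreover have "0 < 1 / \<rho>" using \<rho>0 by simp
  ultimately have eq: "sr = 1 / \<rho>" by (metis ennreal_eq_0_iff ennreal_inj less_imp_le linorder_not_le)
  then show "A.rad = ennreal (1 / sr)" "1 \<le> sr" using \<rho> \<rho>0 by simp_all
qed

lemma entropy_S_ge: "ereal (ln sr) \<le> h_top S"
  using A.entropy_ge_rad[OF rad_S] sr_ge_1 by (simp add: ln_div)

lemma column_growth: "sr < l \<Longrightarrow> \<exists>C. \<forall>n. \<forall>j\<in>P. csum P (\<lambda>i. mat_power P matS n i j) \<le> ennreal (C * l ^ n)"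
  unfolding sr by (rule represents_l1_colsum_growth[OF A.P_countable transition_matrix_nonneg rep])

text \<open>Column growth is known at every rate above \<open>sr\<close>, not at \<open>sr\<close>
  itself, hence the approximation from above.\<close>

lemma entropy_S_le: "h_top S \<le> ereal (ln sr)"
proof (rule le_ereal_lnI)
  show "0 < sr" using sr_ge_1 by simp
  fix l assume l: "sr < l"
  show "h_top S \<le> ereal (ln l)"
  proof (rule A.entropy_le_of_column_growth)
    show "1 \<le> l" using sr_ge_1 l by simp
    show "\<exists>C. \<forall>n. csum P (\<lambda>i. mat_power P matS n i j) \<le> ennreal (C * l ^ n)" if "j \<in> P" for j
      using column_growth[OF l] that by blast
  qed
qed

lemma superharmonic_to_summable:
  assumes l: "sr < l" and v_fin: "\<And>i. i \<in> P \<Longrightarrow> v i < \<infinity>" and v_pos: "\<And>i. i \<in> P \<Longrightarrow> 0 < v i"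
    and super: "\<And>i. i \<in> P \<Longrightarrow> ennreal (1 / l) * csum P (\<lambda>\<alpha>. ennreal (matT i \<alpha>) * v \<alpha>) \<le> v i"
  shows "\<exists>u. csum P u < \<infinity> \<and> (\<forall>i\<in>P'. 0 < u i) \<and>
    (\<forall>i\<in>P. ennreal (1 / l) * csum P (\<lambda>\<alpha>. ennreal (matT i \<alpha>) * u \<alpha>) \<le> u i)"
proof -
  obtain a b where ab: "{a, b} \<subseteq> {0<..<1}" "\<Union>P' \<subseteq> {a..b}"
    using cp ne unfolding centralized_perturbation_def by blast
  obtain j where j: "j \<in> P" using A.P_nonempty by blast
  have l0: "0 < 1 / l" using l sr_ge_1 by simp
  \<comment> \<open>A rate strictly between: column growth is available only above
    \<open>sr\<close>, and the potential needs it below \<open>l\<close>.\<close>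
  define l' where "l' = (sr + l) / 2"
  have l': "sr < l'" "l' < l" using l by (simp_all add: l'_def)
  obtain C where C: "\<And>n j. j \<in> P \<Longrightarrow> csum P (\<lambda>i. mat_power P matS n i j) \<le> ennreal (C * l' ^ n)"
    using column_growth[OF l'(1)] by blast
  have "csum P' v < \<infinity>"
    by (rule B.superharmonic_window_summable[OF super l0 j v_fin[OF j] _ _ P' ab(2)]) (use ab in auto)
  then show ?thesis
    by (intro summable_superharmonic[OF A.P_countable transition_matrix_nonneg P' c _ l'(2) C v_fin v_pos _ super])
      (use l'(1) sr_ge_1 in auto)
qed

text \<open>The vector is a Green column at 1 / l: l > 1 / R makes it finite, and l > sr allows it
  to be replaced by a summable one.\<close>

lemma entropy_T_le:
  assumes R: "0 < R" and fin: "\<And>i j z. i \<in> P \<Longrightarrow> j \<in> P \<Longrightarrow> 0 < z \<Longrightarrow> z < R \<Longrightarrow> green P matT i j (ennreal z) < \<infinity>"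
  shows "h_top T \<le> ereal (ln (max (1 / R) sr))"
proof (rule le_ereal_lnI)
  show "0 < max (1 / R) sr" using R by (simp add: less_max_iff_disj)
  fix l assume "max (1 / R) sr < l"
  then have l: "1 / R < l" "sr < l" by simp_all
  have l0: "0 < l" "1 \<le> l" using l sr_ge_1 by linarith+
  have lR: "0 < 1 / l" "1 / l < R" using l(1) l0 R by (simp_all add: field_simps)
  obtain j where j: "j \<in> P'" "j \<in> P" using ne P' by blast
  define v where "v i = green P matT i j (ennreal (1 / l))" for i
  have super: "ennreal (1 / l) * csum P (\<lambda>\<alpha>. ennreal (matT i \<alpha>) * v \<alpha>) \<le> v i" for i
    unfolding v_def by (subst (2) green_eq[OF A.P_countable]) simp
  have vj: "0 < v j" unfolding v_def by (subst green_eq[OF A.P_countable]) (simp add: add_pos_nonneg)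
  have v_pos: "0 < v i" if "i \<in> P" for i by (rule B.superharmonic_pos[OF super lR(1) j(2) vj that])
  have v_fin: "v i < \<infinity>" if "i \<in> P" for i unfolding v_def by (rule fin[OF that j(2) lR])
  obtain u where u: "csum P u < \<infinity>" "\<And>i. i \<in> P' \<Longrightarrow> 0 < u i"
    "\<And>i. i \<in> P \<Longrightarrow> ennreal (1 / l) * csum P (\<lambda>\<alpha>. ennreal (matT i \<alpha>) * u \<alpha>) \<le> u i"
    using superharmonic_to_summable[OF l(2) v_fin v_pos super] by blast
  show "h_top T \<le> ereal (ln l)"
    by (rule B.entropy_le_of_summable_superharmonic[OF u(3) l0(2) j(2) u(2)[OF j(1)] u(1)])
qed

lemma linearizable_T:
  assumes h: "h_top S < h_top T" shows "linearizable T"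
proof -
  obtain R where R: "0 < R" "\<And>i j. i \<in> P \<Longrightarrow> j \<in> P \<Longrightarrow> green P matT i j (ennreal R) = \<infinity>"
    "\<And>i j z. i \<in> P \<Longrightarrow> j \<in> P \<Longrightarrow> 0 < z \<Longrightarrow> z < R \<Longrightarrow> green P matT i j (ennreal z) < \<infinity>"
    using recurrent_green[OF mT T rec] by blast
  obtain j where j: "j \<in> P'" "j \<in> P" using ne P' by blast
  define l where "l = 1 / R"
  have l0: "0 < l" "1 / l = R" using R(1) by (simp_all add: l_def)
  have le: "h_top T \<le> ereal (ln (max l sr))" unfolding l_def by (rule entropy_T_le[OF R(1,3)])
  \<comment> \<open>Otherwise \<open>T\<close> would have entropy at most ln sr, hence at most that
    of \<open>S\<close>.\<close>
  have sl: "sr < l"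
  proof (rule ccontr)
    assume "\<not> sr < l"
    then have "h_top T \<le> ereal (ln sr)" using le by (simp add: max_def split: if_splits)
    then show False using entropy_S_ge h by (meson leD order_trans)
  qed
  have "ereal (- ln R) \<le> h_top T" by (rule B.entropy_ge_of_green_infinite[OF j(2) R(1) R(2)[OF j(2,2)]])
  then have ht: "h_top T = ereal (ln l)" using le sl R(1) by (simp add: l_def ln_div max_def)
  \<comment> \<open>Recurrence gives F j = 1 at R, which turns the first passage vector into an
    exact eigenvector.\<close>
  define F where "F i = first_passage_series P matT i j (ennreal R)" for i
  have Fj: "F j = 1" unfolding F_def
    by (rule passage_eq_1_at_radius[OF A.P_countable j(2) R(1) R(3)[OF j(2,2)] R(2)[OF j(2,2)]])
  have eigen: "ennreal R * csum P (\<lambda>\<alpha>. ennreal (matT i \<alpha>) * F \<alpha>) = F i" for i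
    using first_passage_series_eq[OF A.P_countable j(2), of matT i "ennreal R"] Fj
    unfolding csum_remove[OF j(2), of "\<lambda>\<alpha>. ennreal (matT i \<alpha>) * F \<alpha>"] F_def[symmetric] by (simp add: distrib_left)
  have F_pos: "0 < F i" if "i \<in> P" for i
    by (rule B.superharmonic_pos[OF _ R(1) j(2) _ that]) (simp_all add: eigen Fj)
  have F_fin: "F i < \<infinity>" if "i \<in> P" for i
    by (rule B.superharmonic_finite[OF _ R(1) j(2) _ that]) (simp_all add: eigen Fj)
  obtain u where u: "csum P u < \<infinity>" "\<And>i. i \<in> P' \<Longrightarrow> 0 < u i"
    "\<And>i. i \<in> P \<Longrightarrow> ennreal (1 / l) * csum P (\<lambda>\<alpha>. ennreal (matT i \<alpha>) * u \<alpha>) \<le> u i"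
    using superharmonic_to_summable[OF sl F_fin F_pos eq_refl[OF eigen[folded l0(2)]]] by blast
  \<comment> \<open>The summable vector \<open>u\<close> is only superharmonic, but by minimality it
    dominates u j * F. Here u j > 0 because \<open>j\<close> was chosen in the window.\<close>
  have "csum P F * u j = csum P (\<lambda>i. F i * u j)" by (simp add: csum_multc)
  also have "\<dots> \<le> csum P u"
  proof (rule csum_mono)
    fix i assume i: "i \<in> P"
    show "F i * u j \<le> u i" unfolding F_def
      by (rule first_passage_series_le_super[OF A.P_countable j(2) _ i]) (use u(3) l0(2) in simp)
  qed
  finally have "csum P F * u j < \<infinity>" using u(1) by (rule le_less_trans)
  then have F_sum: "csum P F < \<infinity>" using u(2)[OF j(1)] by (auto simp: ennreal_mult_less_top)
  define v where "v i = enn2real (F i)" for i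
  have vF: "ennreal (v i) = F i" if "i \<in> P" for i using F_fin[OF that] by (simp add: v_def)
  interpret E: markov_eigenvector T P L matT v l
  proof
    show "0 < v i" if "i \<in> P" for i using F_pos[OF that] F_fin[OF that] by (simp add: v_def enn2real_positive_iff)
    have "csum P (\<lambda>i. ennreal (v i)) = csum P F" by (intro csum_cong vF)
    then show "csum P (\<lambda>i. ennreal (v i)) < \<infinity>" using F_sum by simp
    show "1 < l" using sl sr_ge_1 by simp
    show "csum P (\<lambda>j. ennreal (matT i j) * ennreal (v j)) = ennreal (l * v i)" if i: "i \<in> P" for i
    proof -
      have "csum P (\<lambda>j. ennreal (matT i j) * ennreal (v j)) = csum P (\<lambda>\<alpha>. ennreal (matT i \<alpha>) * F \<alpha>)"
        by (intro csum_cong) (simp add: vF)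
      also have "\<dots> = ennreal l * (ennreal R * csum P (\<lambda>\<alpha>. ennreal (matT i \<alpha>) * F \<alpha>))"
        using l0 R(1) by (simp add: mult.assoc[symmetric] ennreal_mult[symmetric] l_def)
      also have "\<dots> = ennreal l * ennreal (v i)" unfolding eigen vF[OF i] ..
      also have "\<dots> = ennreal (l * v i)" using l0(1) by (intro ennreal_mult[symmetric]) (simp_all add: v_def)
      finally show ?thesis .
    qed
  qed
  have "exp (real_of_ereal (h_top T)) = l" using l0(1) by (simp add: ht)
  then show ?thesis using E.conjugate_constant_slope unfolding linearizable_def by simp
qed

text \<open>Recurrence of \<open>S\<close> fixes its first return series at R to be 1. The series of
  \<open>T\<close> exceeds 1 there, hence already at some z < R, where its Green function diverges
  and - ln z bounds the entropy from below.\<close>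

lemma entropy_increases:
  assumes recS: "recurrent_map S" shows "h_top S < h_top T"
proof -
  obtain R where R: "0 < R" "\<And>i j. i \<in> P \<Longrightarrow> j \<in> P \<Longrightarrow> green P matS i j (ennreal R) = \<infinity>"
    "\<And>i j z. i \<in> P \<Longrightarrow> j \<in> P \<Longrightarrow> 0 < z \<Longrightarrow> z < R \<Longrightarrow> green P matS i j (ennreal z) < \<infinity>"
    using recurrent_green[OF S.markov_map_laps S recS] by blast
  obtain j where j: "j \<in> P'" "j \<in> P" using ne P' by blast
  \<comment> \<open>The R from recurrence and the radius known from the spectral hypothesis separate
    the same finite and infinite values of the Green function.\<close>
  have "R = 1 / sr"
  proof (rule antisym; rule ccontr)
    assume "\<not> R \<le> 1 / sr"
    then have z: "0 < (R + 1 / sr) / 2" "(R + 1 / sr) / 2 < R" "1 / sr < (R + 1 / sr) / 2"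
      using sr_ge_1 R(1) by (auto intro!: add_pos_nonneg)
    have "A.rad < ennreal ((R + 1 / sr) / 2)"
      unfolding rad_S using z(3) sr_ge_1 by (subst ennreal_less_iff) auto
    then show False using A.green_infinite_above_rad[OF j(2,2)] R(3)[OF j(2,2) z(1,2)] by fastforce
  next
    assume "\<not> 1 / sr \<le> R"
    then have "ennreal R < A.rad" unfolding rad_S using R(1) by (subst ennreal_less_iff) auto
    then show False using A.green_finite_below_rad[OF j(2,2)] R(2)[OF j(2,2)] by fastforce
  qed
  have one: "first_passage_series P matS j j (ennreal R) = 1"
    by (rule passage_eq_1_at_radius[OF A.P_countable j(2) R(1) R(3)[OF j(2,2)] R(2)[OF j(2,2)]])
  have c1: "1 \<le> c i" for i using c[of i] by (cases "i \<in> P'") auto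
  have MST: "matS i \<alpha> \<le> matT i \<alpha>" for i \<alpha>
    using mult_right_mono[OF c1[of i] transition_matrix_nonneg[of S i \<alpha>]] by simp
  have FST: "first_passage_series P matS i j z \<le> first_passage_series P matT i j z" if "i \<in> P" for i z
    unfolding first_passage_series_def
    by (intro suminf_le mult_right_mono first_passage_mono[OF A.P_countable MST that]) auto
  have MST3: "ennreal 3 * ennreal (matS j \<alpha>) \<le> ennreal (matT j \<alpha>)" for \<alpha>
  proof -
    have "ennreal 3 * ennreal (matS j \<alpha>) = ennreal (3 * matS j \<alpha>)"
      by (rule ennreal_mult[symmetric]) (simp_all add: transition_matrix_nonneg)
    also have "\<dots> \<le> ennreal (matT j \<alpha>)"
      by (intro ennreal_leI mult_right_mono c(1)[OF j(1)] transition_matrix_nonneg)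
    finally show ?thesis .
  qed
  \<comment> \<open>The factor 3 comes from the first step out of \<open>j\<close>; for the later
    steps monotonicity in the matrix suffices.\<close>
  have "ennreal 3 * first_passage_series P matS j j (ennreal R)
     = ennreal R * (ennreal 3 * ennreal (matS j j)) + ennreal R * csum (P - {j}) (\<lambda>\<alpha>. (ennreal 3 * ennreal (matS j \<alpha>)) * first_passage_series P matS \<alpha> j (ennreal R))"
    by (subst first_passage_series_eq[OF A.P_countable j(2)]) (simp add: distrib_left csum_cmult ac_simps)
  also have "\<dots> \<le> ennreal R * ennreal (matT j j) + ennreal R * csum (P - {j}) (\<lambda>\<alpha>. ennreal (matT j \<alpha>) * first_passage_series P matT \<alpha> j (ennreal R))"
    by (intro add_mono mult_left_mono csum_mono mult_mono MST3 FST) auto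
  also have "\<dots> = first_passage_series P matT j j (ennreal R)"
    by (rule first_passage_series_eq[OF A.P_countable j(2), symmetric])
  finally have "ennreal 3 \<le> first_passage_series P matT j j (ennreal R)" unfolding one mult_1_right .
  moreover have "ennreal 1 < ennreal 3" by (subst ennreal_less_iff) simp_all
  ultimately have "1 < first_passage_series P matT j j (ennreal R)" unfolding ennreal_1 by (rule less_le_trans[rotated])
  from passage_gt_1_before[OF R(1) this] obtain z where z: "0 < z" "z < R" "1 < first_passage_series P matT j j (ennreal z)" by blast
  have "green P matT j j (ennreal z) = \<infinity>"
    by (rule green_infinite_of_passage_ge[OF A.P_countable j(2) less_imp_le[OF z(3)]])
  then have ge: "ereal (- ln z) \<le> h_top T" by (rule B.entropy_ge_of_green_infinite[OF j(2) z(1)])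
  have "ln z < ln R" using z by (subst ln_less_cancel_iff) auto
  then have "ln sr < - ln z" using \<open>R = 1 / sr\<close> sr_ge_1 by (simp add: ln_div)
  then have "h_top S < ereal (- ln z)" using entropy_S_le by (auto intro: le_less_trans)
  then show ?thesis using ge by (rule less_le_trans)
qed

end

text \<open>The empty perturbation counts as centralized and leaves the entropy unchanged, so strict
  increase is asserted for P' \<noteq> {}. In the first part the entropy assumption excludes that
  case.\<close>

theorem theorem11:
  fixes S :: "real \<Rightarrow> real" and P :: "real set set"
  assumes "S \<in> CPMM"
    and "operator_type S"
    and "markov_partition S P"
    and "represents_l1_operator P (transition_matrix S)"
    and "ennreal (l1_spectral_radius P (matrix_operator P (transition_matrix S))) =
      perron_value P (transition_matrix S)"
  shows "(\<forall>P' T. centralized_perturbation S P P' T \<and> recurrent_map T \<and> h_top T > h_top S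
             \<longrightarrow> linearizable T) \<and>
         (recurrent_map S \<longrightarrow>
           (\<forall>P' T. centralized_perturbation S P P' T \<and> recurrent_map T \<and> P' \<noteq> {}
             \<longrightarrow> h_top T > h_top S))"
proof -
  have setting: "\<exists>L c. centralized_setting S P P' T (l1_spectral_radius P (matrix_operator P (transition_matrix S))) L c"
    if cp: "centralized_perturbation S P P' T" and rec: "recurrent_map T" and ne: "P' \<noteq> {}" for P' T
  proof -
    have "window_perturbation S P P' T" using cp unfolding centralized_perturbation_def by blast
    then obtain L c where "markov_map T P L (\<lambda>i j. c i * transition_matrix S i j)"
      "\<forall>i\<in>P'. 3 \<le> c i" "\<forall>i. i \<notin> P' \<longrightarrow> c i = (1::real)"
      using perturbation_markov_map by meson
    then have "centralized_setting S P P' T (l1_spectral_radius P (matrix_operator P (transition_matrix S))) L c"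
      using assms(1,3,4,5) cp rec ne by (intro centralized_setting.intro) simp_all
    then show ?thesis by blast
  qed
  show ?thesis
  proof (intro conjI allI impI; elim conjE)
    fix P' T assume cp: "centralized_perturbation S P P' T" and rec: "recurrent_map T" and h: "h_top S < h_top T"
    have "P' \<noteq> {}"
      using window_perturbation_trivial[of S P T] cp h unfolding centralized_perturbation_def by auto
    then obtain L c where "centralized_setting S P P' T (l1_spectral_radius P (matrix_operator P (transition_matrix S))) L c"
      using setting[OF cp rec] by blast
    then show "linearizable T" using h by (rule centralized_setting.linearizable_T)
  next
    fix P' T assume recS: "recurrent_map S" and cp: "centralized_perturbation S P P' T" and rec: "recurrent_map T" and ne: "P' \<noteq> {}"
    then obtain L c where "centralized_setting S P P' T (l1_spectral_radius P (matrix_operator P (transition_matrix S))) L c"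
      using setting[OF cp rec ne] by blast
    then show "h_top S < h_top T" using recS by (rule centralized_setting.entropy_increases)
  qed
qed

end
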